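(* Let $n$ be an integer with $2\le n\le 4$, let $f:\mathbb{R}^n\to(0,\infty)$ be an even continuous positive function, and let $\mu$ be the measure on $\mathbb{R}^n$ with density $f$ (with measures of hyperplane sections defined by integrating $f$ over the section). If $K$ is an origin-symmetric convex body in $\mathbb{R}^n$, then $$\mu(K)\le \frac{n}{n-1}\,\max_{\xi\in S^{n-1}}\mu(K\cap\xi^\perp)\ \mathrm{Vol}_n(K)^{1/n}.$$
   Context: $S^{n-1}$ is the Euclidean unit sphere in $\mathbb{R}^n$, and for $\xi\in S^{n-1}$, $\xi^\perp=\{x\in\mathbb{R}^n: \langle x,\xi\rangle=0\}$ is the central hyperplane perpendicular to $\xi$. A convex body is a compact convex set having the origin as an interior point; it is origin-symmetric if $K=-K$. $\mathrm{Vol}_n$ is $n$-dimensional Lebesgue measure. For a closed bounded set $B\subset\mathbb{R}^n$, $\mu(B)=\int_B f(x)\,dx$ with $dx$ the Lebesgue measure on $\mathbb{R}^n$; for a closed bounded set $B\subset\xi^\perp$ (a section), $\mu(B)=\int_B f(x)\,dx$ with $dx$ the $(n-1)$-dimensional Lebesgue measure on $\xi^\perp$. *)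

theory Defs
  imports "HOL-Analysis.Analysis"
begin

definition convex_body :: "'a::euclidean_space set \<Rightarrow> bool" where
  "convex_body K \<longleftrightarrow> compact K \<and> convex K \<and> 0 \<in> interior K"

definition origin_symmetric :: "'a::euclidean_space set \<Rightarrow> bool" where
  "origin_symmetric K \<longleftrightarrow> uminus ` K = K"

definition perp_hyperplane :: "'a::euclidean_space \<Rightarrow> 'a set" where
  "perp_hyperplane \<xi> = {x. x \<bullet> \<xi> = 0}"

definition orthonormal_basis_of :: "'a::euclidean_space set \<Rightarrow> 'a set \<Rightarrow> bool" where
  "orthonormal_basis_of S B \<longleftrightarrow>
     pairwise orthogonal B \<and> (\<forall>b\<in>B. norm b = 1) \<and> span B = S"

lemma orthonormal_basis_of_exists:
  assumes "subspace S"
  shows "\<exists>B. orthonormal_basis_of S B"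
  using orthonormal_basis_subspace[OF assms] unfolding orthonormal_basis_of_def by metis

(* The Lebesgue measure of dimension dim S on a linear subspace S, as a Borel measure on the
   ambient space concentrated on S.  It is the image of the product of one-dimensional Lebesgue
   measures under the isometric coordinate map of an orthonormal basis of S, as in lborel_def,
   where S is the whole space with the standard basis.  Since Lebesgue measure is invariant
   under orthogonal maps, the choice of the orthonormal basis is immaterial. *)
definition subspace_lborel :: "'a::euclidean_space set \<Rightarrow> 'a measure" where
  "subspace_lborel S =
     (let B = (SOME B. orthonormal_basis_of S B)
      in distr (\<Pi>\<^sub>M b\<in>B. lborel) borel (\<lambda>x. \<Sum>b\<in>B. x b *\<^sub>R b))"

definition body_measure :: "('a::euclidean_space \<Rightarrow> real) \<Rightarrow> 'a set \<Rightarrow> real" where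
  "body_measure f K = (LINT x:K|lborel. f x)"

definition section_measure :: "('a::euclidean_space \<Rightarrow> real) \<Rightarrow> 'a set \<Rightarrow> 'a \<Rightarrow> real" where
  "section_measure f K \<xi> =
     (LINT x:K \<inter> perp_hyperplane \<xi>|subspace_lborel (perp_hyperplane \<xi>). f x)"

end

theory Submission
  imports Defs "HOL-Probability.Distributions"
begin

text \<open>
  Let K be a symmetric convex body in dimension n = 2, 3 or 4, let M be the largest measure of a
  central section of K with respect to the density f, and let radial K y be the reciprocal of the
  gauge of K. The inequality is the product of two bounds for the Gaussian integral

    Y = \<open>\<integral> exp (- |y|\<^sup>2 / 2) radial K y dy\<close>.

  The first, measure_le_gauss_radial, is \<open>(2 pi) powr ((n - 1) / 2) \<mu>(K) \<le> M Y\<close>,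
  and the second, nn_integral_gauss_radial_le, is \<open>Y \<le> n / (n - 1) (2 pi) powr ((n - 1) / 2)
  vol(K) powr (1 / n)\<close>. The second holds because Y is the integral over s > 0 of the Gaussian
  mass of K / s, which is bounded both by \<open>(2 pi) powr (n / 2)\<close> and by \<open>vol(K) / s
  ^ n\<close>.

  The first bound compares two measures by their central sections: the one with density f on K, whose
  sections are at most M, and the multiple of the Gaussian measure whose sections are all equal to M.
  Such a comparison is inherited by the integrals of any function that is the dual Radon transform of
  a nonnegative weight. If radial K is such a function, that is if K is an intersection body, the
  bound follows, since radial K is at least 1 on K. In dimension at most 4 this is the case by the
  analytic solution of the Busemann-Petty problem. The proof below does not invert the Radon
  transform. It writes down, for every scale \<open>\<epsilon>\<close>, a nonnegative weight P built
  from Gaussians and from the functions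

    slab K b \<open>\<xi>\<close> = \<open>\<integral> sqrt b exp (- b (x \<bullet> \<xi>)\<^sup>2)
    dx\<close> over K.

  All transforms of P are Gaussian integrals in two directions, so they can be computed: the transform
  of P at y is the integral over x in K of a positive kernel in the distance from x to the line
  through y (exists_kernel_weight). At small scale the kernel concentrates on that line, and its
  integral becomes the length of the chord of K through y, which is a multiple of radial K y
  (kern_potential_bounds).

  The weight P is nonnegative because slab K b \<open>\<xi>\<close> increases with b
  (slab_gauss_mono). This expresses that the central section of a symmetric convex body is the largest
  among its parallel sections, and it is proved by Steiner symmetrization. In dimension 2 positivity
  of slab suffices; in dimension 3 one difference in b gives an integrable kernel; in dimension 4 one
  needs a further difference in the Gaussian factor.

  The Radon transform itself appears only as a limit of integrals against thin Gaussian layers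
  (thin_transform), for which Fubini's theorem gives the duality, and section_comparison carries out
  the passage to the limit. The density f restricted to K is upper semicontinuous; this controls the
  upper limits that occur there, and it provides a section of maximal measure (sections_attain_max).
\<close>

abbreviation gauss :: "real \<Rightarrow> 'a::euclidean_space \<Rightarrow> ennreal" where
  "gauss c x \<equiv> ennreal (exp (- (c * (norm x)\<^sup>2)))"

abbreviation gauss_dir :: "real \<Rightarrow> real \<Rightarrow> 'a \<Rightarrow> 'a::euclidean_space \<Rightarrow> ennreal" where
  "gauss_dir c b v x \<equiv> ennreal (exp (- (c * (norm x)\<^sup>2 + b * (x \<bullet> v)\<^sup>2)))"

abbreviation slab_gauss :: "real \<Rightarrow> 'a \<Rightarrow> 'a::euclidean_space \<Rightarrow> ennreal" where
  "slab_gauss b \<xi> x \<equiv> ennreal (sqrt b * exp (- b * (x \<bullet> \<xi>)\<^sup>2))"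

section \<open>Lebesgue measure on hyperplanes\<close>

lemma nn_integral_lborel_cong_nonzero:
  fixes F G :: "'a::euclidean_space \<Rightarrow> ennreal"
  assumes eq: "\<And>y. y \<noteq> 0 \<Longrightarrow> F y = G y"
  shows "(\<integral>\<^sup>+y. F y \<partial>lborel) = (\<integral>\<^sup>+y. G y \<partial>lborel)"
  by (rule nn_integral_cong_AE, rule AE_mp[OF AE_lborel_singleton[of 0]], rule AE_I2, rule impI, rule eq)

lemma nn_integral_lborel_mono_nonzero:
  fixes F G :: "'a::euclidean_space \<Rightarrow> ennreal"
  assumes le: "\<And>y. y \<noteq> 0 \<Longrightarrow> F y \<le> G y"
  shows "(\<integral>\<^sup>+y. F y \<partial>lborel) \<le> (\<integral>\<^sup>+y. G y \<partial>lborel)"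
  by (rule nn_integral_mono_AE, rule AE_mp[OF AE_lborel_singleton[of 0]], rule AE_I2, rule impI, rule le)

lemma nn_integral_lborel_translate:
  fixes h :: "'a::euclidean_space \<Rightarrow> ennreal"
  assumes [measurable]: "h \<in> borel_measurable borel"
  shows "(\<integral>\<^sup>+x. h (c + x) \<partial>lborel) = (\<integral>\<^sup>+x. h x \<partial>lborel)"
proof -
  have "(\<integral>\<^sup>+x. h x \<partial>lborel) = (\<integral>\<^sup>+x. h x \<partial>distr lborel borel ((+) c))"
    by (simp add: lborel_distr_plus)
  then show ?thesis by (simp add: nn_integral_distr)
qed

lemma nn_integral_lborel_scale:
  fixes h :: "'a::euclidean_space \<Rightarrow> ennreal"
  assumes [measurable]: "h \<in> borel_measurable borel" and "c > 0"
  shows "(\<integral>\<^sup>+x. h x \<partial>lborel) = ennreal (c ^ DIM('a)) * (\<integral>\<^sup>+x. h (c *\<^sub>R x) \<partial>lborel)"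
proof -
  have "(\<integral>\<^sup>+x. h x \<partial>lborel) = (\<integral>\<^sup>+x. h x \<partial>density (distr lborel borel (\<lambda>x. 0 + c *\<^sub>R x)) (\<lambda>_. ennreal (\<bar>c\<bar> ^ DIM('a))))"
    using lborel_affine[of c "0::'a"] \<open>c > 0\<close> by simp
  also have "\<dots> = ennreal (c ^ DIM('a)) * (\<integral>\<^sup>+x. h (c *\<^sub>R x) \<partial>lborel)"
    using \<open>c > 0\<close> by (simp add: nn_integral_density nn_integral_distr nn_integral_cmult)
  finally show ?thesis .
qed

lemma norm_preserving_imp_bij:
  fixes T :: "'a::euclidean_space \<Rightarrow> 'a"
  assumes "linear T" "\<And>x. norm (T x) = norm x"
  shows "bij T"
proof -
  have "inj T"
    using assms by (metis linear_injective_0 norm_eq_zero)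
  then show ?thesis using assms(1) linear_injective_imp_surjective by (auto simp: bij_def)
qed

text \<open>
  Uniqueness of a translation invariant measure up to a factor: if B is the indicator of the unit
  ball, the double integral of h x * B (x - T y) is \<open>\<integral>h\<close> times the volume of
  the ball when y is integrated first, and \<open>\<integral>h \<circ> T\<close> times the same volume
  when x is shifted by T y before. The factor is 1 since T maps the unit ball to itself.
\<close>

lemma nn_integral_lborel_orthogonal:
  fixes T :: "'a::euclidean_space \<Rightarrow> 'a"
  assumes T: "linear T" "\<And>x. norm (T x) = norm x"
    and h[measurable]: "h \<in> borel_measurable borel"
  shows "(\<integral>\<^sup>+x. h (T x) \<partial>lborel) = (\<integral>\<^sup>+x. h x \<partial>lborel)"
proof -
  have [measurable]: "T \<in> borel_measurable borel"
    using T(1) by (simp add: borel_measurable_continuous_onI linear_continuous_on linear_linear)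
  define B :: "'a \<Rightarrow> ennreal" where "B = indicator (ball 0 1)"
  have [measurable]: "B \<in> borel_measurable borel" unfolding B_def by (intro borel_measurable_indicator borel_open open_ball)
  have BT: "B (T x) = B x" for x by (simp add: B_def T(2) indicator_def)
  have Bm: "B (- x) = B x" for x by (simp add: B_def indicator_def)
  define b where "b = (\<integral>\<^sup>+x. B x \<partial>lborel)"
  have b: "b = emeasure lborel (ball (0::'a) 1)" by (simp add: b_def B_def)
  have b_fin: "b < \<infinity>" unfolding b by (rule emeasure_lborel_ball_finite)
  have b_pos: "b > 0"
    using content_ball_pos[of 1 "0::'a"] by (auto simp: b measure_def zero_less_iff_neq_zero)
  have shiftT: "(\<integral>\<^sup>+y. g (T (c + y)) \<partial>lborel) = (\<integral>\<^sup>+y. g (T y) \<partial>lborel)"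
    if [measurable]: "g \<in> borel_measurable borel" for g :: "'a \<Rightarrow> ennreal" and c
    by (rule nn_integral_lborel_translate[of "\<lambda>y. g (T y)"]) measurable
  have "(\<integral>\<^sup>+y. \<integral>\<^sup>+x. h x * B (x - T y) \<partial>lborel \<partial>lborel) = (\<integral>\<^sup>+x. \<integral>\<^sup>+y. h x * B (x - T y) \<partial>lborel \<partial>lborel)"
    by (rule lborel_pair.Fubini') measurable
  also have "\<dots> = (\<integral>\<^sup>+x. h x * b \<partial>lborel)"
  proof (rule nn_integral_cong)
    fix x :: 'a
    obtain c where c: "x = T c" using norm_preserving_imp_bij[OF T] by (metis bij_pointE)
    have "(\<integral>\<^sup>+y. h x * B (x - T y) \<partial>lborel) = h x * (\<integral>\<^sup>+y. B (x - T y) \<partial>lborel)"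
      by (rule nn_integral_cmult) measurable
    also have "(\<integral>\<^sup>+y. B (x - T y) \<partial>lborel) = (\<integral>\<^sup>+y. B (- c + y) \<partial>lborel)"
    proof (rule nn_integral_cong)
      fix y
      have "x - T y = T (- (- c + y))"
        using T(1) by (simp add: c linear_diff)
      then show "B (x - T y) = B (- c + y)" using BT Bm by metis
    qed
    also have "\<dots> = b" unfolding b_def by (rule nn_integral_lborel_translate) measurable
    finally show "(\<integral>\<^sup>+y. h x * B (x - T y) \<partial>lborel) = h x * b" .
  qed
  also have "\<dots> = (\<integral>\<^sup>+x. h x \<partial>lborel) * b" by (rule nn_integral_multc) measurable
  finally have 1: "(\<integral>\<^sup>+y. \<integral>\<^sup>+x. h x * B (x - T y) \<partial>lborel \<partial>lborel) = (\<integral>\<^sup>+x. h x \<partial>lborel) * b" .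
  have "(\<integral>\<^sup>+y. \<integral>\<^sup>+x. h x * B (x - T y) \<partial>lborel \<partial>lborel) = (\<integral>\<^sup>+y. \<integral>\<^sup>+x. h (T y + x) * B x \<partial>lborel \<partial>lborel)"
  proof (rule nn_integral_cong)
    fix y
    show "(\<integral>\<^sup>+x. h x * B (x - T y) \<partial>lborel) = (\<integral>\<^sup>+x. h (T y + x) * B x \<partial>lborel)"
      using nn_integral_lborel_translate[of "\<lambda>x. h x * B (x - T y)" "T y"] by simp
  qed
  also have "\<dots> = (\<integral>\<^sup>+x. \<integral>\<^sup>+y. h (T y + x) * B x \<partial>lborel \<partial>lborel)"
    by (rule lborel_pair.Fubini') measurable
  also have "\<dots> = (\<integral>\<^sup>+x. (\<integral>\<^sup>+y. h (T y) \<partial>lborel) * B x \<partial>lborel)"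
  proof (rule nn_integral_cong)
    fix x :: 'a
    obtain c where c: "x = T c" using norm_preserving_imp_bij[OF T] by (metis bij_pointE)
    have "(\<integral>\<^sup>+y. h (T y + x) * B x \<partial>lborel) = (\<integral>\<^sup>+y. h (T (c + y)) \<partial>lborel) * B x"
      using T(1) by (simp add: c linear_add add.commute nn_integral_multc)
    then show "(\<integral>\<^sup>+y. h (T y + x) * B x \<partial>lborel) = (\<integral>\<^sup>+y. h (T y) \<partial>lborel) * B x"
      using shiftT[of h] by simp
  qed
  also have "\<dots> = (\<integral>\<^sup>+y. h (T y) \<partial>lborel) * b" unfolding b_def by (rule nn_integral_cmult) measurable
  finally have "(\<integral>\<^sup>+y. h (T y) \<partial>lborel) * b = (\<integral>\<^sup>+x. h x \<partial>lborel) * b" using 1 by simp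
  then show ?thesis using b_fin b_pos
    by (metis infinity_ennreal_def mult_divide_eq_ennreal not_gr_zero top.not_eq_extremum)
qed

lemma nn_integral_lborel_uminus:
  fixes h :: "'a::euclidean_space \<Rightarrow> ennreal"
  assumes "h \<in> borel_measurable borel"
  shows "(\<integral>\<^sup>+x. h (- x) \<partial>lborel) = (\<integral>\<^sup>+x. h x \<partial>lborel)"
  by (rule nn_integral_lborel_orthogonal[OF _ _ assms]) (auto intro: linearI)

lemma orthonormal_basis_of_props:
  fixes B :: "'a::euclidean_space set"
  assumes "orthonormal_basis_of S B"
  shows "finite B" "independent B" "span B = S" "\<And>b. b \<in> B \<Longrightarrow> norm b = 1"
    "\<And>b c. b \<in> B \<Longrightarrow> c \<in> B \<Longrightarrow> b \<bullet> c = (if b = c then 1 else 0)"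
proof -
  show n: "norm b = 1" if "b \<in> B" for b using assms that by (auto simp: orthonormal_basis_of_def)
  then have "0 \<notin> B" by force
  then show i: "independent B"
    using assms pairwise_orthogonal_independent by (auto simp: orthonormal_basis_of_def)
  then show "finite B" by (rule independent_imp_finite)
  show "span B = S" using assms by (auto simp: orthonormal_basis_of_def)
  show "b \<bullet> c = (if b = c then 1 else 0)" if "b \<in> B" "c \<in> B" for b c
    using assms that n[OF that(1)]
    by (auto simp: orthonormal_basis_of_def pairwise_def orthogonal_def dot_square_norm)
qed

text \<open>
  For the standard basis this is the definition of Lebesgue measure. A bijection
  \<open>\<beta>\<close> from the standard basis to B identifies the two product measures and extends
  to a linear isometry T, under which Lebesgue measure is invariant.
\<close>

lemma lborel_eq_distr_orthonormal_basis:
  fixes B :: "'a::euclidean_space set"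
  assumes B: "orthonormal_basis_of UNIV B"
  shows "distr (\<Pi>\<^sub>M b\<in>B. lborel) borel (\<lambda>u. \<Sum>b\<in>B. u b *\<^sub>R b) = lborel"
proof -
  note Bp = orthonormal_basis_of_props[OF B]
  have "card B = dim (span B)" using Bp(2) by (simp add: dim_eq_card_independent)
  then have "card B = card (Basis :: 'a set)" using Bp(3) by (simp add: dim_UNIV)
  then obtain \<beta> where \<beta>: "bij_betw \<beta> (Basis :: 'a set) B"
    using Bp(1) finite_same_card_bij finite_Basis by metis
  have \<beta>B: "\<beta> i \<in> B" if "i \<in> Basis" for i using \<beta> that by (auto simp: bij_betw_def)
  have \<beta>inj: "\<beta> i = \<beta> j \<longleftrightarrow> i = j" if "i \<in> Basis" "j \<in> Basis" for i j
    using \<beta> that by (auto simp: bij_betw_def inj_on_def)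
  define T where "T x = (\<Sum>i\<in>Basis. (x \<bullet> i) *\<^sub>R \<beta> i)" for x :: 'a
  have T: "linear T"
    by (auto intro!: linearI simp: T_def inner_add_left scaleR_add_left sum.distrib scaleR_sum_right)
  have Tn: "norm (T x) = norm x" for x
  proof -
    have "T x \<bullet> T x = (\<Sum>i\<in>Basis. \<Sum>j\<in>Basis. (x \<bullet> i) * ((x \<bullet> j) * (\<beta> j \<bullet> \<beta> i)))"
      by (simp add: T_def inner_sum_left inner_sum_right sum_distrib_left algebra_simps)
    also have "\<dots> = (\<Sum>i\<in>Basis. \<Sum>j\<in>Basis. if i = j then (x \<bullet> i) * (x \<bullet> j) else 0)"
      by (intro sum.cong refl) (auto simp: Bp(5) \<beta>B \<beta>inj)
    also have "\<dots> = x \<bullet> x" by (simp add: euclidean_inner[of x x])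
    finally show ?thesis by (simp add: norm_eq_sqrt_inner)
  qed
  have [measurable]: "T \<in> borel_measurable borel"
    using T by (simp add: borel_measurable_continuous_onI linear_continuous_on linear_linear)
  interpret L: product_sigma_finite "\<lambda>_::'a. lborel :: real measure" ..
  let ?P = "\<Pi>\<^sub>M b\<in>(Basis :: 'a set). lborel :: real measure" and ?Q = "\<Pi>\<^sub>M b\<in>B. lborel :: real measure"
  let ?r = "\<lambda>u::'a \<Rightarrow> real. \<lambda>b\<in>B. u (the_inv_into Basis \<beta> b) :: real"
  have inv: "the_inv_into Basis \<beta> b \<in> Basis" if "b \<in> B" for b
    using that \<beta> by (metis bij_betw_def order_refl the_inv_into_into)
  then have [measurable]: "?r \<in> measurable ?P ?Q" by (intro measurable_restrict) (auto intro!: measurable_component_singleton)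
  have re: "distr ?P ?Q ?r = ?Q"
  proof (rule L.PiM_eqI)
    fix A assume A: "\<And>i. i \<in> B \<Longrightarrow> A i \<in> sets (lborel :: real measure)"
    have "?r -` Pi\<^sub>E B A \<inter> space ?P = (\<Pi>\<^sub>E i\<in>Basis. A (\<beta> i))"
    proof (intro set_eqI iffI)
      fix u assume u: "u \<in> ?r -` Pi\<^sub>E B A \<inter> space ?P"
      show "u \<in> (\<Pi>\<^sub>E i\<in>Basis. A (\<beta> i))"
      proof (rule PiE_I)
        fix i :: 'a assume i: "i \<in> Basis"
        have "?r u (\<beta> i) \<in> A (\<beta> i)" using u \<beta>B[OF i] by (auto simp: PiE_iff)
        moreover have "the_inv_into Basis \<beta> (\<beta> i) = i" using \<beta> i by (simp add: bij_betw_def the_inv_into_f_f)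
        ultimately show "u i \<in> A (\<beta> i)" using \<beta>B[OF i] by simp
      qed (use u in \<open>auto simp: space_PiM PiE_def extensional_def\<close>)
    next
      fix u assume u: "u \<in> (\<Pi>\<^sub>E i\<in>Basis. A (\<beta> i))"
      have "?r u b \<in> A b" if b: "b \<in> B" for b
      proof -
        have "\<beta> (the_inv_into Basis \<beta> b) = b" using b \<beta> by (simp add: bij_betw_def f_the_inv_into_f)
        moreover have "u (the_inv_into Basis \<beta> b) \<in> A (\<beta> (the_inv_into Basis \<beta> b))"
          using u inv[OF b] by (auto simp: PiE_iff)
        ultimately show ?thesis using b by simp
      qed
      then show "u \<in> ?r -` Pi\<^sub>E B A \<inter> space ?P"
        using u by (auto simp: space_PiM PiE_iff)
    qed
    then have "emeasure (distr ?P ?Q ?r) (Pi\<^sub>E B A) = emeasure ?P (\<Pi>\<^sub>E i\<in>Basis. A (\<beta> i))"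
      using A Bp(1) by (subst emeasure_distr) (auto intro!: sets_PiM_I_finite)
    also have "\<dots> = (\<Prod>i\<in>Basis. emeasure lborel (A (\<beta> i)))"
      using A \<beta>B by (intro L.emeasure_PiM) auto
    also have "\<dots> = (\<Prod>b\<in>B. emeasure lborel (A b))"
      using \<beta> by (rule prod.reindex_bij_betw)
    finally show "emeasure (distr ?P ?Q ?r) (Pi\<^sub>E B A) = (\<Prod>b\<in>B. emeasure lborel (A b))" .
  qed (use Bp(1) in simp_all)
  have "distr ?Q borel (\<lambda>u. \<Sum>b\<in>B. u b *\<^sub>R b) = distr ?P borel ((\<lambda>u. \<Sum>b\<in>B. u b *\<^sub>R b) \<circ> ?r)"
    by (subst re[symmetric], rule distr_distr) measurable
  also have "\<dots> = distr ?P borel (T \<circ> (\<lambda>u. \<Sum>b\<in>Basis. u b *\<^sub>R b))"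
  proof (rule distr_cong)
    fix u assume "u \<in> space ?P"
    have "(\<Sum>b\<in>B. ?r u b *\<^sub>R b) = (\<Sum>i\<in>Basis. ?r u (\<beta> i) *\<^sub>R \<beta> i)"
      using sum.reindex_bij_betw[OF \<beta>, of "\<lambda>b. ?r u b *\<^sub>R b"] by simp
    also have "\<dots> = (\<Sum>i\<in>Basis. u i *\<^sub>R \<beta> i)"
      using \<beta> \<beta>B by (intro sum.cong) (auto simp: bij_betw_def the_inv_into_f_f)
    also have "\<dots> = T (\<Sum>b\<in>Basis. u b *\<^sub>R b)"
      by (simp add: T_def inner_sum_left_Basis)
    finally show "((\<lambda>u. \<Sum>b\<in>B. u b *\<^sub>R b) \<circ> ?r) u = (T \<circ> (\<lambda>u. \<Sum>b\<in>Basis. u b *\<^sub>R b)) u" by simp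
  qed simp_all
  also have "\<dots> = distr lborel borel T"
    by (subst lborel_eq, subst distr_distr) measurable
  also have "\<dots> = lborel"
  proof (rule measure_eqI)
    fix A assume "A \<in> sets (distr lborel borel T)"
    then have [measurable]: "A \<in> sets borel" by simp
    have "emeasure (distr lborel borel T) A = (\<integral>\<^sup>+x. indicator A x \<partial>distr lborel borel T)" by simp
    also have "\<dots> = (\<integral>\<^sup>+x. indicator A (T x) \<partial>lborel)" by (rule nn_integral_distr) measurable
    also have "\<dots> = (\<integral>\<^sup>+x. indicator A x \<partial>lborel)" by (rule nn_integral_lborel_orthogonal[OF T Tn]) measurable
    finally show "emeasure (distr lborel borel T) A = emeasure lborel A" by simp
  qed simp
  finally show ?thesis .
qed

abbreviation perp_lborel :: "'a::euclidean_space \<Rightarrow> 'a measure" where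
  "perp_lborel \<xi> \<equiv> subspace_lborel (perp_hyperplane \<xi>)"

lemma subspace_perp_hyperplane: "subspace (perp_hyperplane \<xi>)"
  by (auto simp: subspace_def perp_hyperplane_def inner_add_left)

lemma space_subspace_lborel [simp]: "space (subspace_lborel S) = UNIV"
  by (simp add: subspace_lborel_def Let_def)

lemma sets_subspace_lborel [simp, measurable_cong]: "sets (subspace_lborel S) = sets borel"
  by (simp add: subspace_lborel_def Let_def)

text \<open>
  The basis B is the one that is hidden in the definition of the measure on the hyperplane.
\<close>

lemma obtain_perp_basis:
  fixes \<xi> :: "'a::euclidean_space"
  assumes "norm \<xi> = 1"
  obtains B where "finite B" "\<xi> \<notin> B" "orthonormal_basis_of (perp_hyperplane \<xi>) B"
    "orthonormal_basis_of UNIV (insert \<xi> B)"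
    "perp_lborel \<xi> = distr (\<Pi>\<^sub>M b\<in>B. lborel) borel (\<lambda>x. \<Sum>b\<in>B. x b *\<^sub>R b)"
proof -
  define B where "B = (SOME B. orthonormal_basis_of (perp_hyperplane \<xi>) B)"
  have B: "orthonormal_basis_of (perp_hyperplane \<xi>) B"
    unfolding B_def by (rule someI_ex[OF orthonormal_basis_of_exists[OF subspace_perp_hyperplane]])
  note Bp = orthonormal_basis_of_props[OF B]
  have perp: "b \<bullet> \<xi> = 0" if "b \<in> B" for b
    using Bp(3) that span_base[of b B] by (auto simp: perp_hyperplane_def)
  have nin: "\<xi> \<notin> B" using perp[of \<xi>] assms by (auto simp: dot_square_norm)
  have "x \<in> span (insert \<xi> B)" for x
  proof -
    have "x - (x \<bullet> \<xi>) *\<^sub>R \<xi> \<in> span B"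
      using assms by (simp add: Bp(3) perp_hyperplane_def inner_diff_left dot_square_norm)
    then show ?thesis by (auto simp: span_insert)
  qed
  then have "orthonormal_basis_of UNIV (insert \<xi> B)"
    using B assms perp by (auto simp: orthonormal_basis_of_def pairwise_insert orthogonal_def inner_commute)
  moreover have "perp_lborel \<xi> = distr (\<Pi>\<^sub>M b\<in>B. lborel) borel (\<lambda>x. \<Sum>b\<in>B. x b *\<^sub>R b)"
    by (simp add: subspace_lborel_def B_def Let_def)
  ultimately show thesis using that Bp(1) nin B by blast
qed

text \<open>
  Fubini in the orthogonal coordinates z and s. The transformation rules and the Gaussian integrals on
  hyperplanes below are drawn from this fact, without coordinates on the hyperplane.
\<close>

lemma nn_integral_lborel_perp:
  fixes \<xi> :: "'a::euclidean_space"
  assumes \<xi>: "norm \<xi> = 1" and [measurable]: "h \<in> borel_measurable borel"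
  shows "(\<integral>\<^sup>+x. h x \<partial>lborel) = (\<integral>\<^sup>+z. \<integral>\<^sup>+s. h (z + s *\<^sub>R \<xi>) \<partial>lborel \<partial>perp_lborel \<xi>)"
proof -
  obtain B where B: "finite B" "\<xi> \<notin> B" "orthonormal_basis_of (perp_hyperplane \<xi>) B" "orthonormal_basis_of UNIV (insert \<xi> B)"
    and P: "perp_lborel \<xi> = distr (\<Pi>\<^sub>M b\<in>B. lborel) borel (\<lambda>x. \<Sum>b\<in>B. x b *\<^sub>R b)"
    by (rule obtain_perp_basis[OF \<xi>])
  interpret L: product_sigma_finite "\<lambda>_::'a. lborel :: real measure" ..
  have "(\<integral>\<^sup>+x. h x \<partial>lborel) = (\<integral>\<^sup>+x. h x \<partial>distr (\<Pi>\<^sub>M b\<in>insert \<xi> B. lborel) borel (\<lambda>u. \<Sum>b\<in>insert \<xi> B. u b *\<^sub>R b))"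
    by (simp add: lborel_eq_distr_orthonormal_basis[OF B(4)])
  also have "\<dots> = (\<integral>\<^sup>+u. h (\<Sum>b\<in>insert \<xi> B. u b *\<^sub>R b) \<partial>(\<Pi>\<^sub>M b\<in>insert \<xi> B. lborel))"
    by (rule nn_integral_distr) measurable
  also have "\<dots> = (\<integral>\<^sup>+u. \<integral>\<^sup>+s. h (\<Sum>b\<in>insert \<xi> B. (u(\<xi> := s)) b *\<^sub>R b) \<partial>lborel \<partial>(\<Pi>\<^sub>M b\<in>B. lborel))"
    using B by (intro L.product_nn_integral_insert) measurable
  also have "\<dots> = (\<integral>\<^sup>+u. \<integral>\<^sup>+s. h ((\<Sum>b\<in>B. u b *\<^sub>R b) + s *\<^sub>R \<xi>) \<partial>lborel \<partial>(\<Pi>\<^sub>M b\<in>B. lborel))"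
  proof -
    have "(\<Sum>b\<in>insert \<xi> B. (u(\<xi> := s)) b *\<^sub>R b) = (\<Sum>b\<in>B. u b *\<^sub>R b) + s *\<^sub>R \<xi>" for u s
    proof -
      have "(\<Sum>b\<in>B. (u(\<xi> := s)) b *\<^sub>R b) = (\<Sum>b\<in>B. u b *\<^sub>R b)"
        using B(2) by (intro sum.cong) auto
      then show ?thesis using B by (simp add: add.commute)
    qed
    then show ?thesis by simp
  qed
  also have "\<dots> = (\<integral>\<^sup>+z. \<integral>\<^sup>+s. h (z + s *\<^sub>R \<xi>) \<partial>lborel \<partial>perp_lborel \<xi>)"
    unfolding P by (rule nn_integral_distr[symmetric]) measurable
  finally show ?thesis .
qed

lemma AE_perp_lborel:
  fixes \<xi> :: "'a::euclidean_space"
  assumes \<xi>: "norm \<xi> = 1"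
  shows "AE z in perp_lborel \<xi>. z \<bullet> \<xi> = 0"
proof -
  obtain B where B: "finite B" "\<xi> \<notin> B" "orthonormal_basis_of (perp_hyperplane \<xi>) B" "orthonormal_basis_of UNIV (insert \<xi> B)"
    and P: "perp_lborel \<xi> = distr (\<Pi>\<^sub>M b\<in>B. lborel) borel (\<lambda>x. \<Sum>b\<in>B. x b *\<^sub>R b)"
    by (rule obtain_perp_basis[OF \<xi>])
  have "b \<bullet> \<xi> = 0" if "b \<in> B" for b
    using orthonormal_basis_of_props(3)[OF B(3)] that span_base[of b B] by (auto simp: perp_hyperplane_def)
  then show ?thesis unfolding P
    by (subst AE_distr_iff) (auto simp: inner_sum_left)
qed

lemma nn_integral_perp_cong:
  assumes \<xi>: "norm \<xi> = 1" and eq: "\<And>z. z \<bullet> \<xi> = 0 \<Longrightarrow> F z = G z"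
  shows "(\<integral>\<^sup>+z. F z \<partial>perp_lborel \<xi>) = (\<integral>\<^sup>+z. G z \<partial>perp_lborel \<xi>)"
  by (rule nn_integral_cong_AE, rule AE_mp[OF AE_perp_lborel[OF \<xi>]], rule AE_I2, rule impI, rule eq)

lemma nn_integral_perp_mono:
  assumes \<xi>: "norm \<xi> = 1" and le: "\<And>z. z \<bullet> \<xi> = 0 \<Longrightarrow> F z \<le> G z"
  shows "(\<integral>\<^sup>+z. F z \<partial>perp_lborel \<xi>) \<le> (\<integral>\<^sup>+z. G z \<partial>perp_lborel \<xi>)"
  by (rule nn_integral_mono_AE, rule AE_mp[OF AE_perp_lborel[OF \<xi>]], rule AE_I2, rule impI, rule le)

lemma nn_integral_lborel_perp_eq:
  fixes \<xi> :: "'a::euclidean_space"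
  assumes \<xi>: "norm \<xi> = 1" and h: "h \<in> borel_measurable borel"
    and slice: "\<And>z. z \<bullet> \<xi> = 0 \<Longrightarrow> (\<integral>\<^sup>+s. h (z + s *\<^sub>R \<xi>) \<partial>lborel) = H z"
  shows "(\<integral>\<^sup>+x. h x \<partial>lborel) = (\<integral>\<^sup>+z. H z \<partial>perp_lborel \<xi>)"
  unfolding nn_integral_lborel_perp[OF \<xi> h] by (rule nn_integral_perp_cong[OF \<xi> slice])

lemma nn_integral_lborel_perp_prod:
  fixes \<xi> :: "'a::euclidean_space"
  assumes \<xi>: "norm \<xi> = 1"
    and [measurable]: "h \<in> borel_measurable borel" "F \<in> borel_measurable borel" "G \<in> borel_measurable borel"
    and prod: "\<And>z s. z \<bullet> \<xi> = 0 \<Longrightarrow> h (z + s *\<^sub>R \<xi>) = F z * G s"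
  shows "(\<integral>\<^sup>+x. h x \<partial>lborel) = (\<integral>\<^sup>+z. F z \<partial>perp_lborel \<xi>) * (\<integral>\<^sup>+s. G s \<partial>lborel)"
proof -
  have "(\<integral>\<^sup>+x. h x \<partial>lborel) = (\<integral>\<^sup>+z. F z * (\<integral>\<^sup>+s. G s \<partial>lborel) \<partial>perp_lborel \<xi>)"
    by (rule nn_integral_lborel_perp_eq[OF \<xi>]) (simp_all add: prod nn_integral_cmult)
  also have "\<dots> = (\<integral>\<^sup>+z. F z \<partial>perp_lborel \<xi>) * (\<integral>\<^sup>+s. G s \<partial>lborel)"
    by (rule nn_integral_multc) measurable
  finally show ?thesis .
qed

text \<open>
  Integrals over the hyperplane are integrals over a slab of width 1. This carries the transformation
  rules of Lebesgue measure over to hyperplanes.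
\<close>

lemma nn_integral_perp_lborel:
  fixes \<xi> :: "'a::euclidean_space"
  assumes \<xi>: "norm \<xi> = 1" and [measurable]: "h \<in> borel_measurable borel"
  shows "(\<integral>\<^sup>+z. h z \<partial>perp_lborel \<xi>) =
    (\<integral>\<^sup>+x. h (x - (x \<bullet> \<xi>) *\<^sub>R \<xi>) * indicator {0..1} (x \<bullet> \<xi>) \<partial>lborel)"
  using \<xi> by (subst nn_integral_lborel_perp_prod[OF \<xi>, where F = h and G = "indicator {0..1}"])
    (auto simp: inner_add_left dot_square_norm)

lemma nn_integral_perp_lborel_orthogonal:
  fixes \<xi> :: "'a::euclidean_space" and T :: "'a \<Rightarrow> 'a"
  assumes \<xi>: "norm \<xi> = 1" and T: "linear T" "\<And>x. norm (T x) = norm x"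
    and h[measurable]: "h \<in> borel_measurable borel"
  shows "(\<integral>\<^sup>+z. h z \<partial>perp_lborel (T \<xi>)) = (\<integral>\<^sup>+z. h (T z) \<partial>perp_lborel \<xi>)"
proof -
  have [measurable]: "T \<in> borel_measurable borel"
    using T(1) by (simp add: borel_measurable_continuous_onI linear_continuous_on linear_linear)
  have inn: "T x \<bullet> T y = x \<bullet> y" for x y
    using T by (metis orthogonal_transformation orthogonal_transformation_def)
  have "(\<integral>\<^sup>+z. h z \<partial>perp_lborel (T \<xi>)) =
    (\<integral>\<^sup>+x. h (x - (x \<bullet> T \<xi>) *\<^sub>R T \<xi>) * indicator {0..1} (x \<bullet> T \<xi>) \<partial>lborel)"
    using \<xi> T by (intro nn_integral_perp_lborel) auto
  also have "\<dots> = (\<integral>\<^sup>+x. h (T x - (T x \<bullet> T \<xi>) *\<^sub>R T \<xi>) * indicator {0..1} (T x \<bullet> T \<xi>) \<partial>lborel)"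
    by (rule nn_integral_lborel_orthogonal[OF T, symmetric]) measurable
  also have "\<dots> = (\<integral>\<^sup>+x. h (T (x - (x \<bullet> \<xi>) *\<^sub>R \<xi>)) * indicator {0..1} (x \<bullet> \<xi>) \<partial>lborel)"
    using T(1) by (simp add: inn linear_diff linear_scale)
  also have "\<dots> = (\<integral>\<^sup>+z. h (T z) \<partial>perp_lborel \<xi>)"
    using \<xi> by (intro nn_integral_perp_lborel[symmetric]) auto
  finally show ?thesis .
qed

lemma nn_integral_perp_lborel_scale:
  fixes \<xi> :: "'a::euclidean_space"
  assumes \<xi>: "norm \<xi> = 1" and c: "c > 0" and h[measurable]: "h \<in> borel_measurable borel"
  shows "(\<integral>\<^sup>+z. h z \<partial>perp_lborel \<xi>) = ennreal (c ^ (DIM('a) - 1)) * (\<integral>\<^sup>+z. h (c *\<^sub>R z) \<partial>perp_lborel \<xi>)"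
proof -
  have "(\<integral>\<^sup>+z. h z \<partial>perp_lborel \<xi>) =
    (\<integral>\<^sup>+x. h (x - (x \<bullet> \<xi>) *\<^sub>R \<xi>) * indicator {0..1} (x \<bullet> \<xi>) \<partial>lborel)"
    by (rule nn_integral_perp_lborel[OF \<xi>]) measurable
  also have "\<dots> = ennreal (c ^ DIM('a)) * (\<integral>\<^sup>+x. h (c *\<^sub>R x - ((c *\<^sub>R x) \<bullet> \<xi>) *\<^sub>R \<xi>) * indicator {0..1} ((c *\<^sub>R x) \<bullet> \<xi>) \<partial>lborel)"
    using c by (intro nn_integral_lborel_scale) measurable
  also have "(\<integral>\<^sup>+x. h (c *\<^sub>R x - ((c *\<^sub>R x) \<bullet> \<xi>) *\<^sub>R \<xi>) * indicator {0..1} ((c *\<^sub>R x) \<bullet> \<xi>) \<partial>lborel) =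
    (\<integral>\<^sup>+z. h (c *\<^sub>R z) \<partial>perp_lborel \<xi>) * (\<integral>\<^sup>+s. indicator {0..1 / c} s \<partial>lborel)"
    using \<xi> c by (intro nn_integral_lborel_perp_prod[OF \<xi>])
      (auto simp: inner_add_left dot_square_norm scaleR_add_right indicator_def field_simps zero_le_mult_iff)
  also have "(\<integral>\<^sup>+s. indicator {0..1 / c} s \<partial>lborel) = ennreal (1 / c)" using c by simp
  finally have "(\<integral>\<^sup>+z. h z \<partial>perp_lborel \<xi>) = (ennreal (c ^ DIM('a)) * ennreal (1 / c)) * (\<integral>\<^sup>+z. h (c *\<^sub>R z) \<partial>perp_lborel \<xi>)"
    by (simp add: mult_ac)
  also have "ennreal (c ^ DIM('a)) * ennreal (1 / c) = ennreal (c ^ (DIM('a) - 1))"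
    using c by (simp add: ennreal_mult'[symmetric] power_diff)
  finally show ?thesis .
qed

section \<open>Symmetrization and slabs through the centre\<close>

text \<open>
  Steiner symmetrization: every segment of K in direction e is replaced by a segment of the same
  length that is centred at the hyperplane orthogonal to e. A centred segment consists of the half
  differences of points of the given one. So the result is a linear image of a compact convex set of
  pairs, and it is visibly compact and convex.
\<close>

definition steiner :: "'a::euclidean_space \<Rightarrow> 'a set \<Rightarrow> 'a set" where
  "steiner e K = (\<lambda>(p, q). p - (p \<bullet> e) *\<^sub>R e + ((p \<bullet> e - q \<bullet> e) / 2) *\<^sub>R e) `
     {(p, q). p \<in> K \<and> q \<in> K \<and> p - (p \<bullet> e) *\<^sub>R e = q - (q \<bullet> e) *\<^sub>R e}"

definition reflect :: "'a::euclidean_space \<Rightarrow> 'a \<Rightarrow> 'a" where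
  "reflect e x = x - (2 * (x \<bullet> e)) *\<^sub>R e"

lemma mem_steinerI:
  "p \<in> K \<Longrightarrow> q \<in> K \<Longrightarrow> p - (p \<bullet> e) *\<^sub>R e = q - (q \<bullet> e) *\<^sub>R e \<Longrightarrow>
    x = p - (p \<bullet> e) *\<^sub>R e + ((p \<bullet> e - q \<bullet> e) / 2) *\<^sub>R e \<Longrightarrow> x \<in> steiner e K"
  unfolding steiner_def by force

lemma mem_steinerE:
  assumes "x \<in> steiner e K"
  obtains p q where "p \<in> K" "q \<in> K" "p - (p \<bullet> e) *\<^sub>R e = q - (q \<bullet> e) *\<^sub>R e"
    "x = p - (p \<bullet> e) *\<^sub>R e + ((p \<bullet> e - q \<bullet> e) / 2) *\<^sub>R e"
  using assms unfolding steiner_def by auto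

lemma compact_steiner:
  assumes "compact K"
  shows "compact (steiner e K)"
proof -
  have "{(p, q). p \<in> K \<and> q \<in> K \<and> p - (p \<bullet> e) *\<^sub>R e = q - (q \<bullet> e) *\<^sub>R e} =
    (K \<times> K) \<inter> {x. fst x - (fst x \<bullet> e) *\<^sub>R e = snd x - (snd x \<bullet> e) *\<^sub>R e}" by auto
  moreover have "compact \<dots>"
    by (intro compact_Int_closed compact_Times assms closed_Collect_eq continuous_intros)
  ultimately show ?thesis unfolding steiner_def case_prod_beta
    by (intro compact_continuous_image) (auto intro!: continuous_intros)
qed

lemma convex_steiner:
  assumes "convex K"
  shows "convex (steiner e K)"
proof (rule convexI)
  fix x y :: 'a and u v :: real
  assume x: "x \<in> steiner e K" and y: "y \<in> steiner e K" and uv: "0 \<le> u" "0 \<le> v" "u + v = 1"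
  from x obtain p q where p: "p \<in> K" "q \<in> K" "p - (p \<bullet> e) *\<^sub>R e = q - (q \<bullet> e) *\<^sub>R e"
    "x = p - (p \<bullet> e) *\<^sub>R e + ((p \<bullet> e - q \<bullet> e) / 2) *\<^sub>R e" by (rule mem_steinerE)
  from y obtain r s where r: "r \<in> K" "s \<in> K" "r - (r \<bullet> e) *\<^sub>R e = s - (s \<bullet> e) *\<^sub>R e"
    "y = r - (r \<bullet> e) *\<^sub>R e + ((r \<bullet> e - s \<bullet> e) / 2) *\<^sub>R e" by (rule mem_steinerE)
  have lin: "(u *\<^sub>R p + v *\<^sub>R r) - ((u *\<^sub>R p + v *\<^sub>R r) \<bullet> e) *\<^sub>R e =
    u *\<^sub>R (p - (p \<bullet> e) *\<^sub>R e) + v *\<^sub>R (r - (r \<bullet> e) *\<^sub>R e)" for p r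
    by (simp add: algebra_simps inner_add_left)
  show "u *\<^sub>R x + v *\<^sub>R y \<in> steiner e K"
  proof (rule mem_steinerI)
    show "u *\<^sub>R p + v *\<^sub>R r \<in> K" "u *\<^sub>R q + v *\<^sub>R s \<in> K"
      using p r uv assms by (auto simp: convex_def)
    show "(u *\<^sub>R p + v *\<^sub>R r) - ((u *\<^sub>R p + v *\<^sub>R r) \<bullet> e) *\<^sub>R e =
      (u *\<^sub>R q + v *\<^sub>R s) - ((u *\<^sub>R q + v *\<^sub>R s) \<bullet> e) *\<^sub>R e"
      unfolding lin p(3) r(3) ..
    show "u *\<^sub>R x + v *\<^sub>R y = u *\<^sub>R p + v *\<^sub>R r - ((u *\<^sub>R p + v *\<^sub>R r) \<bullet> e) *\<^sub>R e +
      (((u *\<^sub>R p + v *\<^sub>R r) \<bullet> e - (u *\<^sub>R q + v *\<^sub>R s) \<bullet> e) / 2) *\<^sub>R e"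
      unfolding lin p(4) r(4)
      by (simp add: algebra_simps inner_add_left diff_divide_distrib add_divide_distrib)
  qed
qed

text \<open>
  Symmetrization keeps the symmetries that map e to a multiple of itself: the central symmetry and the
  reflections in directions orthogonal to e.
\<close>

lemma steiner_invariant:
  assumes "linear T" "\<And>x. x \<in> K \<Longrightarrow> T x \<in> K" "T e = c *\<^sub>R e" "\<And>x. T x \<bullet> e = c * (x \<bullet> e)"
    and "x \<in> steiner e K"
  shows "T x \<in> steiner e K"
proof -
  from assms(5) obtain p q where p: "p \<in> K" "q \<in> K" "p - (p \<bullet> e) *\<^sub>R e = q - (q \<bullet> e) *\<^sub>R e"
    "x = p - (p \<bullet> e) *\<^sub>R e + ((p \<bullet> e - q \<bullet> e) / 2) *\<^sub>R e" by (rule mem_steinerE)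
  have lin: "T p - (T p \<bullet> e) *\<^sub>R e = T (p - (p \<bullet> e) *\<^sub>R e)" for p
    using assms(1,3,4) by (simp add: linear_diff linear_scale mult.commute)
  show ?thesis
  proof (rule mem_steinerI)
    show "T p \<in> K" "T q \<in> K" using p assms(2) by auto
    show "T p - (T p \<bullet> e) *\<^sub>R e = T q - (T q \<bullet> e) *\<^sub>R e" unfolding lin p(3) ..
    show "T x = T p - (T p \<bullet> e) *\<^sub>R e + ((T p \<bullet> e - T q \<bullet> e) / 2) *\<^sub>R e"
      unfolding lin p(4) using assms(1,3,4)
      by (simp add: linear_add linear_scale right_diff_distrib[symmetric] mult.commute)
  qed
qed

lemma steiner_reflect:
  assumes "norm e = 1" "x \<in> steiner e K"
  shows "reflect e x \<in> steiner e K"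
proof -
  from assms(2) obtain p q where p: "p \<in> K" "q \<in> K" "p - (p \<bullet> e) *\<^sub>R e = q - (q \<bullet> e) *\<^sub>R e"
    "x = p - (p \<bullet> e) *\<^sub>R e + ((p \<bullet> e - q \<bullet> e) / 2) *\<^sub>R e" by (rule mem_steinerE)
  have e: "e \<bullet> e = 1" using assms(1) by (simp add: dot_square_norm)
  have xe: "x \<bullet> e = (p \<bullet> e - q \<bullet> e) / 2"
    unfolding p(4) by (simp add: inner_add_left inner_diff_left e)
  show ?thesis
  proof (rule mem_steinerI[OF p(2,1) p(3)[symmetric]])
    have gen: "w + t *\<^sub>R e - (2 * t) *\<^sub>R e = w - t *\<^sub>R e" for w t
    proof -
      have "(2 * t) *\<^sub>R e = t *\<^sub>R e + t *\<^sub>R e" by (metis mult_2 scaleR_add_left)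
      then show ?thesis by simp
    qed
    have "reflect e x = p - (p \<bullet> e) *\<^sub>R e - ((p \<bullet> e - q \<bullet> e) / 2) *\<^sub>R e"
      unfolding reflect_def xe unfolding p(4) by (rule gen)
    then show "reflect e x = q - (q \<bullet> e) *\<^sub>R e + ((q \<bullet> e - p \<bullet> e) / 2) *\<^sub>R e"
      using scaleR_minus_left[of "(p \<bullet> e - q \<bullet> e) / 2" e] unfolding p(3) minus_divide_left by simp
  qed
qed

lemma chord_interval:
  fixes K :: "'a::euclidean_space set"
  assumes "compact K" "convex K" "norm e = 1"
  obtains "{s. z + s *\<^sub>R e \<in> K} = {}" | l u :: real where "l \<le> u" "{s. z + s *\<^sub>R e \<in> K} = {l..u}"
proof -
  let ?A = "{s. z + s *\<^sub>R e \<in> K}"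
  have "convex ?A"
  proof (rule convexI)
    fix x y u v :: real assume *: "x \<in> ?A" "y \<in> ?A" "0 \<le> u" "0 \<le> v" "u + v = 1"
    then have "u *\<^sub>R (z + x *\<^sub>R e) + v *\<^sub>R (z + y *\<^sub>R e) \<in> K" using assms(2) by (auto simp: convex_def)
    also have "u *\<^sub>R (z + x *\<^sub>R e) + v *\<^sub>R (z + y *\<^sub>R e) = (u + v) *\<^sub>R z + (u * x + v * y) *\<^sub>R e"
      by (simp add: algebra_simps)
    finally show "u *\<^sub>R x + v *\<^sub>R y \<in> ?A" using * by simp
  qed
  moreover have "closed ?A"
  proof -
    have "closed ((\<lambda>s. z + s *\<^sub>R e) -` K)"
      using assms(1) by (intro continuous_closed_vimage) (auto intro!: continuous_intros compact_imp_closed)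
    then show ?thesis by (simp add: vimage_def)
  qed
  moreover have "bounded ?A"
  proof -
    obtain R where R: "\<And>x. x \<in> K \<Longrightarrow> norm x \<le> R" using assms(1) by (meson bounded_iff compact_imp_bounded)
    have "\<bar>s\<bar> \<le> R + norm z" if "s \<in> ?A" for s
    proof -
      have "norm (s *\<^sub>R e) \<le> norm (z + s *\<^sub>R e) + norm z"
        by (metis add.commute norm_add_leD order_refl)
      then show ?thesis using R that assms(3) by fastforce
    qed
    then show ?thesis by (intro boundedI[of _ "R + norm z"]) auto
  qed
  ultimately have "connected ?A \<and> compact ?A" by (simp add: convex_connected compact_eq_bounded_closed)
  then obtain l u where lu: "?A = {l..u}" using connected_compact_interval_1[of ?A] by (auto simp: cbox_interval)
  show thesis
  proof (cases "l \<le> u")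
    case True then show thesis using lu that(2) by blast
  next
    case False then show thesis using lu that(1) by auto
  qed
qed

text \<open>
  By Fubini along e, since the lengths of the segments in direction e do not change.
\<close>

lemma nn_integral_steiner:
  fixes K :: "'a::euclidean_space set"
  assumes K: "compact K" "convex K" and e: "norm e = 1"
    and [measurable]: "F \<in> borel_measurable borel" and F: "\<And>x t. F (x + t *\<^sub>R e) = F x"
  shows "(\<integral>\<^sup>+x. F x * indicator (steiner e K) x \<partial>lborel) = (\<integral>\<^sup>+x. F x * indicator K x \<partial>lborel)"
proof -
  have [measurable]: "K \<in> sets borel" "steiner e K \<in> sets borel"
    using K compact_steiner by (auto intro: borel_compact)
  have e1: "e \<bullet> e = 1" using e by (simp add: dot_square_norm)
  have slice: "(\<integral>\<^sup>+x. F x * indicator L x \<partial>lborel) =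
    (\<integral>\<^sup>+z. F z * emeasure lborel {s. z + s *\<^sub>R e \<in> L} \<partial>perp_lborel e)" if [measurable]: "L \<in> sets borel" for L
  proof -
    have "(\<integral>\<^sup>+x. F x * indicator L x \<partial>lborel) =
      (\<integral>\<^sup>+z. \<integral>\<^sup>+s. F (z + s *\<^sub>R e) * indicator L (z + s *\<^sub>R e) \<partial>lborel \<partial>perp_lborel e)"
      by (rule nn_integral_lborel_perp[OF e]) measurable
    also have "\<dots> = (\<integral>\<^sup>+z. F z * (\<integral>\<^sup>+s. indicator {s. z + s *\<^sub>R e \<in> L} s \<partial>lborel) \<partial>perp_lborel e)"
    proof (rule nn_integral_cong)
      fix z
      have "indicator L (z + s *\<^sub>R e) = (indicator {s. z + s *\<^sub>R e \<in> L} s :: ennreal)" for s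
        by (simp add: indicator_def)
      then show "(\<integral>\<^sup>+s. F (z + s *\<^sub>R e) * indicator L (z + s *\<^sub>R e) \<partial>lborel) =
        F z * (\<integral>\<^sup>+s. indicator {s. z + s *\<^sub>R e \<in> L} s \<partial>lborel)"
        by (simp add: F nn_integral_cmult)
    qed
    finally show ?thesis by simp
  qed
  have len: "emeasure lborel {s. z + s *\<^sub>R e \<in> steiner e K} = emeasure lborel {s. z + s *\<^sub>R e \<in> K}"
    if z: "z \<bullet> e = 0" for z
  proof -
    let ?A = "{s. z + s *\<^sub>R e \<in> K}"
    have S: "{s. z + s *\<^sub>R e \<in> steiner e K} = {s. \<exists>a\<in>?A. \<exists>b\<in>?A. s = (a - b) / 2}"
    proof (intro set_eqI iffI; clarify)
      fix s assume "z + s *\<^sub>R e \<in> steiner e K"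
      then obtain p q where p: "p \<in> K" "q \<in> K" "p - (p \<bullet> e) *\<^sub>R e = q - (q \<bullet> e) *\<^sub>R e"
        "z + s *\<^sub>R e = p - (p \<bullet> e) *\<^sub>R e + ((p \<bullet> e - q \<bullet> e) / 2) *\<^sub>R e" by (rule mem_steinerE)
      have "(z + s *\<^sub>R e) \<bullet> e = (p \<bullet> e - q \<bullet> e) / 2"
        unfolding p(4) by (simp add: inner_add_left inner_diff_left e1)
      then have s: "s = (p \<bullet> e - q \<bullet> e) / 2" using z by (simp add: inner_add_left e1)
      then have zp: "z = p - (p \<bullet> e) *\<^sub>R e" using p(4) unfolding s by simp
      have "z + (p \<bullet> e) *\<^sub>R e = p" "z + (q \<bullet> e) *\<^sub>R e = q" unfolding zp by (simp, simp add: p(3))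
      then have "z + (p \<bullet> e) *\<^sub>R e \<in> K" "z + (q \<bullet> e) *\<^sub>R e \<in> K" using p(1,2) by simp_all
      then show "\<exists>a\<in>?A. \<exists>b\<in>?A. s = (a - b) / 2" using s by blast
    next
      fix a b assume ab: "z + a *\<^sub>R e \<in> K" "z + b *\<^sub>R e \<in> K"
      show "z + ((a - b) / 2) *\<^sub>R e \<in> steiner e K"
        by (rule mem_steinerI[OF ab]) (simp_all add: inner_add_left z e1)
    qed
    show ?thesis
    proof (rule chord_interval[OF K e, of z])
      assume "?A = {}" then show ?thesis unfolding S by simp
    next
      fix l u :: real assume lu: "l \<le> u" "?A = {l..u}"
      have "{s. z + s *\<^sub>R e \<in> steiner e K} = {- ((u - l) / 2)..(u - l) / 2}"
        unfolding S lu(2)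
      proof (intro set_eqI iffI; clarify)
        fix s assume s: "s \<in> {- ((u - l) / 2)..(u - l) / 2}"
        show "\<exists>a\<in>{l..u}. \<exists>b\<in>{l..u}. s = (a - b) / 2"
          using s lu(1) by (intro bexI[of _ "(l + u) / 2 + s"] bexI[of _ "(l + u) / 2 - s"])
            (auto simp: field_simps)
      qed (auto simp: field_simps)
      then show ?thesis unfolding lu(2) using lu(1) by (simp add: field_simps)
    qed
  qed
  show ?thesis unfolding slice[OF \<open>K \<in> sets borel\<close>] slice[OF \<open>steiner e K \<in> sets borel\<close>]
    by (rule nn_integral_perp_cong[OF e], simp add: len)
qed

lemma linear_reflect: "linear (reflect e)"
  by (rule linearI) (auto simp: reflect_def inner_add_left algebra_simps)

text \<open>
  Symmetrizing once in every direction of B. Each step keeps the reflections that were gained before,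
  and the distribution of \<open>x \<bullet> \<xi>\<close> because \<open>\<xi>\<close> is orthogonal
  to B.
\<close>

lemma exists_symmetrization:
  fixes K :: "'a::euclidean_space set"
  assumes K: "compact K" "convex K" "\<And>x. x \<in> K \<Longrightarrow> - x \<in> K"
    and "finite B"
    and B: "\<And>b. b \<in> B \<Longrightarrow> norm b = 1" "\<And>b. b \<in> B \<Longrightarrow> b \<bullet> \<xi> = 0"
      "\<And>b c. b \<in> B \<Longrightarrow> c \<in> B \<Longrightarrow> b \<noteq> c \<Longrightarrow> b \<bullet> c = 0"
  shows "\<exists>L. compact L \<and> convex L \<and> (\<forall>x\<in>L. - x \<in> L) \<and> (\<forall>b\<in>B. \<forall>x\<in>L. reflect b x \<in> L) \<and>
    (\<forall>\<phi>\<in>borel_measurable borel. (\<integral>\<^sup>+x. \<phi> (x \<bullet> \<xi>) * indicator L x \<partial>lborel) = (\<integral>\<^sup>+x. \<phi> (x \<bullet> \<xi>) * indicator K x \<partial>lborel))"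
  using \<open>finite B\<close> B
proof (induction B)
  case empty
  then show ?case using K by (intro exI[of _ K]) auto
next
  case (insert e B)
  then obtain L where L: "compact L" "convex L" "\<And>x. x \<in> L \<Longrightarrow> - x \<in> L"
      "\<And>b x. b \<in> B \<Longrightarrow> x \<in> L \<Longrightarrow> reflect b x \<in> L"
    and eq: "\<And>\<phi>. \<phi> \<in> borel_measurable borel \<Longrightarrow>
      (\<integral>\<^sup>+x. \<phi> (x \<bullet> \<xi>) * indicator L x \<partial>lborel) = (\<integral>\<^sup>+x. \<phi> (x \<bullet> \<xi>) * indicator K x \<partial>lborel)"
    by (auto 4 4)
  have e: "norm e = 1" "e \<bullet> \<xi> = 0" using insert.prems by auto
  have "reflect b x \<in> steiner e L" if b: "b \<in> insert e B" and x: "x \<in> steiner e L" for b x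
  proof (cases "b = e")
    case False
    then have be: "b \<bullet> e = 0" "e \<bullet> b = 0" "b \<in> B" using b insert.prems by auto
    show ?thesis
      by (rule steiner_invariant[where c = 1, OF linear_reflect L(4)[OF be(3)] _ _ x])
        (simp_all add: reflect_def inner_diff_left be)
  qed (use x steiner_reflect[OF e(1)] in simp)
  moreover have "- x \<in> steiner e L" if "x \<in> steiner e L" for x
    using that L(3) by (intro steiner_invariant[where c = "- 1" and T = uminus]) (auto intro: linearI)
  moreover have "(\<integral>\<^sup>+x. \<phi> (x \<bullet> \<xi>) * indicator (steiner e L) x \<partial>lborel) = (\<integral>\<^sup>+x. \<phi> (x \<bullet> \<xi>) * indicator K x \<partial>lborel)"
    if [measurable]: "\<phi> \<in> borel_measurable borel" for \<phi>
    unfolding eq[OF that, symmetric]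
    by (rule nn_integral_steiner[OF L(1,2) e(1)]) (measurable, simp add: inner_add_left e)
  ultimately show ?case using compact_steiner[OF L(1)] convex_steiner[OF L(2)]
    by (intro exI[of _ "steiner e L"]) auto
qed

text \<open>
  After rescaling, only the length of the interval depends on the parameter, and it increases with it.
\<close>

lemma nn_integral_gauss_chord_mono:
  assumes "0 < b" "b \<le> c"
  shows "(\<integral>\<^sup>+s. ennreal (sqrt b * exp (- b * s\<^sup>2)) * indicator {- h..h} s \<partial>lborel)
    \<le> (\<integral>\<^sup>+s. ennreal (sqrt c * exp (- c * s\<^sup>2)) * indicator {- h..h} s \<partial>lborel)"
proof -
  have "(\<integral>\<^sup>+s. ennreal (sqrt b * exp (- b * s\<^sup>2)) * indicator {- h..h} s \<partial>lborel)
    = (\<integral>\<^sup>+t. ennreal (exp (- t\<^sup>2)) * indicator {- (sqrt b * h)..sqrt b * h} t \<partial>lborel)" if b: "0 < b" for b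
  proof -
    have "(\<integral>\<^sup>+t. ennreal (exp (- t\<^sup>2)) * indicator {- (sqrt b * h)..sqrt b * h} t \<partial>lborel) =
      ennreal \<bar>sqrt b\<bar> * (\<integral>\<^sup>+s. ennreal (exp (- (0 + sqrt b * s)\<^sup>2)) * indicator {- (sqrt b * h)..sqrt b * h} (0 + sqrt b * s) \<partial>lborel)"
      using b by (intro nn_integral_real_affine) auto
    also have "\<dots> = (\<integral>\<^sup>+s. ennreal (sqrt b) * (ennreal (exp (- (0 + sqrt b * s)\<^sup>2)) * indicator {- (sqrt b * h)..sqrt b * h} (0 + sqrt b * s)) \<partial>lborel)"
      using b by (subst nn_integral_cmult) auto
    also have "\<dots> = (\<integral>\<^sup>+s. ennreal (sqrt b * exp (- b * s\<^sup>2)) * indicator {- h..h} s \<partial>lborel)"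
    proof (rule nn_integral_cong)
      fix s
      have "- (sqrt b * h) \<le> sqrt b * s \<longleftrightarrow> - h \<le> s"
        using b by (metis mult_le_cancel_left_pos mult_minus_right real_sqrt_gt_zero)
      then have "indicator {- (sqrt b * h)..sqrt b * h} (0 + sqrt b * s) = (indicator {- h..h} s :: ennreal)"
        using b by (auto simp: indicator_def)
      then show "ennreal (sqrt b) * (ennreal (exp (- (0 + sqrt b * s)\<^sup>2)) * indicator {- (sqrt b * h)..sqrt b * h} (0 + sqrt b * s)) =
        ennreal (sqrt b * exp (- b * s\<^sup>2)) * indicator {- h..h} s"
        using b by (simp add: ennreal_mult power_mult_distrib mult.assoc)
    qed
    finally show ?thesis by simp
  qed
  note this[OF \<open>0 < b\<close>] this[of c]
  moreover have "(\<integral>\<^sup>+t. ennreal (exp (- t\<^sup>2)) * indicator {- (sqrt b * h)..sqrt b * h} t \<partial>lborel) \<le>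
    (\<integral>\<^sup>+t. ennreal (exp (- t\<^sup>2)) * indicator {- (sqrt c * h)..sqrt c * h} t \<partial>lborel)"
  proof (intro nn_integral_mono mult_left_mono)
    fix t :: real
    show "indicator {- (sqrt b * h)..sqrt b * h} t \<le> (indicator {- (sqrt c * h)..sqrt c * h} t :: ennreal)"
    proof (cases "h \<ge> 0")
      case True
      then have "sqrt b * h \<le> sqrt c * h" using assms by (intro mult_right_mono) auto
      then show ?thesis by (auto simp: indicator_def)
    next
      case False
      then have "sqrt b * h < 0" using assms by (simp add: mult_pos_neg)
      then show ?thesis by (auto simp: indicator_def)
    qed
  qed simp
  ultimately show ?thesis using assms by simp
qed

lemma sum_reflections:
  fixes L :: "'a::euclidean_space set"
  assumes "finite B" "\<And>b. b \<in> B \<Longrightarrow> norm b = 1"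
      "\<And>b c. b \<in> B \<Longrightarrow> c \<in> B \<Longrightarrow> b \<noteq> c \<Longrightarrow> b \<bullet> c = 0"
    and "\<And>b x. b \<in> B \<Longrightarrow> x \<in> L \<Longrightarrow> reflect b x \<in> L" and "x \<in> L"
  shows "x - (\<Sum>b\<in>B. (2 * (x \<bullet> b)) *\<^sub>R b) \<in> L"
  using assms(1-4)
proof (induction B)
  case empty
  then show ?case using \<open>x \<in> L\<close> by simp
next
  case (insert e B)
  then have "reflect e (x - (\<Sum>b\<in>B. (2 * (x \<bullet> b)) *\<^sub>R b)) \<in> L" by simp
  moreover have "b \<bullet> e = 0" if "b \<in> B" for b
    using insert(2) insert.prems(2)[of b e] that by auto
  then have "(\<Sum>b\<in>B. (2 * (x \<bullet> b)) *\<^sub>R b) \<bullet> e = 0"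
    by (simp add: inner_sum_left)
  then have "reflect e (x - (\<Sum>b\<in>B. (2 * (x \<bullet> b)) *\<^sub>R b)) = x - (\<Sum>b\<in>insert e B. (2 * (x \<bullet> b)) *\<^sub>R b)"
    using insert(1,2) by (simp add: reflect_def inner_diff_left algebra_simps)
  ultimately show ?case by simp
qed

text \<open>
  The sections of a symmetric convex body by parallel hyperplanes are largest at the centre (Brunn),
  so more of it lies in a more concentrated Gaussian slab. After symmetrization in all directions
  orthogonal to \<open>\<xi>\<close>, the body is symmetric under the reflection in the hyperplane
  orthogonal to \<open>\<xi>\<close>: this reflection is minus the composition of the others. The
  segments in direction \<open>\<xi>\<close> are then centred, and on each of them the inequality is
  elementary.
\<close>

lemma slab_gauss_mono_unit:
  fixes K :: "'a::euclidean_space set"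
  assumes K: "compact K" "convex K" "\<And>x. x \<in> K \<Longrightarrow> - x \<in> K" and \<xi>: "norm \<xi> = 1" and bc: "0 < b" "b \<le> c"
  shows "(\<integral>\<^sup>+x. slab_gauss b \<xi> x * indicator K x \<partial>lborel) \<le>
    (\<integral>\<^sup>+x. slab_gauss c \<xi> x * indicator K x \<partial>lborel)"
proof -
  obtain B where B: "finite B" "\<xi> \<notin> B" "orthonormal_basis_of (perp_hyperplane \<xi>) B"
      "orthonormal_basis_of UNIV (insert \<xi> B)"
    and "perp_lborel \<xi> = distr (\<Pi>\<^sub>M b\<in>B. lborel) borel (\<lambda>x. \<Sum>b\<in>B. x b *\<^sub>R b)"
    by (rule obtain_perp_basis[OF \<xi>])
  note Bp = orthonormal_basis_of_props[OF B(4)]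
  have "b \<bullet> \<xi> = 0" if "b \<in> B" for b using Bp(5)[of b \<xi>] that B(2) by auto
  then obtain L where L: "compact L" "convex L" "\<And>x. x \<in> L \<Longrightarrow> - x \<in> L"
      "\<And>b x. b \<in> B \<Longrightarrow> x \<in> L \<Longrightarrow> reflect b x \<in> L"
    and eq: "\<And>\<phi>. \<phi> \<in> borel_measurable borel \<Longrightarrow>
      (\<integral>\<^sup>+x. \<phi> (x \<bullet> \<xi>) * indicator L x \<partial>lborel) = (\<integral>\<^sup>+x. \<phi> (x \<bullet> \<xi>) * indicator K x \<partial>lborel)"
    using exists_symmetrization[OF K B(1), of \<xi>] Bp(4,5) by (auto 4 4)
  have [measurable]: "L \<in> sets borel" using L by (auto intro: borel_compact)
  have refl: "z - s *\<^sub>R \<xi> \<in> L" if z: "z \<bullet> \<xi> = 0" and zs: "z + s *\<^sub>R \<xi> \<in> L" for z s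
  proof -
    define x where "x = z + s *\<^sub>R \<xi>"
    have x: "x \<bullet> \<xi> = s" using z \<xi> by (simp add: x_def inner_add_left dot_square_norm)
    have "x - (\<Sum>b\<in>B. (2 * (x \<bullet> b)) *\<^sub>R b) \<in> L"
      using B(1,2) Bp(4,5) L(4) zs by (intro sum_reflections) (auto simp: x_def)
    moreover have "(\<Sum>b\<in>insert \<xi> B. (x \<bullet> b) *\<^sub>R b) = x"
    proof -
      define w where "w = x - (\<Sum>b\<in>insert \<xi> B. (x \<bullet> b) *\<^sub>R b)"
      have "b \<bullet> w = 0" if "b \<in> insert \<xi> B" for b
      proof -
        have "(\<Sum>c\<in>insert \<xi> B. (x \<bullet> c) *\<^sub>R c) \<bullet> b = (\<Sum>c\<in>insert \<xi> B. if c = b then x \<bullet> b else 0)"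
          unfolding inner_sum_left using Bp(5) that by (intro sum.cong) auto
        also have "\<dots> = x \<bullet> b" using that Bp(1) by (simp add: sum.delta')
        finally show ?thesis by (simp add: w_def inner_diff_right inner_commute)
      qed
      then have "w \<bullet> w = 0"
        using orthogonal_to_span[of w "insert \<xi> B" w] Bp(3) by (auto simp: orthogonal_def inner_commute)
      then show ?thesis by (simp add: w_def)
    qed
    then have "(\<Sum>b\<in>B. (x \<bullet> b) *\<^sub>R b) = x - s *\<^sub>R \<xi>"
      using B(1,2) x by (simp add: eq_diff_eq add.commute)
    then have "(\<Sum>b\<in>B. (2 * (x \<bullet> b)) *\<^sub>R b) = 2 *\<^sub>R (x - s *\<^sub>R \<xi>)"
      by (simp add: scaleR_sum_right[symmetric] flip: scaleR_scaleR)
    ultimately have "x - 2 *\<^sub>R (x - s *\<^sub>R \<xi>) \<in> L" by simp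
    then have "- (x - 2 *\<^sub>R (x - s *\<^sub>R \<xi>)) \<in> L" by (rule L(3))
    then show ?thesis by (simp add: x_def algebra_simps scaleR_2)
  qed
  have slice: "(\<integral>\<^sup>+x. slab_gauss b \<xi> x * indicator K x \<partial>lborel) =
      (\<integral>\<^sup>+z. \<integral>\<^sup>+s. slab_gauss b \<xi> (z + s *\<^sub>R \<xi>) * indicator L (z + s *\<^sub>R \<xi>) \<partial>lborel \<partial>perp_lborel \<xi>)"
    for b
  proof -
    have "(\<integral>\<^sup>+x. slab_gauss b \<xi> x * indicator K x \<partial>lborel) =
      (\<integral>\<^sup>+x. slab_gauss b \<xi> x * indicator L x \<partial>lborel)"
      by (rule eq[symmetric]) measurable
    also have "\<dots> = (\<integral>\<^sup>+z. \<integral>\<^sup>+s. slab_gauss b \<xi> (z + s *\<^sub>R \<xi>) * indicator L (z + s *\<^sub>R \<xi>) \<partial>lborel \<partial>perp_lborel \<xi>)"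
      by (rule nn_integral_lborel_perp[OF \<xi>]) measurable
    finally show ?thesis .
  qed
  show ?thesis unfolding slice
  proof (rule nn_integral_perp_mono[OF \<xi>])
    fix z assume z: "z \<bullet> \<xi> = 0"
    have in_eq: "(z + s *\<^sub>R \<xi>) \<bullet> \<xi> = s" for s using z \<xi> by (simp add: inner_add_left dot_square_norm)
    obtain h where h: "{s. z + s *\<^sub>R \<xi> \<in> L} = {- h..h}"
    proof (rule chord_interval[OF L(1,2) \<xi>, of z])
      assume "{s. z + s *\<^sub>R \<xi> \<in> L} = {}" then show thesis using that[of "-1"] by simp
    next
      fix l u assume lu: "l \<le> u" "{s. z + s *\<^sub>R \<xi> \<in> L} = {l..u}"
      have "- u \<in> {s. z + s *\<^sub>R \<xi> \<in> L}" "- l \<in> {s. z + s *\<^sub>R \<xi> \<in> L}"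
      proof -
        have "u \<in> {s. z + s *\<^sub>R \<xi> \<in> L}" "l \<in> {s. z + s *\<^sub>R \<xi> \<in> L}" unfolding lu(2) using lu(1) by simp_all
        then have "z - u *\<^sub>R \<xi> \<in> L" "z - l *\<^sub>R \<xi> \<in> L" using refl[OF z] by simp_all
        then show "- u \<in> {s. z + s *\<^sub>R \<xi> \<in> L}" "- l \<in> {s. z + s *\<^sub>R \<xi> \<in> L}" by simp_all
      qed
      then have "l = - u" unfolding lu(2) by simp
      then show thesis using that[of u] lu(2) by simp
    qed
    then have ind: "indicator L (z + s *\<^sub>R \<xi>) = (indicator {- h..h} s :: ennreal)" for s
      by (auto simp: indicator_def)
    show "(\<integral>\<^sup>+s. slab_gauss b \<xi> (z + s *\<^sub>R \<xi>) * indicator L (z + s *\<^sub>R \<xi>) \<partial>lborel) \<le>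
      (\<integral>\<^sup>+s. slab_gauss c \<xi> (z + s *\<^sub>R \<xi>) * indicator L (z + s *\<^sub>R \<xi>) \<partial>lborel)"
      unfolding in_eq ind by (rule nn_integral_gauss_chord_mono[OF bc])
  qed
qed

lemma slab_gauss_mono:
  fixes K :: "'a::euclidean_space set"
  assumes K: "compact K" "convex K" "\<And>x. x \<in> K \<Longrightarrow> - x \<in> K" and bc: "0 < b" "b \<le> c"
  shows "(\<integral>\<^sup>+x. slab_gauss b \<xi> x * indicator K x \<partial>lborel) \<le>
    (\<integral>\<^sup>+x. slab_gauss c \<xi> x * indicator K x \<partial>lborel)"
proof (cases "\<xi> = 0")
  case True
  then show ?thesis using bc by (auto intro!: nn_integral_mono mult_right_mono)
next
  case False
  have [measurable]: "K \<in> sets borel" using K by (auto intro: borel_compact)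
  define r where "r = norm \<xi>"
  have r: "r > 0" using False by (simp add: r_def)
  define \<zeta> where "\<zeta> = \<xi> /\<^sub>R r"
  have \<zeta>: "norm \<zeta> = 1" "\<xi> = r *\<^sub>R \<zeta>" using r by (auto simp: \<zeta>_def r_def)
  have "(\<integral>\<^sup>+x. slab_gauss b \<xi> x * indicator K x \<partial>lborel) =
    ennreal (1 / r) * (\<integral>\<^sup>+x. ennreal (sqrt (r\<^sup>2 * b) * exp (- (r\<^sup>2 * b) * (x \<bullet> \<zeta>)\<^sup>2)) * indicator K x \<partial>lborel)" if "0 < b" for b
  proof -
    have "(\<integral>\<^sup>+x. slab_gauss b \<xi> x * indicator K x \<partial>lborel) =
      (\<integral>\<^sup>+x. ennreal (1 / r) * (ennreal (sqrt (r\<^sup>2 * b) * exp (- (r\<^sup>2 * b) * (x \<bullet> \<zeta>)\<^sup>2)) * indicator K x) \<partial>lborel)"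
    proof (rule nn_integral_cong)
      fix x
      have "sqrt b * exp (- b * (x \<bullet> \<xi>)\<^sup>2) = (1 / r) * (sqrt (r\<^sup>2 * b) * exp (- (r\<^sup>2 * b) * (x \<bullet> \<zeta>)\<^sup>2))"
        using r \<open>0 < b\<close> by (simp add: \<zeta>(2) real_sqrt_mult power_mult_distrib mult_ac)
      then show "slab_gauss b \<xi> x * indicator K x =
        ennreal (1 / r) * (ennreal (sqrt (r\<^sup>2 * b) * exp (- (r\<^sup>2 * b) * (x \<bullet> \<zeta>)\<^sup>2)) * indicator K x)"
        using r by (simp only: ennreal_mult'[of "1 / r"] mult.assoc divide_nonneg_pos zero_le_one)
    qed
    also have "\<dots> = ennreal (1 / r) * (\<integral>\<^sup>+x. ennreal (sqrt (r\<^sup>2 * b) * exp (- (r\<^sup>2 * b) * (x \<bullet> \<zeta>)\<^sup>2)) * indicator K x \<partial>lborel)"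
      by (rule nn_integral_cmult) measurable
    finally show ?thesis .
  qed
  moreover have "r\<^sup>2 * b \<le> r\<^sup>2 * c" "0 < r\<^sup>2 * b" using bc r by (auto intro: mult_left_mono)
  ultimately show ?thesis using slab_gauss_mono_unit[OF K \<zeta>(1), of "r\<^sup>2 * b" "r\<^sup>2 * c"] bc
    by (simp add: mult_left_mono)
qed

section \<open>Gaussian integrals\<close>

lemma nn_integral_gauss_real:
  assumes "c > 0"
  shows "(\<integral>\<^sup>+s. ennreal (exp (- (c * (s + t)\<^sup>2))) \<partial>lborel) = ennreal (sqrt (pi / c))"
proof -
  define \<sigma> where "\<sigma> = 1 / sqrt (2 * c)"
  have \<sigma>: "\<sigma> > 0" "2 * \<sigma>\<^sup>2 = 1 / c" using assms by (auto simp: \<sigma>_def power_divide)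
  have eq: "exp (- (c * s\<^sup>2)) = sqrt (pi / c) * normal_density 0 \<sigma> s" for s
  proof -
    have "2 * pi * \<sigma>\<^sup>2 = pi * (2 * \<sigma>\<^sup>2)" by simp
    then have "2 * pi * \<sigma>\<^sup>2 = pi / c" unfolding \<sigma>(2) by simp
    moreover have "- (s - 0)\<^sup>2 / (2 * \<sigma>\<^sup>2) = - (c * s\<^sup>2)" unfolding \<sigma>(2) using assms by simp
    ultimately show ?thesis using assms unfolding normal_density_def by simp
  qed
  have "(\<integral>\<^sup>+s. ennreal (exp (- (c * (s + t)\<^sup>2))) \<partial>lborel) = (\<integral>\<^sup>+s. ennreal (exp (- (c * s\<^sup>2))) \<partial>lborel)"
    using nn_integral_lborel_translate[of "\<lambda>s::real. ennreal (exp (- (c * s\<^sup>2)))" t]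
    by (simp add: add.commute)
  also have "\<dots> = (\<integral>\<^sup>+s. ennreal (sqrt (pi / c)) * ennreal (normal_density 0 \<sigma> s) \<partial>lborel)"
    unfolding eq using assms by (intro nn_integral_cong) (auto simp: ennreal_mult)
  also have "\<dots> = ennreal (sqrt (pi / c)) * (\<integral>\<^sup>+s. ennreal (normal_density 0 \<sigma> s) \<partial>lborel)"
    by (rule nn_integral_cmult) measurable
  also have "(\<integral>\<^sup>+s. ennreal (normal_density 0 \<sigma> s) \<partial>lborel) = 1"
  proof -
    interpret prob_space "density lborel (normal_density 0 \<sigma>)" using \<sigma>(1) by (rule prob_space_normal_density)
    show ?thesis using emeasure_space_1 by (simp add: emeasure_density)
  qed
  finally show ?thesis by simp
qed

lemma nn_integral_gauss:
  assumes "c > 0"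
  shows "(\<integral>\<^sup>+x. gauss c (x::'a::euclidean_space) \<partial>lborel) = ennreal (sqrt (pi / c)) ^ DIM('a)"
proof -
  have "exp (- (c * (norm x)\<^sup>2)) = (\<Prod>b\<in>Basis. exp (- (c * (x \<bullet> b + 0)\<^sup>2)))" for x :: 'a
  proof -
    have "(norm x)\<^sup>2 = (\<Sum>b\<in>Basis. (x \<bullet> b)\<^sup>2)"
      unfolding power2_norm_eq_inner by (subst euclidean_inner) (simp add: power2_eq_square)
    then show ?thesis by (simp add: exp_sum[symmetric] sum_negf sum_distrib_left)
  qed
  then have "(\<integral>\<^sup>+x. gauss c (x::'a) \<partial>lborel) =
      (\<integral>\<^sup>+x. (\<Prod>b\<in>Basis. ennreal (exp (- (c * ((x::'a) \<bullet> b + 0)\<^sup>2)))) \<partial>lborel)"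
    by (simp add: prod_ennreal)
  also have "\<dots> = (\<Prod>b\<in>(Basis::'a set). (\<integral>\<^sup>+s. ennreal (exp (- (c * (s + 0)\<^sup>2))) \<partial>lborel))"
    by (rule nn_integral_lborel_prod) auto
  also have "\<dots> = ennreal (sqrt (pi / c)) ^ DIM('a)"
    unfolding nn_integral_gauss_real[OF assms] by simp
  finally show ?thesis .
qed

lemma norm_add_perp:
  fixes e :: "'a::euclidean_space"
  assumes "norm e = 1" "z \<bullet> e = 0"
  shows "(norm (z + s *\<^sub>R e))\<^sup>2 = (norm z)\<^sup>2 + s\<^sup>2"
proof -
  have "e \<bullet> e = 1" "e \<bullet> z = 0" using assms by (auto simp: dot_square_norm inner_commute)
  then show ?thesis using assms(2) unfolding power2_norm_eq_inner
    by (simp add: inner_add_left inner_add_right power2_eq_square)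
qed

text \<open>
  The hyperplane formula is the quotient of the formulas for the space and for a line; the formula
  with the factor in direction v is the product of those for the hyperplane orthogonal to v and for
  the line along v.
\<close>

lemma nn_integral_gauss_dir:
  fixes v :: "'a::euclidean_space"
  assumes "c > 0" "b \<ge> 0"
  shows "(\<integral>\<^sup>+x. gauss_dir c b v x \<partial>lborel) =
    ennreal (sqrt (pi / c) ^ (DIM('a) - 1) * sqrt (pi / (c + b * (norm v)\<^sup>2)))"
    (is ?dir)
    and "norm \<xi> = 1 \<Longrightarrow> (\<integral>\<^sup>+z. gauss c (z::'a) \<partial>perp_lborel \<xi>) =
      ennreal (sqrt (pi / c) ^ (DIM('a) - 1))"
proof -
  obtain m where m: "DIM('a) = Suc m" using DIM_positive[where 'a='a] not0_implies_Suc by blast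
  have pos: "sqrt (pi / c) > 0" using assms by simp
  show perp: "(\<integral>\<^sup>+z. gauss c (z::'a) \<partial>perp_lborel \<xi>) =
      ennreal (sqrt (pi / c) ^ (DIM('a) - 1))" (is "?I = _") if \<xi>: "norm \<xi> = 1" for \<xi> :: 'a
  proof -
    have "ennreal (sqrt (pi / c)) ^ DIM('a) = (\<integral>\<^sup>+x. gauss c (x::'a) \<partial>lborel)"
      by (rule nn_integral_gauss[OF assms(1), symmetric])
    also have "\<dots> = ?I * (\<integral>\<^sup>+s. ennreal (exp (- (c * (s + 0)\<^sup>2))) \<partial>lborel)"
      by (rule nn_integral_lborel_perp_prod[OF \<xi>])
        (simp_all add: norm_add_perp[OF \<xi>] ennreal_mult[symmetric] exp_add[symmetric] algebra_simps)
    also note nn_integral_gauss_real[OF assms(1), of 0]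
    finally have "?I * ennreal (sqrt (pi / c)) = ennreal (sqrt (pi / c) ^ m) * ennreal (sqrt (pi / c))"
      using pos by (simp add: m ennreal_power ennreal_mult'[symmetric] mult.commute)
    then show ?thesis using pos by (subst (asm) mult_right_ennreal_cancel) (auto simp: m)
  qed
  show ?dir
  proof (cases "v = 0")
    case True
    have "ennreal (sqrt (pi / c)) ^ DIM('a) = ennreal (sqrt (pi / c) ^ DIM('a))"
      using pos by (simp add: ennreal_power)
    also have "sqrt (pi / c) ^ DIM('a) = sqrt (pi / c) ^ (DIM('a) - 1) * sqrt (pi / c)" by (simp add: m)
    finally show ?thesis using nn_integral_gauss[OF assms(1), where 'a='a] True by simp
  next
    case False
    define r where "r = norm v"
    have r: "r > 0" using False by (simp add: r_def)
    define e where "e = v /\<^sub>R r"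
    have e: "norm e = 1" "v = r *\<^sub>R e" using r by (auto simp: e_def r_def)
    have cb: "c + b * r\<^sup>2 > 0" using assms by (simp add: add_pos_nonneg)
    have "(z + s *\<^sub>R e) \<bullet> v = r * s" if "z \<bullet> e = 0" for z s
      using that e(1) by (simp add: e(2) inner_add_left dot_square_norm)
    then have "(\<integral>\<^sup>+x. gauss_dir c b v x \<partial>lborel) =
      (\<integral>\<^sup>+z. gauss c z \<partial>perp_lborel e) * (\<integral>\<^sup>+s. ennreal (exp (- ((c + b * r\<^sup>2) * (s + 0)\<^sup>2))) \<partial>lborel)"
      by (intro nn_integral_lborel_perp_prod[OF e(1)])
        (simp_all add: norm_add_perp[OF e(1)] ennreal_mult[symmetric] exp_add[symmetric] algebra_simps power_mult_distrib)
    also have "\<dots> = ennreal (sqrt (pi / c) ^ (DIM('a) - 1) * sqrt (pi / (c + b * r\<^sup>2)))"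
      unfolding perp[OF e(1)] nn_integral_gauss_real[OF cb] using pos cb by (simp add: ennreal_mult)
    finally show ?thesis by (simp add: r_def)
  qed
qed

lemma nn_integral_gauss_dir_perp:
  fixes v :: "'a::euclidean_space"
  assumes "c > 0" "b \<ge> 0" "norm \<xi> = 1" "v \<bullet> \<xi> = 0" and dim: "2 \<le> DIM('a)"
  shows "(\<integral>\<^sup>+z. gauss_dir c b v z \<partial>perp_lborel \<xi>) =
    ennreal (sqrt (pi / c) ^ (DIM('a) - 2) * sqrt (pi / (c + b * (norm v)\<^sup>2)))" (is "?I = _")
proof -
  obtain m where m: "DIM('a) = Suc (Suc m)" using dim
    by (metis Suc_le_D numeral_2_eq_2 Suc_le_mono)
  have pos: "sqrt (pi / c) > 0" using assms by simp
  have cb: "c + b * (norm v)\<^sup>2 > 0" using assms by (simp add: add_pos_nonneg)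
  note \<xi> = assms(3)
  have "\<xi> \<bullet> v = 0" using assms(4) by (simp add: inner_commute)
  then have "(\<integral>\<^sup>+x. gauss_dir c b v x \<partial>lborel) = ?I * (\<integral>\<^sup>+s. ennreal (exp (- (c * (s + 0)\<^sup>2))) \<partial>lborel)"
    by (intro nn_integral_lborel_perp_prod[OF \<xi>])
      (simp_all add: norm_add_perp[OF \<xi>] ennreal_mult[symmetric] exp_add[symmetric] algebra_simps inner_add_left)
  also note nn_integral_gauss_real[OF assms(1), of 0]
  finally have "?I * ennreal (sqrt (pi / c)) =
    ennreal (sqrt (pi / c) ^ m * sqrt (pi / (c + b * (norm v)\<^sup>2))) * ennreal (sqrt (pi / c))"
    unfolding nn_integral_gauss_dir(1)[OF assms(1,2)]
    using pos cb by (simp add: m ennreal_mult'[symmetric] mult_ac)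
  then show ?thesis using pos by (subst (asm) mult_right_ennreal_cancel) (auto simp: m)
qed

text \<open>
  Split \<open>\<xi>\<close> into z + s e with z orthogonal to e, and complete the square in s. The
  remaining exponent on the hyperplane is again Gaussian with one distinguished direction v, the part
  of x orthogonal to e. The value has a limit after multiplication by \<open>sqrt a\<close> as a
  grows, and this limit depends on x only through the norm of v.
\<close>

lemma nn_integral_gauss_two_dirs:
  fixes x :: "'a::euclidean_space"
  assumes "c > 0" "a \<ge> 0" "b \<ge> 0" and e: "norm e = 1" and dim: "2 \<le> DIM('a)"
  shows "(\<integral>\<^sup>+\<xi>. ennreal (exp (- (c * (norm \<xi>)\<^sup>2 + a * (\<xi> \<bullet> (r *\<^sub>R e))\<^sup>2 + b * (\<xi> \<bullet> x)\<^sup>2))) \<partial>lborel) =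
    ennreal (sqrt (pi / c) ^ (DIM('a) - 2) * pi /
      sqrt (c\<^sup>2 + c * (a * r\<^sup>2 + b * (norm x)\<^sup>2) + a * b * r\<^sup>2 * (norm (x - (x \<bullet> e) *\<^sub>R e))\<^sup>2))"
proof -
  define t where "t = x \<bullet> e"
  define v where "v = x - t *\<^sub>R e"
  have ee: "e \<bullet> e = 1" using e by (simp add: dot_square_norm)
  have v: "v \<bullet> e = 0" by (simp add: v_def t_def inner_diff_left ee)
  have x: "x = v + t *\<^sub>R e" by (simp add: v_def)
  define \<alpha> where "\<alpha> = c + a * r\<^sup>2 + b * t\<^sup>2"
  have \<alpha>: "\<alpha> > 0" using assms by (simp add: \<alpha>_def add_pos_nonneg)
  define \<beta> where "\<beta> = b * (c + a * r\<^sup>2) / \<alpha>"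
  have \<beta>: "\<beta> \<ge> 0" using assms \<alpha> by (simp add: \<beta>_def)
  have \<beta>v: "c + \<beta> * (norm v)\<^sup>2 > 0" using assms \<beta> by (simp add: add_pos_nonneg)
  have "(\<integral>\<^sup>+\<xi>. ennreal (exp (- (c * (norm \<xi>)\<^sup>2 + a * (\<xi> \<bullet> (r *\<^sub>R e))\<^sup>2 + b * (\<xi> \<bullet> x)\<^sup>2))) \<partial>lborel) =
    (\<integral>\<^sup>+z. gauss_dir c \<beta> v z * ennreal (sqrt (pi / \<alpha>)) \<partial>perp_lborel e)"
  proof (rule nn_integral_lborel_perp_eq[OF e])
    fix z assume z: "z \<bullet> e = 0"
    define w where "w = z \<bullet> v"
    have "(z + s *\<^sub>R e) \<bullet> (r *\<^sub>R e) = r * s" "(z + s *\<^sub>R e) \<bullet> x = w + t * s" for s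
      using z v by (auto simp: inner_add_left inner_add_right ee x w_def inner_commute)
    moreover have "c * ((norm z)\<^sup>2 + s\<^sup>2) + a * (r * s)\<^sup>2 + b * (w + t * s)\<^sup>2 =
      (c * (norm z)\<^sup>2 + \<beta> * w\<^sup>2) + \<alpha> * (s + b * t * w / \<alpha>)\<^sup>2" for s
    proof -
      have "\<alpha> * (s + b * t * w / \<alpha>)\<^sup>2 = \<alpha> * s\<^sup>2 + 2 * b * t * w * s + (b * t * w)\<^sup>2 / \<alpha>"
        using \<alpha> by (simp add: power2_eq_square field_simps)
      moreover have num: "(b * (c + a * r\<^sup>2) + b * (b * t\<^sup>2)) * w\<^sup>2 = b * (c + a * r\<^sup>2) * w\<^sup>2 + (b * t * w)\<^sup>2"
        by (simp add: power2_eq_square algebra_simps)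
      have "\<beta> * w\<^sup>2 + (b * t * w)\<^sup>2 / \<alpha> = (b * (c + a * r\<^sup>2) + b * (b * t\<^sup>2)) * w\<^sup>2 / \<alpha>"
        unfolding num \<beta>_def by (simp add: add_divide_distrib)
      moreover have "(b * (c + a * r\<^sup>2) + b * (b * t\<^sup>2)) * w\<^sup>2 / \<alpha> = b * w\<^sup>2"
      proof -
        have "b * (c + a * r\<^sup>2) + b * (b * t\<^sup>2) = b * \<alpha>" by (simp add: \<alpha>_def algebra_simps)
        then show ?thesis using \<alpha> by simp
      qed
      ultimately show ?thesis by (simp add: \<alpha>_def power2_eq_square algebra_simps)
    qed
    ultimately have "(\<integral>\<^sup>+s. ennreal (exp (- (c * (norm (z + s *\<^sub>R e))\<^sup>2 + a * ((z + s *\<^sub>R e) \<bullet> (r *\<^sub>R e))\<^sup>2 + b * ((z + s *\<^sub>R e) \<bullet> x)\<^sup>2))) \<partial>lborel) =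
      (\<integral>\<^sup>+s. ennreal (exp (- (c * (norm z)\<^sup>2 + \<beta> * w\<^sup>2))) * ennreal (exp (- (\<alpha> * (s + b * t * w / \<alpha>)\<^sup>2))) \<partial>lborel)"
      by (simp only: norm_add_perp[OF e z] ennreal_mult[symmetric] exp_ge_zero exp_add[symmetric] minus_add_distrib)
    also have "\<dots> = ennreal (exp (- (c * (norm z)\<^sup>2 + \<beta> * w\<^sup>2))) * ennreal (sqrt (pi / \<alpha>))"
      unfolding nn_integral_gauss_real[OF \<alpha>, of "b * t * w / \<alpha>", symmetric] by (rule nn_integral_cmult) measurable
    finally show "(\<integral>\<^sup>+s. ennreal (exp (- (c * (norm (z + s *\<^sub>R e))\<^sup>2 + a * ((z + s *\<^sub>R e) \<bullet> (r *\<^sub>R e))\<^sup>2 + b * ((z + s *\<^sub>R e) \<bullet> x)\<^sup>2))) \<partial>lborel) =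
      gauss_dir c \<beta> v z * ennreal (sqrt (pi / \<alpha>))" unfolding w_def .
  qed measurable
  also have "\<dots> = (\<integral>\<^sup>+z. gauss_dir c \<beta> v z \<partial>perp_lborel e) * ennreal (sqrt (pi / \<alpha>))"
    by (rule nn_integral_multc) measurable
  also have "\<dots> = ennreal (sqrt (pi / c) ^ (DIM('a) - 2) * sqrt (pi / (c + \<beta> * (norm v)\<^sup>2)) * sqrt (pi / \<alpha>))"
    unfolding nn_integral_gauss_dir_perp[OF assms(1) \<beta> e v dim] using assms(1) \<alpha> \<beta>v
    by (simp add: ennreal_mult)
  also have "sqrt (pi / c) ^ (DIM('a) - 2) * sqrt (pi / (c + \<beta> * (norm v)\<^sup>2)) * sqrt (pi / \<alpha>) =
    sqrt (pi / c) ^ (DIM('a) - 2) * pi / sqrt (\<alpha> * (c + \<beta> * (norm v)\<^sup>2))"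
  proof -
    have "sqrt (pi / A) * sqrt (pi / B) = pi / sqrt (B * A)" for A B
      by (simp add: real_sqrt_divide real_sqrt_mult mult.commute)
    then show ?thesis by (simp add: mult.assoc)
  qed
  also have "\<alpha> * (c + \<beta> * (norm v)\<^sup>2) = c\<^sup>2 + c * (a * r\<^sup>2 + b * (norm x)\<^sup>2) + a * b * r\<^sup>2 * (norm v)\<^sup>2"
  proof -
    have "(norm x)\<^sup>2 = (norm v)\<^sup>2 + t\<^sup>2" unfolding x by (rule norm_add_perp[OF e v])
    moreover have "\<alpha> * \<beta> = b * (c + a * r\<^sup>2)" using \<alpha> by (simp add: \<beta>_def)
    then have "\<alpha> * (c + \<beta> * (norm v)\<^sup>2) = \<alpha> * c + b * (c + a * r\<^sup>2) * (norm v)\<^sup>2"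
      by (simp add: distrib_left mult.assoc[symmetric])
    ultimately show ?thesis by (simp add: \<alpha>_def power2_eq_square algebra_simps)
  qed
  finally show ?thesis by (simp add: v_def t_def)
qed

text \<open>
  The inner integral is the length of the part of the ray from 0 through y, measured in multiples of
  y, that lies in K. By Fubini the left-hand side is the integral over s > 0 of the Gaussian mass of K
  / s, which is at most the total mass \<open>(2 pi) powr (n / 2)\<close> and at most the volume
  \<open>vol K / s ^ n\<close>. Integrating the smaller of the two bounds gives the constant n / (n -
  1), and the powers of 2 pi combine to those of the Gaussian mass of a hyperplane.
\<close>

lemma nn_integral_gauss_radial_le:
  fixes K :: "'a::euclidean_space set"
  assumes [measurable]: "K \<in> sets borel" and fin: "emeasure lborel K < \<infinity>" and pos: "measure lborel K > 0"
    and dim: "2 \<le> DIM('a)"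
  shows "(\<integral>\<^sup>+y. gauss (1/2) y * (\<integral>\<^sup>+s. indicator {0<..} s * indicator K (s *\<^sub>R y) \<partial>lborel) \<partial>lborel)
    \<le> ennreal (sqrt (2 * pi) ^ (DIM('a) - 1) * (real DIM('a) / (real DIM('a) - 1) * measure lborel K powr (1 / real DIM('a))))"
    (is "?L \<le> _")
proof -
  define n where "n = DIM('a)"
  have n: "2 \<le> n" using dim by (simp add: n_def)
  define V where "V = measure lborel K"
  have V: "V > 0" "emeasure lborel K = ennreal V"
    using pos fin by (simp_all add: V_def emeasure_eq_ennreal_measure less_top)
  define q where "q = sqrt (2 * pi)"
  have q: "q > 0" by (simp add: q_def)
  define v where "v = V powr (1 / real n)"
  have v: "v > 0" "v ^ n = V" using V n
    by (simp_all add: v_def powr_realpow[symmetric] powr_powr)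
\<comment> \<open>The two bounds on the Gaussian mass coincide at s0.\<close>
  define s0 where "s0 = v / q"
  have s0: "s0 > 0" using v q by (simp add: s0_def)
  have g: "(\<integral>\<^sup>+y. gauss (1/2) (y::'a) \<partial>lborel) = ennreal (q ^ n)"
    using nn_integral_gauss[of "1/2", where 'a='a] q by (simp add: q_def n_def ennreal_power mult.commute)
  have "?L = (\<integral>\<^sup>+y. (\<integral>\<^sup>+s. gauss (1/2) y * (indicator {0<..} s * indicator K (s *\<^sub>R y)) \<partial>lborel) \<partial>lborel)"
    by (intro nn_integral_cong nn_integral_cmult[symmetric]) measurable
  also have "\<dots> = (\<integral>\<^sup>+s. (\<integral>\<^sup>+y. gauss (1/2) y * (indicator {0<..} s * indicator K (s *\<^sub>R y)) \<partial>lborel) \<partial>lborel)"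
    by (rule lborel_pair.Fubini') measurable
  also have "\<dots> \<le> (\<integral>\<^sup>+s. ennreal (q ^ n) * indicator {0..s0} s + ennreal V * (ennreal (1 / s ^ n) * indicator {s0..} s) \<partial>lborel)"
  proof (rule nn_integral_mono)
    fix s :: real
    let ?J = "(\<integral>\<^sup>+y. gauss (1/2) (y::'a) * (indicator {0<..} s * indicator K (s *\<^sub>R y)) \<partial>lborel)"
    have A: "?J \<le> ennreal (q ^ n)" unfolding g[symmetric]
      by (rule nn_integral_mono) (auto simp: indicator_def)
    have B: "?J \<le> ennreal V * ennreal (1 / s ^ n)" if s: "s > 0"
    proof -
      have "ennreal V = ennreal (s ^ DIM('a)) * (\<integral>\<^sup>+y. indicator K (s *\<^sub>R y :: 'a) \<partial>lborel)"
        using nn_integral_lborel_scale[of "indicator K" s] s by (simp add: V(2))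
      then have "ennreal V * ennreal (1 / s ^ n) = (\<integral>\<^sup>+y. indicator K (s *\<^sub>R y :: 'a) \<partial>lborel) * (ennreal (s ^ n) * ennreal (1 / s ^ n))"
        by (simp add: n_def mult_ac)
      also have "ennreal (s ^ n) * ennreal (1 / s ^ n) = 1" using s by (simp add: ennreal_mult'[symmetric])
      finally have "ennreal V * ennreal (1 / s ^ n) = (\<integral>\<^sup>+y. indicator K (s *\<^sub>R y :: 'a) \<partial>lborel)" by simp
      moreover have "?J \<le> (\<integral>\<^sup>+y. indicator K (s *\<^sub>R y :: 'a) \<partial>lborel)"
        by (rule nn_integral_mono) (auto simp: indicator_def)
      ultimately show ?thesis by simp
    qed
    consider "s \<le> 0" | "0 < s" "s \<le> s0" | "s > s0" by linarith
    then show "?J \<le> ennreal (q ^ n) * indicator {0..s0} s + ennreal V * (ennreal (1 / s ^ n) * indicator {s0..} s)"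
    proof cases
      case 2 then show ?thesis using A by (simp add: add_increasing2)
    next
      case 3 then show ?thesis using B s0 by simp
    qed simp
  qed
  also have "\<dots> = ennreal (q ^ n) * ennreal s0 + ennreal V * ennreal (0 - (- (1 / (real (n - 1) * s0 ^ (n - 1)))))"
  proof -
    have "(\<integral>\<^sup>+s. ennreal (1 / s ^ n) * indicator {s0..} s \<partial>lborel) = ennreal (0 - (- (1 / (real (n - 1) * s0 ^ (n - 1)))))"
    proof (rule nn_integral_FTC_atLeast)
      fix x assume "s0 \<le> x"
      then have x: "x > 0" using s0 by simp
      obtain m where m: "n = Suc (Suc m)" using n by (metis Suc_le_D numeral_2_eq_2 Suc_le_mono)
      have "((\<lambda>x. - (1 / (real (Suc m) * x ^ Suc m))) has_real_derivative (1 / x ^ Suc (Suc m))) (at x)"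
      proof -
        have "((\<lambda>x. (- 1 / real (Suc m)) * inverse (x ^ Suc m)) has_real_derivative
          (- 1 / real (Suc m)) * - (inverse (x ^ Suc m) * (real (Suc m) * x ^ (Suc m - Suc 0)) * inverse (x ^ Suc m))) (at x)"
          using x by (intro DERIV_cmult DERIV_inverse' DERIV_pow) auto
        moreover have "(\<lambda>x. (- 1 / real (Suc m)) * inverse (x ^ Suc m)) = (\<lambda>x. - (1 / (real (Suc m) * x ^ Suc m)))"
          by (simp add: inverse_eq_divide)
        moreover have "(- 1 / real (Suc m)) * - (inverse (x ^ Suc m) * (real (Suc m) * x ^ (Suc m - Suc 0)) * inverse (x ^ Suc m)) = 1 / x ^ Suc (Suc m)"
          using x by (simp add: field_simps del: of_nat_Suc)
        ultimately show ?thesis by simp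
      qed
      then show "((\<lambda>x. - (1 / (real (n - 1) * x ^ (n - 1)))) has_real_derivative (1 / x ^ n)) (at x)"
        by (simp add: m)
      show "0 \<le> 1 / x ^ n" using x by simp
    next
      have "((\<lambda>x. - ((1 / real (n - 1)) * (1 / x ^ (n - 1)))) \<longlongrightarrow> - ((1 / real (n - 1)) * 0)) at_top"
        using n by (intro tendsto_intros tendsto_divide_0[OF tendsto_const] filterlim_at_top_imp_at_infinity filterlim_pow_at_top filterlim_ident) auto
      then show "((\<lambda>x. - (1 / (real (n - 1) * x ^ (n - 1)))) \<longlongrightarrow> 0) at_top" by simp
    qed measurable
    then show ?thesis using s0 by (subst nn_integral_add) (auto simp: nn_integral_cmult)
  qed
  also have "\<dots> = ennreal (q ^ n * s0 + V * (1 / (real (n - 1) * s0 ^ (n - 1))))"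
  proof -
    have nn: "0 \<le> 1 / (real (n - 1) * s0 ^ (n - 1))" "0 \<le> q ^ n * s0" using q s0 by simp_all
    show ?thesis
      using q s0 V(1) nn by (simp only: ennreal_mult[symmetric] ennreal_plus[symmetric] mult_nonneg_nonneg
        less_imp_le zero_le_power diff_minus_eq_add add_0_left)
  qed
  also have "q ^ n * s0 + V * (1 / (real (n - 1) * s0 ^ (n - 1))) = q ^ (n - 1) * (real n / (real n - 1) * v)"
  proof -
    obtain m where m: "n = Suc (Suc m)" using n by (metis Suc_le_D numeral_2_eq_2 Suc_le_mono)
    have 1: "q ^ n * s0 = q ^ (n - 1) * v" using q by (simp add: s0_def m)
    have 2: "V * (1 / (real (n - 1) * s0 ^ (n - 1))) = q ^ (n - 1) * (v / real (n - 1))"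
    proof -
      have "v ^ (n - 1) > 0" "q ^ (n - 1) > 0" "real (n - 1) > 0" using q v n by simp_all
      moreover have "V = v * v ^ (n - 1)" using v(2) by (simp add: m)
      moreover have "s0 ^ (n - 1) = v ^ (n - 1) / q ^ (n - 1)" by (simp add: s0_def power_divide)
      moreover have "v * X * (1 / (k * (X / Y))) = Y * (v / k)" if "X > 0" "Y > 0" "k > 0" for X Y k :: real
        using that by (simp add: field_simps)
      ultimately show ?thesis by metis
    qed
    show ?thesis unfolding 1 2 using n by (simp add: of_nat_diff field_simps)
  qed
  finally show ?thesis by (simp add: n_def q_def v_def V_def)
qed

section \<open>Sections of maximal measure\<close>

lemma emeasure_perp_cball_finite:
  fixes \<xi> :: "'a::euclidean_space"
  assumes \<xi>: "norm \<xi> = 1"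
  shows "emeasure (perp_lborel \<xi>) (cball 0 R) < \<infinity>"
proof -
  have "emeasure (perp_lborel \<xi>) (cball 0 R) = (\<integral>\<^sup>+z. indicator (cball 0 R) z \<partial>perp_lborel \<xi>)"
    by (subst nn_integral_indicator) auto
  also have "\<dots> = (\<integral>\<^sup>+x. indicator (cball 0 R) (x - (x \<bullet> \<xi>) *\<^sub>R \<xi>) * indicator {0..1} (x \<bullet> \<xi>) \<partial>lborel)"
    by (rule nn_integral_perp_lborel[OF \<xi>]) (auto intro: borel_measurable_indicator)
  also have "\<dots> \<le> (\<integral>\<^sup>+x. indicator (cball (0::'a) (R + 1)) x \<partial>lborel)"
  proof (rule nn_integral_mono)
    fix x :: 'a
    have "norm x \<le> norm (x - (x \<bullet> \<xi>) *\<^sub>R \<xi>) + norm ((x \<bullet> \<xi>) *\<^sub>R \<xi>)"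
      by (metis diff_add_cancel norm_triangle_ineq)
    then show "indicator (cball 0 R) (x - (x \<bullet> \<xi>) *\<^sub>R \<xi>) * indicator {0..1} (x \<bullet> \<xi>) \<le> (indicator (cball 0 (R + 1)) x :: ennreal)"
      using \<xi> by (auto simp: indicator_def)
  qed
  also have "\<dots> = emeasure lborel (cball (0::'a) (R + 1))" by (rule nn_integral_indicator) auto
  also have "\<dots> < \<infinity>" by (rule emeasure_lborel_cball_finite)
  finally show ?thesis .
qed

text \<open>
  The reflection that maps \<open>- \<xi>\<close> to \<open>\<eta>\<close>. The hyperplane orthogonal
  to \<open>- \<xi>\<close> is that orthogonal to \<open>\<xi>\<close>, and unlike the reflection that
  maps \<open>\<xi>\<close> to \<open>\<eta>\<close>, this one is continuous in \<open>\<eta>\<close>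
  at \<open>\<eta> = \<xi>\<close>, where it fixes the hyperplane pointwise. For \<open>\<eta> = -
  \<xi>\<close> division by zero makes it the identity, which is as desired.
\<close>

definition turn :: "'a::euclidean_space \<Rightarrow> 'a \<Rightarrow> 'a \<Rightarrow> 'a" where
  "turn \<xi> \<eta> x = x - (2 * (x \<bullet> (\<eta> + \<xi>)) / ((\<eta> + \<xi>) \<bullet> (\<eta> + \<xi>))) *\<^sub>R (\<eta> + \<xi>)"

lemma linear_turn: "linear (turn \<xi> \<eta>)"
  by (rule linearI) (auto simp: turn_def inner_add_left algebra_simps add_divide_distrib)

lemma norm_turn [simp]: "norm (turn \<xi> \<eta> x) = norm x"
proof (cases "\<eta> + \<xi> = 0")
  case False
  define v where "v = \<eta> + \<xi>"
  have "turn \<xi> \<eta> x \<bullet> turn \<xi> \<eta> x = x \<bullet> x"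
    using False unfolding turn_def v_def[symmetric] by (simp add: inner_diff_left inner_diff_right inner_commute)
  then show ?thesis by (simp add: norm_eq_sqrt_inner)
qed (simp add: turn_def)

lemma turn_uminus:
  assumes "norm \<xi> = 1" "norm \<eta> = 1"
  shows "turn \<xi> \<eta> (- \<xi>) = \<eta>"
proof (cases "\<eta> + \<xi> = 0")
  case True
  then have "\<eta> = - \<xi>" by (simp add: add_eq_0_iff2)
  then show ?thesis by (simp add: turn_def)
next
  case False
  define v where "v = \<eta> + \<xi>"
  have n: "\<eta> \<bullet> \<eta> = 1" "\<xi> \<bullet> \<xi> = 1" using assms by (auto simp: dot_square_norm)
  have vv: "v \<bullet> v = 2 + 2 * (\<eta> \<bullet> \<xi>)" "(- \<xi>) \<bullet> v = - (1 + \<eta> \<bullet> \<xi>)"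
    by (simp_all add: v_def inner_add_left inner_add_right n inner_commute)
  have "2 * ((- \<xi>) \<bullet> v) = - (v \<bullet> v)" unfolding vv by simp
  then have "2 * ((- \<xi>) \<bullet> v) / (v \<bullet> v) = - (v \<bullet> v) / (v \<bullet> v)" by (rule arg_cong)
  also have "\<dots> = - 1" using False by (simp add: v_def)
  finally have "turn \<xi> \<eta> (- \<xi>) = - \<xi> - (- 1) *\<^sub>R v" unfolding turn_def v_def[symmetric] by (rule arg_cong)
  then show ?thesis by (simp add: v_def)
qed

lemma borel_measurable_turn [measurable]: "turn \<xi> \<eta> \<in> borel_measurable borel"
  using linear_turn[of \<xi> \<eta>]
  by (simp add: borel_measurable_continuous_onI linear_continuous_on linear_linear)

lemma nn_integral_perp_lborel_turn:
  fixes \<xi> \<eta> :: "'a::euclidean_space"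
  assumes "norm \<xi> = 1" "norm \<eta> = 1" "h \<in> borel_measurable borel"
  shows "(\<integral>\<^sup>+z. h z \<partial>perp_lborel \<eta>) = (\<integral>\<^sup>+z. h (turn \<xi> \<eta> z) \<partial>perp_lborel \<xi>)"
proof -
  have "perp_lborel (- \<xi>) = perp_lborel \<xi>" by (simp add: perp_hyperplane_def)
  then show ?thesis
    using nn_integral_perp_lborel_orthogonal[of "- \<xi>" "turn \<xi> \<eta>" h] assms linear_turn[of \<xi> \<eta>]
    by (simp add: turn_uminus)
qed

text \<open>
  The integral over a section is an upper semicontinuous function of its normal: the reflections above
  pull nearby sections back to a fixed hyperplane, where Fatou's lemma applies. Such a function
  attains its supremum on the compact sphere. Upper semicontinuity of g is what the density of a
  measure restricted to a closed set satisfies.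
\<close>

lemma sections_attain_max:
  fixes g :: "'a::euclidean_space \<Rightarrow> ennreal"
  assumes [measurable]: "g \<in> borel_measurable borel"
    and bound: "\<And>x. g x \<le> C * indicator (cball 0 R) x" "C < \<infinity>"
    and usc: "\<And>X x. X \<longlonglongrightarrow> x \<Longrightarrow> limsup (\<lambda>k. g (X k)) \<le> g x"
  shows "\<exists>\<xi>\<in>sphere 0 1. \<forall>\<eta>\<in>sphere 0 1. (\<integral>\<^sup>+z. g z \<partial>perp_lborel \<eta>) \<le> (\<integral>\<^sup>+z. g z \<partial>perp_lborel \<xi>)"
proof -
  define I where "I \<xi> = (\<integral>\<^sup>+z. g z \<partial>perp_lborel \<xi>)" for \<xi>
  define S where "S = (SUP \<xi>\<in>sphere 0 1. I \<xi>)"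
  have "sphere (0::'a) 1 \<noteq> {}"
    using SOME_Basis norm_Basis by (metis mem_sphere_0 empty_iff)
  then have "I ` sphere 0 1 \<noteq> {}" by simp
  from ennreal_Sup_countable_SUP[OF this]
  obtain h :: "nat \<Rightarrow> ennreal" where h: "incseq h" "range h \<subseteq> I ` sphere 0 1" "S = (SUP i. h i)"
    unfolding S_def by auto
  then have "\<forall>k. \<exists>\<xi>\<in>sphere 0 1. h k = I \<xi>" by blast
  then obtain \<Xi> where \<Xi>: "\<And>k. \<Xi> k \<in> sphere 0 1" "\<And>k. h k = I (\<Xi> k)" by metis
  obtain \<xi> r where \<xi>: "\<xi> \<in> sphere 0 1" and r: "strict_mono r" "(\<Xi> \<circ> r) \<longlonglongrightarrow> \<xi>"
    using compact_sphere[of "0::'a" 1] \<Xi>(1) unfolding compact_def by blast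
  have \<xi>1: "norm \<xi> = 1" using \<xi> by simp
  define T where "T k = turn \<xi> (\<Xi> (r k))" for k
  have [measurable]: "T k \<in> borel_measurable borel" for k unfolding T_def by measurable
  have T_norm: "norm (T k x) = norm x" for k x by (simp add: T_def)
  have I_eq: "I (\<Xi> (r k)) = (\<integral>\<^sup>+z. g (T k z) \<partial>perp_lborel \<xi>)" for k
    unfolding I_def T_def using \<xi>1 \<Xi>(1)[of "r k"] by (intro nn_integral_perp_lborel_turn) auto
  have "S = limsup (h \<circ> r)"
  proof -
    have "h \<longlonglongrightarrow> S" unfolding h(3) using h(1) by (rule LIMSEQ_SUP)
    then have "(h \<circ> r) \<longlonglongrightarrow> S" using r(1) by (rule LIMSEQ_subseq_LIMSEQ)
    then show ?thesis by (metis lim_imp_Limsup trivial_limit_sequentially)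
  qed
  also have "\<dots> = limsup (\<lambda>k. \<integral>\<^sup>+z. g (T k z) \<partial>perp_lborel \<xi>)" by (simp add: comp_def \<Xi>(2) I_eq)
  also have "\<dots> \<le> (\<integral>\<^sup>+z. limsup (\<lambda>k. g (T k z)) \<partial>perp_lborel \<xi>)"
  proof (rule nn_integral_limsup[where w = "\<lambda>z. C * indicator (cball 0 R) z"])
    show "AE z in perp_lborel \<xi>. g (T k z) \<le> C * indicator (cball 0 R) z" for k
    proof (rule AE_I2)
      fix z show "g (T k z) \<le> C * indicator (cball 0 R) z"
        using bound(1)[of "T k z"] by (simp add: T_norm indicator_def)
    qed
    show "(\<integral>\<^sup>+z. C * indicator (cball 0 R) z \<partial>perp_lborel \<xi>) < \<infinity>"
      using emeasure_perp_cball_finite[OF \<xi>1, of R] bound(2)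
      by (subst nn_integral_cmult_indicator) (auto simp: ennreal_mult_less_top)
  qed (auto intro!: borel_measurable_times_ennreal borel_measurable_indicator)
  also have "\<dots> \<le> (\<integral>\<^sup>+z. g z \<partial>perp_lborel \<xi>)"
  proof (rule nn_integral_perp_mono[OF \<xi>1])
    fix z assume z: "z \<bullet> \<xi> = 0"
    have v_lim: "(\<lambda>k. \<Xi> (r k)) \<longlonglongrightarrow> \<xi>" using r(2) by (simp add: comp_def)
    have "\<xi> + \<xi> \<noteq> 0" using \<xi>1 by (metis add.inverse_unique norm_zero scaleR_2 scaleR_eq_0_iff zero_neq_numeral zero_neq_one)
    then have "(\<lambda>k. T k z) \<longlonglongrightarrow> z - (2 * (z \<bullet> (\<xi> + \<xi>)) / ((\<xi> + \<xi>) \<bullet> (\<xi> + \<xi>))) *\<^sub>R (\<xi> + \<xi>)"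
      unfolding T_def turn_def by (intro tendsto_intros v_lim) simp
    then have "(\<lambda>k. T k z) \<longlonglongrightarrow> z" using z by (simp add: inner_add_right)
    then show "limsup (\<lambda>k. g (T k z)) \<le> g z" by (rule usc)
  qed
  finally have "S \<le> I \<xi>" by (simp add: I_def)
  moreover have "I \<eta> \<le> S" if "\<eta> \<in> sphere 0 1" for \<eta> unfolding S_def using that by (rule SUP_upper)
  ultimately show ?thesis using \<xi> unfolding I_def[symmetric] by (meson order_trans)
qed

section \<open>The kernel\<close>

text \<open>
  The profile, in the distance d from a line, of the potential that is built below. It is positive, so
  that truncating it gives a lower bound, and it is \<open>O((1 + d\<^sup>2) powr (- n / 2))\<close>,
  so that it is integrable over the (n - 1)-dimensional space of directions orthogonal to the line.
  For n = 4 a difference of two terms would only decay like the inverse cube, which is not integrable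
  there; the third term cancels that order, because 1 - (3/2) 2 + (1/2) 4 = 0.
\<close>

definition kern :: "nat \<Rightarrow> real \<Rightarrow> real" where
  "kern n d = (if n = 4 then 1 / sqrt (1 + d\<^sup>2) - 3 / 2 / sqrt (2 + d\<^sup>2) + 1 / 2 / sqrt (4 + d\<^sup>2)
    else 1 / sqrt (1 + d\<^sup>2) - 1 / sqrt (2 + d\<^sup>2))"

text \<open>
  The function 1 / sqrt is strictly convex and hence lies above its tangent at c.
\<close>

lemma inverse_sqrt_tangent:
  fixes c w :: real
  assumes "c > 0" "w > 0" "w \<noteq> c"
  shows "1 / sqrt w > 1 / sqrt c * (3 / 2 - w / (2 * c))"
proof -
  define t where "t = sqrt w / sqrt c"
  have t: "t > 0" "t \<noteq> 1" "t\<^sup>2 = w / c" using assms by (auto simp: t_def power_divide)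
  have "(t - 1)\<^sup>2 * (t + 2) > 0" using t by simp
  moreover have "(t - 1)\<^sup>2 * (t + 2) = t * (t\<^sup>2 - 3) + 2" by (simp add: power2_eq_square algebra_simps)
  ultimately have "t * (3 / 2 - t\<^sup>2 / 2) < 1" by (simp add: algebra_simps)
  then have "3 / 2 - t\<^sup>2 / 2 < 1 / t" using t by (simp add: pos_less_divide_eq mult.commute)
  then have "1 / sqrt c * (3 / 2 - t\<^sup>2 / 2) < 1 / sqrt c * (1 / t)"
    using assms by (intro mult_strict_left_mono) auto
  moreover have "1 / sqrt c * (1 / t) = 1 / sqrt w" using assms by (simp add: t_def)
  moreover have "t\<^sup>2 / 2 = w / (2 * c)" using t by simp
  ultimately show ?thesis by simp
qed

text \<open>
  For n = 4 this is the convexity of the inverse square root at the points 1, 2, 4 (shifted by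
  \<open>d\<^sup>2\<close>): 2 is the average of 1 and 4 with the weights 2/3 and 1/3. The values at 1
  and 4 of the tangent at 2, taken with the coefficients 1 and 1/2 of the kernel, add up to exactly
  the subtracted term.
\<close>

lemma kern_pos: "kern n d > 0"
proof (cases "n = 4")
  case True
  define c where "c = 2 + d\<^sup>2"
  have c: "c \<ge> 2" by (simp add: c_def)
  have "1 / sqrt (1 + d\<^sup>2) > 1 / sqrt c * (3 / 2 - (1 + d\<^sup>2) / (2 * c))"
    by (rule inverse_sqrt_tangent) (auto simp: c_def add_pos_nonneg)
  moreover have "1 / sqrt (4 + d\<^sup>2) > 1 / sqrt c * (3 / 2 - (4 + d\<^sup>2) / (2 * c))"
    by (rule inverse_sqrt_tangent) (auto simp: c_def add_pos_nonneg)
  moreover have "1 / sqrt c * (3 / 2 - (1 + d\<^sup>2) / (2 * c)) + 1 / 2 * (1 / sqrt c * (3 / 2 - (4 + d\<^sup>2) / (2 * c))) = 3 / 2 / sqrt c"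
  proof -
    have "1 + d\<^sup>2 = c - 1" "4 + d\<^sup>2 = c + 2" by (simp_all add: c_def)
    then have sum: "(3 / 2 - (1 + d\<^sup>2) / (2 * c)) + 1 / 2 * (3 / 2 - (4 + d\<^sup>2) / (2 * c)) = 3 / 2"
      using c by (simp only:) (simp add: field_simps)
    have "X * A + 1 / 2 * (X * B) = X * (A + 1 / 2 * B)" for X A B :: real by (simp add: algebra_simps)
    note this[of "1 / sqrt c" "3 / 2 - (1 + d\<^sup>2) / (2 * c)" "3 / 2 - (4 + d\<^sup>2) / (2 * c)", unfolded sum]
    then show ?thesis by simp
  qed
  ultimately have "1 / sqrt (1 + d\<^sup>2) + 1 / 2 * (1 / sqrt (4 + d\<^sup>2)) > 3 / 2 / sqrt c"
    by linarith
  then show ?thesis using True by (simp add: kern_def c_def)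
next
  case False
  have "sqrt (1 + d\<^sup>2) < sqrt (2 + d\<^sup>2)" "sqrt (1 + d\<^sup>2) > 0" by (simp_all add: add_pos_nonneg)
  then show ?thesis using False by (simp add: kern_def frac_less2)
qed

text \<open>
  With v = 1 + \<open>d\<^sup>2\<close>, Taylor polynomials of \<open>(1 + u) powr (- 1 / 2)\<close>
  at 0 bound the terms at v + 1 from below (first order) and at v + 3 from above (second order). The
  leading orders cancel, which leaves a multiple of \<open>v powr (- 5 / 2)\<close> for n = 4 and of
  \<open>v powr (- 3 / 2)\<close> otherwise.
\<close>

lemma kern_le:
  assumes "2 \<le> n" "n \<le> 4"
  shows "kern n d \<le> 2 / sqrt (1 + d\<^sup>2) ^ n"
proof -
  define v where "v = 1 + d\<^sup>2"
  define s where "s = sqrt v"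
  have v: "v \<ge> 1" by (simp add: v_def)
  then have s: "s \<ge> 1" "s\<^sup>2 = v" "s > 0" by (auto simp: s_def)
  have lower: "1 / sqrt (v + 1) \<ge> 1 / s * (1 - 1 / (2 * v))"
  proof (cases "1 - 1 / (2 * v) \<ge> 0")
    case True
    have "(1 - 1 / (2 * v))\<^sup>2 * (v + 1) \<le> v"
    proof -
      have "(1 - 1 / (2 * v))\<^sup>2 * (v + 1) = v - (3 * v - 1) / (4 * v\<^sup>2)"
        using v by (simp add: power2_eq_square field_simps)
      also have "\<dots> \<le> v" using v by simp
      finally show ?thesis .
    qed
    then have "sqrt ((1 - 1 / (2 * v))\<^sup>2 * (v + 1)) \<le> s" by (simp add: s_def)
    then have "(1 - 1 / (2 * v)) * sqrt (v + 1) \<le> s" using True by (simp add: real_sqrt_mult)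
    then show ?thesis using s v by (simp add: field_simps)
  next
    case False
    then have "1 / s * (1 - 1 / (2 * v)) \<le> 0" using s by (simp add: mult_le_0_iff divide_le_0_iff)
    also have "0 \<le> 1 / sqrt (v + 1)" using v by simp
    finally show ?thesis .
  qed
  show ?thesis
  proof (cases "n = 4")
    case True
    have upper: "1 / sqrt (v + 3) \<le> 1 / s * (1 - 3 / (2 * v) + 27 / (8 * v\<^sup>2))"
    proof -
      define w where "w = 3 / v"
      have w: "w \<ge> 0" "v + 3 = v * (1 + w)" using v by (auto simp: w_def field_simps)
      define p where "p = 1 - w / 2 + 3 * w\<^sup>2 / 8"
      have p: "p > 0"
      proof -
        have eq: "p = (3 * (w - 2 / 3)\<^sup>2 + 20 / 3) / 8" by (simp add: p_def power2_eq_square field_simps)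
        have "3 * (w - 2 / 3)\<^sup>2 + 20 / 3 > 0" by (rule add_nonneg_pos) auto
        then show ?thesis unfolding eq by simp
      qed
      have "p\<^sup>2 * (1 + w) = 1 + w ^ 3 * (9 * (w - 5 / 6)\<^sup>2 + 135 / 4) / 64"
        by (simp add: p_def power2_eq_square power3_eq_cube field_simps)
      then have "p\<^sup>2 * (1 + w) \<ge> 1" using w by (simp add: add_nonneg_nonneg)
      then have "v \<le> p\<^sup>2 * (v + 3)" using v unfolding w(2) by (simp add: mult.left_commute)
      then have "s \<le> sqrt (p\<^sup>2 * (v + 3))" by (simp add: s_def)
      then have "s \<le> p * sqrt (v + 3)" using p by (simp add: real_sqrt_mult)
      then have "1 / sqrt (v + 3) \<le> 1 / s * p" using s v by (simp add: field_simps)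
      moreover have "p = 1 - 3 / (2 * v) + 27 / (8 * v\<^sup>2)" by (simp add: p_def w_def power_divide)
      ultimately show ?thesis by simp
    qed
    have "kern n d = 1 / s - 3 / 2 * (1 / sqrt (v + 1)) + 1 / 2 * (1 / sqrt (v + 3))"
      using True by (simp add: kern_def s_def v_def add.commute)
    also have "\<dots> \<le> 1 / s - 3 / 2 * (1 / s * (1 - 1 / (2 * v))) + 1 / 2 * (1 / s * (1 - 3 / (2 * v) + 27 / (8 * v\<^sup>2)))"
      using lower upper by linarith
    also have "\<dots> = 27 / 16 / (s * v\<^sup>2)"
      using s v by (simp add: field_simps power2_eq_square)
    also have "\<dots> \<le> 2 / (1 * v\<^sup>2)"
      using s v by (intro frac_le mult_right_mono) auto
    also have "\<dots> = 2 / s ^ n" using s(2) True by (simp add: power_mult[symmetric] flip: s(2))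
    finally show ?thesis by (simp add: s_def v_def)
  next
    case False
    have "kern n d = 1 / s - 1 / sqrt (v + 1)"
      using False by (simp add: kern_def s_def v_def add.commute)
    also have "\<dots> \<le> 1 / s - 1 / s * (1 - 1 / (2 * v))" using lower by linarith
    also have "\<dots> = 1 / 2 / s ^ 3"
      using s by (simp add: power2_eq_square power3_eq_cube field_simps flip: s(2))
    also have "\<dots> \<le> 2 / s ^ n"
      using s assms False by (intro frac_le power_increasing) auto
    finally show ?thesis by (simp add: s_def v_def)
  qed
qed

lemma borel_measurable_kern [measurable]: "kern n \<in> borel_measurable borel"
  unfolding kern_def by (cases "n = 4") simp_all

lemma sigma_finite_perp_lborel:
  assumes "norm \<xi> = 1"
  shows "sigma_finite_measure (perp_lborel \<xi>)"
proof
  show "\<exists>A. countable A \<and> A \<subseteq> sets (perp_lborel \<xi>) \<and> \<Union> A = space (perp_lborel \<xi>) \<and> (\<forall>a\<in>A. emeasure (perp_lborel \<xi>) a \<noteq> \<infinity>)"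
  proof (intro exI[of _ "range (\<lambda>k. cball 0 (real k))"] conjI ballI)
    show "\<Union> (range (\<lambda>k. cball 0 (real k))) = space (perp_lborel \<xi>)"
      by (auto simp: real_arch_simple)
  qed (use emeasure_perp_cball_finite[OF assms] in \<open>auto simp: less_top\<close>)
qed

text \<open>
  The density is that of a multivariate Cauchy distribution. It arises by integrating the Gaussian
  \<open>exp (- s\<^sup>2 (1 + |z|\<^sup>2))\<close> with the weight \<open>s ^ (n - 1)\<close> over
  s; integrating over z first leaves the integral of \<open>exp (- s\<^sup>2)\<close> instead.
\<close>

lemma cauchy_mass_finite:
  fixes \<xi> :: "'a::euclidean_space"
  assumes \<xi>: "norm \<xi> = 1"
  shows "(\<integral>\<^sup>+z. ennreal (1 / sqrt (1 + (norm z)\<^sup>2) ^ DIM('a)) \<partial>perp_lborel \<xi>) < \<infinity>" (is "?X < _")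
proof -
  define n where "n = DIM('a)"
  obtain m where m: "n = Suc m" using DIM_positive[where 'a='a] not0_implies_Suc unfolding n_def by blast
  interpret S: sigma_finite_measure "perp_lborel \<xi>" by (rule sigma_finite_perp_lborel[OF \<xi>])
  interpret pair_sigma_finite "perp_lborel \<xi>" "lborel :: real measure" ..
  define H :: "real \<Rightarrow> ennreal" where "H s = ennreal (s ^ m * exp (- s\<^sup>2)) * indicator {0<..} s" for s
  have [measurable]: "H \<in> borel_measurable borel" unfolding H_def[abs_def] by measurable
  define G where "G = (\<integral>\<^sup>+s. H s \<partial>lborel)"
  have scale: "(\<integral>\<^sup>+s. ennreal (s ^ m * exp (- (s\<^sup>2 * c\<^sup>2))) * indicator {0<..} s \<partial>lborel) = ennreal (1 / c ^ n) * G"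
    if c: "c > 0" for c
  proof -
    have "G = ennreal \<bar>c\<bar> * (\<integral>\<^sup>+s. H (0 + c * s) \<partial>lborel)"
      unfolding G_def using c by (intro nn_integral_real_affine) auto
    also have "(\<integral>\<^sup>+s. H (0 + c * s) \<partial>lborel) = (\<integral>\<^sup>+s. ennreal (c ^ m) * (ennreal (s ^ m * exp (- (s\<^sup>2 * c\<^sup>2))) * indicator {0<..} s) \<partial>lborel)"
    proof (rule nn_integral_cong)
      fix s :: real
      show "H (0 + c * s) = ennreal (c ^ m) * (ennreal (s ^ m * exp (- (s\<^sup>2 * c\<^sup>2))) * indicator {0<..} s)"
      proof (cases "s > 0")
        case True
        then show ?thesis using c by (simp add: H_def ennreal_mult'[symmetric] power_mult_distrib mult_ac)
      next
        case False
        then show ?thesis using c by (simp add: H_def zero_less_mult_iff)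
      qed
    qed
    also have "\<dots> = ennreal (c ^ m) * (\<integral>\<^sup>+s. ennreal (s ^ m * exp (- (s\<^sup>2 * c\<^sup>2))) * indicator {0<..} s \<partial>lborel)" (is "_ = _ * ?Y")
      by (rule nn_integral_cmult) measurable
    finally have "ennreal (1 / c ^ n) * G = (ennreal (1 / c ^ n) * (ennreal c * ennreal (c ^ m))) * ?Y"
      using c by (simp add: mult.assoc)
    also have "ennreal (1 / c ^ n) * (ennreal c * ennreal (c ^ m)) = 1"
      using c by (simp add: ennreal_mult'[symmetric] m)
    finally show ?thesis by simp
  qed
  have G: "G > 0"
  proof -
    have "0 < ennreal (exp (- 4)) * emeasure lborel {1..2::real}" by (simp add: ennreal_zero_less_mult_iff)
    also have "\<dots> = (\<integral>\<^sup>+s. ennreal (exp (- 4)) * indicator {1..2::real} s \<partial>lborel)"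
      by (subst nn_integral_cmult_indicator) auto
    also have "\<dots> \<le> G" unfolding G_def
    proof (rule nn_integral_mono)
      fix s :: real
      show "ennreal (exp (- 4)) * indicator {1..2} s \<le> H s"
      proof (cases "s \<in> {1..2}")
        case True
        then have "1 * exp (- 4) \<le> s ^ m * exp (- s\<^sup>2)"
          by (intro mult_mono) (auto simp: one_le_power power2_eq_square intro: mult_mono[of s 2 s 2, simplified])
        then show ?thesis using True by (simp add: H_def ennreal_leI)
      qed simp
    qed
    finally show ?thesis .
  qed
  have "?X * G = (\<integral>\<^sup>+z. ennreal (1 / sqrt (1 + (norm z)\<^sup>2) ^ n) * G \<partial>perp_lborel \<xi>)"
    unfolding n_def by (rule nn_integral_multc[symmetric]) measurable
  also have "\<dots> = (\<integral>\<^sup>+z. \<integral>\<^sup>+s. ennreal (s ^ m * exp (- (s\<^sup>2 * (1 + (norm z)\<^sup>2)))) * indicator {0<..} s \<partial>lborel \<partial>perp_lborel \<xi>)"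
  proof (rule nn_integral_cong)
    fix z :: 'a
    have "sqrt (1 + (norm z)\<^sup>2) > 0" "(sqrt (1 + (norm z)\<^sup>2))\<^sup>2 = 1 + (norm z)\<^sup>2" by (simp_all add: add_pos_nonneg)
    then show "ennreal (1 / sqrt (1 + (norm z)\<^sup>2) ^ n) * G =
      (\<integral>\<^sup>+s. ennreal (s ^ m * exp (- (s\<^sup>2 * (1 + (norm z)\<^sup>2)))) * indicator {0<..} s \<partial>lborel)"
      using scale[of "sqrt (1 + (norm z)\<^sup>2)"] by simp
  qed
  also have "\<dots> = (\<integral>\<^sup>+s. \<integral>\<^sup>+z. ennreal (s ^ m * exp (- (s\<^sup>2 * (1 + (norm z)\<^sup>2)))) * indicator {0<..} s \<partial>perp_lborel \<xi> \<partial>lborel)"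
    by (rule Fubini'[symmetric]) measurable
  also have "\<dots> \<le> (\<integral>\<^sup>+s. ennreal (sqrt pi ^ m) * ennreal (exp (- (1 * (s + 0)\<^sup>2))) \<partial>lborel)"
  proof (rule nn_integral_mono)
    fix s :: real
    show "(\<integral>\<^sup>+z. ennreal (s ^ m * exp (- (s\<^sup>2 * (1 + (norm z)\<^sup>2)))) * indicator {0<..} s \<partial>perp_lborel \<xi>) \<le>
      ennreal (sqrt pi ^ m) * ennreal (exp (- (1 * (s + 0)\<^sup>2)))"
    proof (cases "s > 0")
      case True
      have "(\<integral>\<^sup>+z. ennreal (s ^ m * exp (- (s\<^sup>2 * (1 + (norm z)\<^sup>2)))) * indicator {0<..} s \<partial>perp_lborel \<xi>) =
        (\<integral>\<^sup>+z. ennreal (s ^ m * exp (- s\<^sup>2)) * gauss (s\<^sup>2) z \<partial>perp_lborel \<xi>)"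
        using True by (simp add: ennreal_mult'[symmetric] distrib_left exp_add exp_minus mult_ac exp_diff divide_inverse)
      also have "\<dots> = ennreal (s ^ m * exp (- s\<^sup>2)) * (\<integral>\<^sup>+z. gauss (s\<^sup>2) z \<partial>perp_lborel \<xi>)"
        by (rule nn_integral_cmult) measurable
      also have "\<dots> = ennreal (s ^ m * exp (- s\<^sup>2)) * ennreal (sqrt (pi / s\<^sup>2) ^ m)"
        using nn_integral_gauss_dir(2)[OF _ order_refl \<xi>, of "s\<^sup>2"] True by (simp add: m n_def[symmetric])
      also have "\<dots> = ennreal (sqrt pi ^ m * exp (- s\<^sup>2))"
        using True by (simp add: ennreal_mult'[symmetric] real_sqrt_divide power_divide)
      finally show ?thesis by (simp add: ennreal_mult')
    qed simp
  qed
  also have "\<dots> = ennreal (sqrt pi ^ m) * ennreal (sqrt (pi / 1))"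
    unfolding nn_integral_gauss_real[OF zero_less_one, of 0, symmetric] by (rule nn_integral_cmult) measurable
  also have "\<dots> < \<infinity>" by (simp add: ennreal_mult_less_top)
  finally have "?X * G < \<infinity>" .
  then show ?thesis using G by (auto simp: ennreal_mult_less_top)
qed

abbreviation kern_total :: "'a::euclidean_space \<Rightarrow> ennreal" where
  "kern_total e \<equiv> (\<integral>\<^sup>+z. ennreal (kern DIM('a) (norm (z::'a))) \<partial>perp_lborel e)"

lemma kern_mass_finite:
  fixes \<xi> :: "'a::euclidean_space"
  assumes \<xi>: "norm \<xi> = 1" and dim: "2 \<le> DIM('a)" "DIM('a) \<le> 4"
  shows "kern_total \<xi> < \<infinity>"
proof -
  have "kern_total \<xi> \<le>
    (\<integral>\<^sup>+z. 2 * ennreal (1 / sqrt (1 + (norm z)\<^sup>2) ^ DIM('a)) \<partial>perp_lborel \<xi>)"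
  proof (rule nn_integral_mono)
    fix z :: 'a
    have "ennreal (kern DIM('a) (norm z)) \<le> ennreal (2 * (1 / sqrt (1 + (norm z)\<^sup>2) ^ DIM('a)))"
      using kern_le[OF dim, of "norm z"] by (intro ennreal_leI) simp
    then show "ennreal (kern DIM('a) (norm z)) \<le> 2 * ennreal (1 / sqrt (1 + (norm z)\<^sup>2) ^ DIM('a))"
      by (subst (asm) ennreal_mult) auto
  qed
  also have "\<dots> = 2 * (\<integral>\<^sup>+z. ennreal (1 / sqrt (1 + (norm z)\<^sup>2) ^ DIM('a)) \<partial>perp_lborel \<xi>)"
    by (rule nn_integral_cmult) measurable
  also have "\<dots> < \<infinity>" using cauchy_mass_finite[OF \<xi>] by (simp add: ennreal_mult_less_top)
  finally show ?thesis .
qed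

lemma kern_mass_pos:
  fixes \<xi> :: "'a::euclidean_space"
  assumes \<xi>: "norm \<xi> = 1"
  shows "(\<integral>\<^sup>+z. ennreal (kern n (norm z)) \<partial>perp_lborel \<xi>) > 0"
proof (rule ccontr)
  assume "\<not> ?thesis"
  then have "(\<integral>\<^sup>+z. ennreal (kern n (norm z)) \<partial>perp_lborel \<xi>) = 0" by simp
  then have "AE z in perp_lborel \<xi>. ennreal (kern n (norm z)) = 0"
    by (subst (asm) nn_integral_0_iff_AE) measurable
  then have "AE z in perp_lborel \<xi>. False"
  proof (rule AE_mp, intro AE_I2 impI)
    fix z :: 'a assume "ennreal (kern n (norm z)) = 0"
    then show False using kern_pos[of n "norm z"] by (simp add: ennreal_eq_0_iff not_le)
  qed
  then have "(\<integral>\<^sup>+z. \<integral>\<^sup>+s. 1 \<partial>(lborel :: real measure) \<partial>perp_lborel \<xi>) = (\<integral>\<^sup>+z. 0 \<partial>perp_lborel \<xi>)"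
    by (intro nn_integral_cong_AE) auto
  moreover have "(\<integral>\<^sup>+(x::'a). 1 \<partial>lborel) = (\<integral>\<^sup>+z. \<integral>\<^sup>+s. 1 \<partial>(lborel :: real measure) \<partial>perp_lborel \<xi>)"
    by (rule nn_integral_lborel_perp[OF \<xi>]) measurable
  ultimately show False by simp
qed

section \<open>Gaussian approximation of central sections\<close>

text \<open>
  Up to the factor \<open>sqrt pi\<close>, an approximation of the Dirac measure at 0; the index is
  shifted to keep the variance finite.
\<close>

definition thin :: "nat \<Rightarrow> real \<Rightarrow> ennreal" where
  "thin k t = ennreal (sqrt (real (Suc k)) * exp (- (real (Suc k) * t\<^sup>2)))"

lemma borel_measurable_thin [measurable]: "thin k \<in> borel_measurable borel"
  unfolding thin_def[abs_def] by measurable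

text \<open>
  As k grows, this tends to \<open>sqrt pi / norm y\<close> times the integral of F over the
  hyperplane orthogonal to y, where F is continuous. It replaces the Radon transform, with the
  advantage that it is self-adjoint by Fubini.
\<close>

definition thin_transform :: "('a::euclidean_space \<Rightarrow> ennreal) \<Rightarrow> nat \<Rightarrow> 'a \<Rightarrow> ennreal" where
  "thin_transform F k y = (\<integral>\<^sup>+x. F x * thin k (x \<bullet> y) \<partial>lborel)"

lemma borel_measurable_thin_transform [measurable]:
  assumes [measurable]: "F \<in> borel_measurable borel"
  shows "thin_transform F k \<in> borel_measurable borel"
  unfolding thin_transform_def[abs_def] by measurable

lemma thin_transform_mono:
  assumes "\<And>x. F x \<le> G x"
  shows "thin_transform F k y \<le> thin_transform G k y"
  unfolding thin_transform_def by (intro nn_integral_mono mult_right_mono assms) simp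

lemma thin_transform_cmult:
  assumes [measurable]: "F \<in> borel_measurable borel"
  shows "thin_transform (\<lambda>x. c * F x) k y = c * thin_transform F k y"
  unfolding thin_transform_def mult.assoc by (rule nn_integral_cmult) measurable

lemma thin_transform_add:
  assumes [measurable]: "F \<in> borel_measurable borel" "G \<in> borel_measurable borel"
  shows "thin_transform (\<lambda>x. F x + G x) k y = thin_transform F k y + thin_transform G k y"
  unfolding thin_transform_def distrib_right by (rule nn_integral_add) measurable

lemma thin_transform_adjoint:
  fixes F G :: "'a::euclidean_space \<Rightarrow> ennreal"
  assumes [measurable]: "F \<in> borel_measurable borel" "G \<in> borel_measurable borel"
  shows "(\<integral>\<^sup>+y. F y * thin_transform G k y \<partial>lborel) = (\<integral>\<^sup>+x. G x * thin_transform F k x \<partial>lborel)"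
proof -
  have "(\<integral>\<^sup>+y. F y * thin_transform G k y \<partial>lborel) = (\<integral>\<^sup>+y. \<integral>\<^sup>+x. F y * (G x * thin k (x \<bullet> y)) \<partial>lborel \<partial>lborel)"
    unfolding thin_transform_def by (intro nn_integral_cong nn_integral_cmult[symmetric]) measurable
  also have "\<dots> = (\<integral>\<^sup>+x. \<integral>\<^sup>+y. G x * (F y * thin k (y \<bullet> x)) \<partial>lborel \<partial>lborel)"
    by (subst lborel_pair.Fubini') (measurable, simp add: mult_ac inner_commute)
  also have "\<dots> = (\<integral>\<^sup>+x. G x * thin_transform F k x \<partial>lborel)"
    unfolding thin_transform_def by (intro nn_integral_cong nn_integral_cmult) measurable
  finally show ?thesis .
qed

text \<open>
  This is nn_integral_gauss_radial_le for the unit ball, whose ray through y has length 1 / norm y in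
  multiples of y.
\<close>

lemma nn_integral_gauss_inverse_norm_finite:
  assumes dim: "2 \<le> DIM('a::euclidean_space)"
  shows "(\<integral>\<^sup>+y. gauss (1/2) (y::'a) * ennreal (1 / norm y) \<partial>lborel) < \<infinity>"
proof -
  have "(\<integral>\<^sup>+s. indicator {0<..} s * indicator (cball 0 1) (s *\<^sub>R y) \<partial>lborel) = ennreal (1 / norm y)"
    if "y \<noteq> 0" for y :: 'a
  proof -
    have "(\<integral>\<^sup>+s. indicator {0<..} s * indicator (cball 0 1) (s *\<^sub>R y) \<partial>lborel) = (\<integral>\<^sup>+s. indicator {0<..1 / norm y} s \<partial>lborel)"
      using that by (intro nn_integral_cong) (auto simp: indicator_def field_simps)
    then show ?thesis by simp
  qed
  note inner = this
  have "(\<integral>\<^sup>+y. gauss (1/2) (y::'a) * ennreal (1 / norm y) \<partial>lborel) =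
    (\<integral>\<^sup>+y. gauss (1/2) (y::'a) * (\<integral>\<^sup>+s. indicator {0<..} s * indicator (cball 0 1) (s *\<^sub>R y) \<partial>lborel) \<partial>lborel)"
  proof (rule nn_integral_lborel_cong_nonzero)
    fix y :: 'a assume "y \<noteq> 0"
    then show "gauss (1/2) y * ennreal (1 / norm y) =
      gauss (1/2) y * (\<integral>\<^sup>+s. indicator {0<..} s * indicator (cball 0 1) (s *\<^sub>R y) \<partial>lborel)"
      by (subst inner) simp_all
  qed
  also have "\<dots> \<le> ennreal (sqrt (2 * pi) ^ (DIM('a) - 1) * (real DIM('a) / (real DIM('a) - 1) * measure lborel (cball (0::'a) 1) powr (1 / real DIM('a))))"
    using dim emeasure_lborel_cball_finite[of "0::'a" 1] by (intro nn_integral_gauss_radial_le) (auto simp: content_cball_pos)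
  also have "\<dots> < \<infinity>" by simp
  finally show ?thesis .
qed

lemma limsup_cmult_ennreal:
  fixes f :: "nat \<Rightarrow> ennreal"
  assumes "c < \<infinity>"
  shows "limsup (\<lambda>n. c * f n) = c * limsup f"
proof (rule Limsup_compose_continuous_mono)
  show "continuous_on UNIV ((*) c)"
    using ennreal_continuous_on_cmult[of c UNIV "\<lambda>x. x"] assms by simp
  show "mono ((*) c)" by (intro monoI mult_left_mono) auto
qed simp

text \<open>
  In the coordinates y = z + c k * u e, the transform is an integral of g (z + c k * u e) with respect
  to a fixed Gaussian in u. Fatou's lemma is applied in z and in u, with the bound for g as a majorant
  in both cases.
\<close>

lemma thin_section_limsup:
  fixes g :: "'a::euclidean_space \<Rightarrow> ennreal"
  assumes [measurable]: "g \<in> borel_measurable borel"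
    and bound: "\<And>x. g x \<le> C * indicator (cball 0 R) x" "C < \<infinity>"
    and usc: "\<And>X x. X \<longlonglongrightarrow> x \<Longrightarrow> limsup (\<lambda>k. g (X k)) \<le> g x"
    and e: "norm e = 1" and r: "r > 0"
  shows "limsup (\<lambda>k. thin_transform g k (r *\<^sub>R e)) \<le> ennreal (sqrt pi / r) * (\<integral>\<^sup>+z. g z \<partial>perp_lborel e)"
proof -
  define c where "c k = 1 / (sqrt (real (Suc k)) * r)" for k :: nat
  have c: "c k > 0" for k using r by (simp add: c_def)
  have c0: "c \<longlonglongrightarrow> 0" unfolding c_def
    by (intro real_tendsto_divide_at_top[OF tendsto_const] filterlim_at_top_mult_tendsto_pos[OF tendsto_const r]
        filterlim_compose[OF sqrt_at_top] filterlim_compose[OF filterlim_real_sequentially filterlim_Suc])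
  define E :: "real \<Rightarrow> ennreal" where "E u = ennreal (exp (- (1 * (u + 0)\<^sup>2)))" for u
  have [measurable]: "E \<in> borel_measurable borel" unfolding E_def[abs_def] by measurable
  have E: "(\<integral>\<^sup>+u. E u \<partial>lborel) = ennreal (sqrt pi)"
    unfolding E_def nn_integral_gauss_real[OF zero_less_one, of 0] by simp
  define \<Phi> where "\<Phi> k z = (\<integral>\<^sup>+u. g (z + (c k * u) *\<^sub>R e) * E u \<partial>lborel)" for k z
  have [measurable]: "\<Phi> k \<in> borel_measurable borel" for k unfolding \<Phi>_def[abs_def] by measurable
  have ik: "thin_transform g k (r *\<^sub>R e) = ennreal (1 / r) * (\<integral>\<^sup>+z. \<Phi> k z \<partial>perp_lborel e)" for k
  proof -
    have "thin_transform g k (r *\<^sub>R e) = (\<integral>\<^sup>+z. ennreal (1 / r) * \<Phi> k z \<partial>perp_lborel e)"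
      unfolding thin_transform_def
    proof (rule nn_integral_lborel_perp_eq[OF e])
      fix z assume z: "z \<bullet> e = 0"
      have "(\<integral>\<^sup>+s. g (z + s *\<^sub>R e) * thin k ((z + s *\<^sub>R e) \<bullet> (r *\<^sub>R e)) \<partial>lborel) =
        ennreal \<bar>c k\<bar> * (\<integral>\<^sup>+u. g (z + (0 + c k * u) *\<^sub>R e) * thin k ((z + (0 + c k * u) *\<^sub>R e) \<bullet> (r *\<^sub>R e)) \<partial>lborel)"
        using c[of k] by (intro nn_integral_real_affine) auto
      also have "(\<integral>\<^sup>+u. g (z + (0 + c k * u) *\<^sub>R e) * thin k ((z + (0 + c k * u) *\<^sub>R e) \<bullet> (r *\<^sub>R e)) \<partial>lborel) =
        (\<integral>\<^sup>+u. ennreal (sqrt (real (Suc k))) * (g (z + (c k * u) *\<^sub>R e) * E u) \<partial>lborel)"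
      proof (rule nn_integral_cong)
        fix u
        have "(z + (0 + c k * u) *\<^sub>R e) \<bullet> (r *\<^sub>R e) = u / sqrt (real (Suc k))"
          using z e r by (simp add: inner_add_left dot_square_norm c_def)
        then have "thin k ((z + (0 + c k * u) *\<^sub>R e) \<bullet> (r *\<^sub>R e)) = ennreal (sqrt (real (Suc k))) * E u"
          by (simp add: thin_def E_def power_divide ennreal_mult)
        then show "g (z + (0 + c k * u) *\<^sub>R e) * thin k ((z + (0 + c k * u) *\<^sub>R e) \<bullet> (r *\<^sub>R e)) =
          ennreal (sqrt (real (Suc k))) * (g (z + (c k * u) *\<^sub>R e) * E u)"
          by (simp add: mult_ac)
      qed
      also have "\<dots> = ennreal (sqrt (real (Suc k))) * \<Phi> k z"
        unfolding \<Phi>_def by (rule nn_integral_cmult) measurable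
      also have "ennreal \<bar>c k\<bar> * (ennreal (sqrt (real (Suc k))) * \<Phi> k z) = ennreal (1 / r) * \<Phi> k z"
      proof -
        have "ennreal \<bar>c k\<bar> * ennreal (sqrt (real (Suc k))) = ennreal (1 / r)"
          using c[of k] by (simp add: ennreal_mult'[symmetric] c_def del: of_nat_Suc)
        then show ?thesis by (simp add: mult.assoc[symmetric])
      qed
      finally show "(\<integral>\<^sup>+s. g (z + s *\<^sub>R e) * thin k ((z + s *\<^sub>R e) \<bullet> (r *\<^sub>R e)) \<partial>lborel) = ennreal (1 / r) * \<Phi> k z" .
    qed measurable
    also have "\<dots> = ennreal (1 / r) * (\<integral>\<^sup>+z. \<Phi> k z \<partial>perp_lborel e)" by (rule nn_integral_cmult) measurable
    finally show ?thesis .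
  qed
  have "limsup (\<lambda>k. \<integral>\<^sup>+z. \<Phi> k z \<partial>perp_lborel e) \<le> (\<integral>\<^sup>+z. limsup (\<lambda>k. \<Phi> k z) \<partial>perp_lborel e)"
  proof (rule nn_integral_limsup[where w = "\<lambda>z. (C * ennreal (sqrt pi)) * indicator (cball 0 R) z"])
    show "AE z in perp_lborel e. \<Phi> k z \<le> (C * ennreal (sqrt pi)) * indicator (cball 0 R) z" for k
    proof (rule AE_mp[OF AE_perp_lborel[OF e]], rule AE_I2, rule impI)
      fix z assume z: "z \<bullet> e = 0"
      have "\<Phi> k z \<le> (\<integral>\<^sup>+u. (C * indicator (cball 0 R) z) * E u \<partial>lborel)"
        unfolding \<Phi>_def
      proof (intro nn_integral_mono mult_right_mono)
        fix u
        have "norm z \<le> norm (z + (c k * u) *\<^sub>R e)"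
          by (rule power2_le_imp_le) (simp_all add: norm_add_perp[OF e z])
        then show "g (z + (c k * u) *\<^sub>R e) \<le> C * indicator (cball 0 R) z"
          using bound(1)[of "z + (c k * u) *\<^sub>R e"]
          by (cases "norm (z + (c k * u) *\<^sub>R e) \<le> R") (auto simp: indicator_def)
      qed simp
      also have "\<dots> = (C * indicator (cball 0 R) z) * ennreal (sqrt pi)"
        unfolding E[symmetric] by (rule nn_integral_cmult) measurable
      finally show "\<Phi> k z \<le> (C * ennreal (sqrt pi)) * indicator (cball 0 R) z" by (simp add: mult_ac)
    qed
    show "(\<integral>\<^sup>+z. (C * ennreal (sqrt pi)) * indicator (cball 0 R) z \<partial>perp_lborel e) < \<infinity>"
      using emeasure_perp_cball_finite[OF e, of R] bound(2)
      by (subst nn_integral_cmult_indicator) (auto simp: ennreal_mult_less_top)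
  qed (auto intro!: borel_measurable_times_ennreal borel_measurable_indicator)
  also have "\<dots> \<le> (\<integral>\<^sup>+z. g z * ennreal (sqrt pi) \<partial>perp_lborel e)"
  proof (rule nn_integral_mono)
    fix z
    have "limsup (\<lambda>k. \<Phi> k z) \<le> (\<integral>\<^sup>+u. limsup (\<lambda>k. g (z + (c k * u) *\<^sub>R e) * E u) \<partial>lborel)"
      unfolding \<Phi>_def
    proof (rule nn_integral_limsup[where w = "\<lambda>u. C * E u"])
      show "AE u in lborel. g (z + (c k * u) *\<^sub>R e) * E u \<le> C * E u" for k
      proof (intro AE_I2 mult_right_mono)
        fix u show "g (z + (c k * u) *\<^sub>R e) \<le> C"
          using bound(1)[of "z + (c k * u) *\<^sub>R e"]
          by (cases "norm (z + (c k * u) *\<^sub>R e) \<le> R") (auto simp: indicator_def)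
      qed simp
      show "(\<integral>\<^sup>+u. C * E u \<partial>lborel) < \<infinity>"
        using bound(2) by (subst nn_integral_cmult) (auto simp: E ennreal_mult_less_top)
    qed measurable
    also have "\<dots> \<le> (\<integral>\<^sup>+u. g z * E u \<partial>lborel)"
    proof (rule nn_integral_mono)
      fix u
      have "(\<lambda>k. z + (c k * u) *\<^sub>R e) \<longlonglongrightarrow> z + (0 * u) *\<^sub>R e" by (intro tendsto_intros c0)
      then have "limsup (\<lambda>k. g (z + (c k * u) *\<^sub>R e)) \<le> g z" by (intro usc) simp
      moreover have "limsup (\<lambda>k. g (z + (c k * u) *\<^sub>R e) * E u) = E u * limsup (\<lambda>k. g (z + (c k * u) *\<^sub>R e))"
        by (subst mult.commute) (simp add: limsup_cmult_ennreal E_def)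
      ultimately show "limsup (\<lambda>k. g (z + (c k * u) *\<^sub>R e) * E u) \<le> g z * E u"
        by (simp add: mult.commute mult_left_mono)
    qed
    also have "\<dots> = g z * ennreal (sqrt pi)" unfolding E[symmetric] by (rule nn_integral_cmult) measurable
    finally show "limsup (\<lambda>k. \<Phi> k z) \<le> g z * ennreal (sqrt pi)" .
  qed
  also have "\<dots> = (\<integral>\<^sup>+z. g z \<partial>perp_lborel e) * ennreal (sqrt pi)" by (rule nn_integral_multc) measurable
  finally have "limsup (\<lambda>k. \<integral>\<^sup>+z. \<Phi> k z \<partial>perp_lborel e) \<le> (\<integral>\<^sup>+z. g z \<partial>perp_lborel e) * ennreal (sqrt pi)" .
  then have "ennreal (1 / r) * limsup (\<lambda>k. \<integral>\<^sup>+z. \<Phi> k z \<partial>perp_lborel e) \<le> ennreal (1 / r) * ((\<integral>\<^sup>+z. g z \<partial>perp_lborel e) * ennreal (sqrt pi))"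
    by (rule mult_left_mono) simp
  also have "\<dots> = ennreal (sqrt pi / r) * (\<integral>\<^sup>+z. g z \<partial>perp_lborel e)"
  proof -
    have "ennreal (sqrt pi / r) = ennreal (1 / r) * ennreal (sqrt pi)"
      using r by (simp add: ennreal_mult'[symmetric])
    then show ?thesis by (simp add: mult_ac)
  qed
  finally show ?thesis unfolding ik by (simp add: limsup_cmult_ennreal)
qed


lemma sqrt_ratio_bounds:
  assumes "c > 0" "r > 0"
  shows "sqrt (real (Suc k)) * sqrt (pi / (c + real (Suc k) * r\<^sup>2)) \<le> sqrt pi / r"
    and "(\<lambda>k. sqrt (real (Suc k)) * sqrt (pi / (c + real (Suc k) * r\<^sup>2))) \<longlonglongrightarrow> sqrt pi / r"
proof -
  have eq: "sqrt (real (Suc k)) * sqrt (pi / (c + real (Suc k) * r\<^sup>2)) = sqrt (pi / (c / real (Suc k) + r\<^sup>2))" for k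
  proof -
    have "sqrt (real (Suc k)) * sqrt (pi / (c + real (Suc k) * r\<^sup>2)) = sqrt (real (Suc k) * (pi / (c + real (Suc k) * r\<^sup>2)))"
      by (rule real_sqrt_mult[symmetric])
    also have "real (Suc k) * (pi / (c + real (Suc k) * r\<^sup>2)) = pi / ((c + real (Suc k) * r\<^sup>2) / real (Suc k))"
      by simp
    also have "(c + real (Suc k) * r\<^sup>2) / real (Suc k) = c / real (Suc k) + r\<^sup>2"
      by (simp add: add_divide_distrib del: of_nat_Suc)
    finally show ?thesis .
  qed
  have r: "sqrt pi / r = sqrt (pi / r\<^sup>2)" using assms by (simp add: real_sqrt_divide)
  show "sqrt (real (Suc k)) * sqrt (pi / (c + real (Suc k) * r\<^sup>2)) \<le> sqrt pi / r"
    unfolding eq r using assms by (intro real_sqrt_le_mono divide_left_mono) (auto simp: add_nonneg_pos simp del: of_nat_Suc)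
  have "(\<lambda>k. c / real (Suc k)) \<longlonglongrightarrow> 0"
    by (intro real_tendsto_divide_at_top[OF tendsto_const] filterlim_compose[OF filterlim_real_sequentially filterlim_Suc])
  then have "(\<lambda>k. sqrt (pi / (c / real (Suc k) + r\<^sup>2))) \<longlonglongrightarrow> sqrt (pi / (0 + r\<^sup>2))"
    using assms by (intro tendsto_intros) auto
  then show "(\<lambda>k. sqrt (real (Suc k)) * sqrt (pi / (c + real (Suc k) * r\<^sup>2))) \<longlonglongrightarrow> sqrt pi / r"
    unfolding eq r by simp
qed

lemma thin_transform_gauss:
  fixes v :: "'a::euclidean_space"
  assumes c: "c > 0"
  shows "thin_transform (gauss c) k v =
    ennreal (sqrt (pi / c) ^ (DIM('a) - 1) * (sqrt (real (Suc k)) * sqrt (pi / (c + real (Suc k) * (norm v)\<^sup>2))))"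
proof -
  have "thin_transform (gauss c) k v =
    (\<integral>\<^sup>+x. ennreal (sqrt (real (Suc k))) * ennreal (exp (- (c * (norm x)\<^sup>2 + real (Suc k) * (x \<bullet> v)\<^sup>2))) \<partial>lborel)"
    unfolding thin_transform_def by (intro nn_integral_cong) (simp add: thin_def ennreal_mult[symmetric] exp_add[symmetric] mult_ac del: of_nat_Suc)
  also have "\<dots> = ennreal (sqrt (real (Suc k))) * (\<integral>\<^sup>+x. ennreal (exp (- (c * (norm x)\<^sup>2 + real (Suc k) * (x \<bullet> v)\<^sup>2))) \<partial>lborel)"
    by (rule nn_integral_cmult) measurable
  also have "\<dots> = ennreal (sqrt (pi / c) ^ (DIM('a) - 1) * (sqrt (real (Suc k)) * sqrt (pi / (c + real (Suc k) * (norm v)\<^sup>2))))"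
    using c by (subst nn_integral_gauss_dir(1)) (simp_all add: ennreal_mult'[symmetric] mult_ac del: of_nat_Suc)
  finally show ?thesis .
qed

lemma thin_transform_gauss_le:
  fixes v :: "'a::euclidean_space"
  assumes c: "c > 0" and v: "v \<noteq> 0"
  shows "thin_transform (gauss c) k v \<le>
    ennreal (sqrt (pi / c) ^ (DIM('a) - 1) * sqrt pi) * ennreal (1 / norm v)"
proof -
  define A where "A = sqrt (pi / c) ^ (DIM('a) - 1)"
  have A: "A \<ge> 0" using c by (simp add: A_def)
  have "A * (sqrt (real (Suc k)) * sqrt (pi / (c + real (Suc k) * (norm v)\<^sup>2))) \<le> A * (sqrt pi / norm v)"
    using v by (intro mult_left_mono A sqrt_ratio_bounds(1)[OF c]) simp
  moreover have "ennreal (A * sqrt pi) * ennreal (1 / norm v) = ennreal (A * (sqrt pi / norm v))"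
    using A by (simp add: ennreal_mult'[symmetric])
  ultimately show ?thesis unfolding thin_transform_gauss[OF c] A_def[symmetric] by (simp add: ennreal_leI)
qed

text \<open>
  A measure with density g, all of whose central sections are at most M, is compared with the Gaussian
  whose central sections are all M, with density \<open>M / (2 pi) powr ((n - 1) / 2) exp (-
  |y|\<^sup>2 / 2)\<close>. The comparison survives integration against every function Q that is a
  limit of transforms of a nonnegative weight P: moving the transform to the other factor turns both
  sides into integrals of P against sections. For g only an upper bound of the limit is available,
  which is the direction that is needed.
\<close>

lemma section_comparison:
  fixes g P Q :: "'a::euclidean_space \<Rightarrow> ennreal"
  assumes dim: "2 \<le> DIM('a)"
    and [measurable]: "g \<in> borel_measurable borel" "P \<in> borel_measurable borel" "Q \<in> borel_measurable borel"
    and bound: "\<And>x. g x \<le> C * indicator (cball 0 R) x" "C < \<infinity>"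
    and usc: "\<And>X x. X \<longlonglongrightarrow> x \<Longrightarrow> limsup (\<lambda>k. g (X k)) \<le> g x"
    and sec: "\<And>e. norm e = 1 \<Longrightarrow> (\<integral>\<^sup>+z. g z \<partial>perp_lborel e) \<le> M"
    and P: "\<And>\<xi>. P \<xi> \<le> D * gauss 1 \<xi>" "D < \<infinity>"
    and Q: "\<And>y. y \<noteq> 0 \<Longrightarrow> (\<lambda>k. thin_transform P k y) \<longlonglongrightarrow> Q y"
  shows "ennreal (sqrt (2 * pi) ^ (DIM('a) - 1)) * (\<integral>\<^sup>+y. g y * Q y \<partial>lborel) \<le>
    M * (\<integral>\<^sup>+y. gauss (1/2) y * Q y \<partial>lborel)"
proof -
  define q where "q = sqrt (2 * pi) ^ (DIM('a) - 1)"
  have q: "q > 0" by (simp add: q_def)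
  define E :: "'a \<Rightarrow> ennreal" where "E = gauss (1/2)"
  have [measurable]: "E \<in> borel_measurable borel" unfolding E_def by measurable
  define N :: "'a \<Rightarrow> ennreal" where "N y = ennreal (1 / norm y)" for y
  have [measurable]: "N \<in> borel_measurable borel" unfolding N_def[abs_def] by measurable
  have EN: "(\<integral>\<^sup>+y. E y * N y \<partial>lborel) < \<infinity>"
    unfolding E_def N_def by (rule nn_integral_gauss_inverse_norm_finite[OF dim])
  have ae0: "AE y in lborel. y \<noteq> (0::'a)" by (rule AE_lborel_singleton)
  have P_fin: "P \<xi> < \<infinity>" for \<xi> using P by (intro le_less_trans[OF P(1)]) (simp add: ennreal_mult_less_top)
  have g_fin: "g y < \<infinity>" for y
    using bound(1)[of y] bound(2) by (cases "y \<in> cball 0 R") (auto intro: le_less_trans)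
  have lim_eqs: "liminf u = l" "limsup u = l" if "u \<longlonglongrightarrow> l" for u :: "nat \<Rightarrow> ennreal" and l
    using that by (simp_all add: lim_imp_Liminf lim_imp_Limsup)
  have q_eq: "sqrt (pi / (1/2)) ^ (DIM('a) - 1) = q" by (simp add: q_def mult.commute)
\<comment> \<open>The transforms of E, P and g are all dominated by multiples of N, uniformly in k.\<close>
  have E_le: "thin_transform E k \<xi> \<le> ennreal (q * sqrt pi) * N \<xi>" if "\<xi> \<noteq> 0" for k \<xi>
    using thin_transform_gauss_le[of "1/2" \<xi> k] that unfolding q_eq E_def N_def by simp
  have E_lim: "(\<lambda>k. thin_transform E k \<xi>) \<longlonglongrightarrow> ennreal (q * sqrt pi) * N \<xi>" if "\<xi> \<noteq> 0" for \<xi>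
  proof -
    have "(\<lambda>k. ennreal (q * (sqrt (real (Suc k)) * sqrt (pi / (1/2 + real (Suc k) * (norm \<xi>)\<^sup>2))))) \<longlonglongrightarrow> ennreal (q * (sqrt pi / norm \<xi>))"
      using that by (intro tendsto_ennrealI tendsto_mult tendsto_const sqrt_ratio_bounds(2)) auto
    moreover have "thin_transform E k \<xi> = ennreal (q * (sqrt (real (Suc k)) * sqrt (pi / (1/2 + real (Suc k) * (norm \<xi>)\<^sup>2))))" for k
      unfolding E_def by (subst thin_transform_gauss) (simp_all only: q_eq half_gt_zero_iff zero_less_one)
    ultimately show ?thesis using q by (simp add: N_def ennreal_mult'[symmetric])
  qed
  have P_le: "thin_transform P k y \<le> D * ennreal (sqrt pi ^ (DIM('a) - 1) * sqrt pi) * N y" if "y \<noteq> 0" for k y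
  proof -
    have "thin_transform P k y \<le> D * thin_transform (gauss 1) k y"
      using thin_transform_mono[OF P(1)] by (subst thin_transform_cmult[symmetric]) auto
    also have "\<dots> \<le> D * (ennreal (sqrt pi ^ (DIM('a) - 1) * sqrt pi) * N y)"
      using thin_transform_gauss_le[OF zero_less_one that, of k] unfolding N_def by (intro mult_left_mono) auto
    finally show ?thesis by (simp add: mult.assoc)
  qed
  have g_le: "thin_transform g k \<xi> \<le> C * ennreal (exp (R\<^sup>2 / 2)) * (ennreal (q * sqrt pi) * N \<xi>)" if "\<xi> \<noteq> 0" for k \<xi>
  proof -
    have gE: "g y \<le> (C * ennreal (exp (R\<^sup>2 / 2))) * E y" for y
    proof (cases "y \<in> cball 0 R")
      case True
      then have "(norm y)\<^sup>2 \<le> R\<^sup>2" by (intro power_mono) auto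
      then have "ennreal 1 \<le> ennreal (exp (R\<^sup>2 / 2) * exp (- (1/2 * (norm y)\<^sup>2)))"
        by (intro ennreal_leI) (simp add: exp_add[symmetric])
      then have "C * ennreal 1 \<le> C * (ennreal (exp (R\<^sup>2 / 2)) * E y)"
        unfolding E_def by (intro mult_left_mono) (auto simp: ennreal_mult)
      then show ?thesis using bound(1)[of y] True by (simp add: mult.assoc)
    next
      case False
      then show ?thesis using bound(1)[of y] by simp
    qed
    have "thin_transform g k \<xi> \<le> (C * ennreal (exp (R\<^sup>2 / 2))) * thin_transform E k \<xi>"
      using thin_transform_mono[OF gE] by (subst thin_transform_cmult[symmetric]) auto
    also have "\<dots> \<le> C * ennreal (exp (R\<^sup>2 / 2)) * (ennreal (q * sqrt pi) * N \<xi>)"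
      by (intro mult_left_mono E_le that) simp
    finally show ?thesis .
  qed
  have g_limsup: "limsup (\<lambda>k. thin_transform g k \<xi>) \<le> ennreal (sqrt pi) * N \<xi> * M" if "\<xi> \<noteq> 0" for \<xi>
  proof -
    define e where "e = \<xi> /\<^sub>R norm \<xi>"
    have e: "norm e = 1" "\<xi> = norm \<xi> *\<^sub>R e" using that by (auto simp: e_def)
    have "limsup (\<lambda>k. thin_transform g k (norm \<xi> *\<^sub>R e)) \<le> ennreal (sqrt pi / norm \<xi>) * (\<integral>\<^sup>+z. g z \<partial>perp_lborel e)"
      using that by (intro thin_section_limsup[OF _ bound(1) bound(2) usc e(1)]) auto
    also have "\<dots> \<le> ennreal (sqrt pi / norm \<xi>) * M" by (intro mult_left_mono sec e) simp
    finally show ?thesis unfolding e(2)[symmetric] by (simp add: N_def ennreal_mult'[symmetric])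
  qed
  have "(\<integral>\<^sup>+y. g y * Q y \<partial>lborel) = (\<integral>\<^sup>+y. liminf (\<lambda>k. g y * thin_transform P k y) \<partial>lborel)"
  proof (rule nn_integral_lborel_cong_nonzero)
    fix y :: 'a assume y: "y \<noteq> 0"
    have "(\<lambda>k. g y * thin_transform P k y) \<longlonglongrightarrow> g y * Q y"
      using g_fin[of y] by (intro ennreal_tendsto_cmult Q[OF y]) auto
    then show "g y * Q y = liminf (\<lambda>k. g y * thin_transform P k y)" by (rule lim_eqs(1)[symmetric])
  qed
  also have "\<dots> \<le> liminf (\<lambda>k. \<integral>\<^sup>+y. g y * thin_transform P k y \<partial>lborel)" by (rule nn_integral_liminf) measurable
  also have "\<dots> \<le> limsup (\<lambda>k. \<integral>\<^sup>+y. g y * thin_transform P k y \<partial>lborel)" by (rule Liminf_le_Limsup) simp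
  also have "\<dots> = limsup (\<lambda>k. \<integral>\<^sup>+\<xi>. P \<xi> * thin_transform g k \<xi> \<partial>lborel)" by (subst thin_transform_adjoint) auto
  also have "\<dots> \<le> (\<integral>\<^sup>+\<xi>. limsup (\<lambda>k. P \<xi> * thin_transform g k \<xi>) \<partial>lborel)"
  proof (rule nn_integral_limsup[where w = "\<lambda>\<xi>. (D * (C * ennreal (exp (R\<^sup>2 / 2)) * ennreal (q * sqrt pi))) * (E \<xi> * N \<xi>)"])
    show "AE \<xi> in lborel. P \<xi> * thin_transform g k \<xi> \<le> (D * (C * ennreal (exp (R\<^sup>2 / 2)) * ennreal (q * sqrt pi))) * (E \<xi> * N \<xi>)" for k
    proof (rule AE_mp[OF ae0], rule AE_I2, rule impI)
      fix \<xi> :: 'a assume \<xi>: "\<xi> \<noteq> 0"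
      have "gauss 1 \<xi> \<le> E \<xi>" unfolding E_def by (intro ennreal_leI) simp
      then have "P \<xi> \<le> D * E \<xi>" using P(1)[of \<xi>] by (meson mult_left_mono order_trans zero_le)
      then have "P \<xi> * thin_transform g k \<xi> \<le> (D * E \<xi>) * (C * ennreal (exp (R\<^sup>2 / 2)) * (ennreal (q * sqrt pi) * N \<xi>))"
        by (intro mult_mono g_le \<xi>) auto
      then show "P \<xi> * thin_transform g k \<xi> \<le> (D * (C * ennreal (exp (R\<^sup>2 / 2)) * ennreal (q * sqrt pi))) * (E \<xi> * N \<xi>)"
        by (simp add: mult_ac)
    qed
    show "(\<integral>\<^sup>+\<xi>. (D * (C * ennreal (exp (R\<^sup>2 / 2)) * ennreal (q * sqrt pi))) * (E \<xi> * N \<xi>) \<partial>lborel) < \<infinity>"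
      using P(2) bound(2) EN by (subst nn_integral_cmult) (auto simp: ennreal_mult_less_top)
  qed measurable
  also have "\<dots> \<le> (\<integral>\<^sup>+\<xi>. P \<xi> * (ennreal (sqrt pi) * N \<xi> * M) \<partial>lborel)"
  proof (rule nn_integral_lborel_mono_nonzero)
    fix \<xi> :: 'a assume \<xi>: "\<xi> \<noteq> 0"
    show "limsup (\<lambda>k. P \<xi> * thin_transform g k \<xi>) \<le> P \<xi> * (ennreal (sqrt pi) * N \<xi> * M)"
      unfolding limsup_cmult_ennreal[OF P_fin] by (intro mult_left_mono g_limsup \<xi>) simp
  qed
  finally have left: "(\<integral>\<^sup>+y. g y * Q y \<partial>lborel) \<le> (\<integral>\<^sup>+\<xi>. P \<xi> * (ennreal (sqrt pi) * N \<xi> * M) \<partial>lborel)" .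
  have "(\<integral>\<^sup>+\<xi>. P \<xi> * (ennreal (q * sqrt pi) * N \<xi>) \<partial>lborel) = (\<integral>\<^sup>+\<xi>. liminf (\<lambda>k. P \<xi> * thin_transform E k \<xi>) \<partial>lborel)"
  proof (rule nn_integral_lborel_cong_nonzero)
    fix \<xi> :: 'a assume \<xi>: "\<xi> \<noteq> 0"
    have "(\<lambda>k. P \<xi> * thin_transform E k \<xi>) \<longlonglongrightarrow> P \<xi> * (ennreal (q * sqrt pi) * N \<xi>)"
      using P_fin[of \<xi>] by (intro ennreal_tendsto_cmult E_lim[OF \<xi>]) auto
    then show "P \<xi> * (ennreal (q * sqrt pi) * N \<xi>) = liminf (\<lambda>k. P \<xi> * thin_transform E k \<xi>)"
      by (rule lim_eqs(1)[symmetric])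
  qed
  also have "\<dots> \<le> liminf (\<lambda>k. \<integral>\<^sup>+\<xi>. P \<xi> * thin_transform E k \<xi> \<partial>lborel)" by (rule nn_integral_liminf) measurable
  also have "\<dots> \<le> limsup (\<lambda>k. \<integral>\<^sup>+\<xi>. P \<xi> * thin_transform E k \<xi> \<partial>lborel)" by (rule Liminf_le_Limsup) simp
  also have "\<dots> = limsup (\<lambda>k. \<integral>\<^sup>+y. E y * thin_transform P k y \<partial>lborel)" by (subst thin_transform_adjoint) auto
  also have "\<dots> \<le> (\<integral>\<^sup>+y. limsup (\<lambda>k. E y * thin_transform P k y) \<partial>lborel)"
  proof (rule nn_integral_limsup[where w = "\<lambda>y. (D * ennreal (sqrt pi ^ (DIM('a) - 1) * sqrt pi)) * (E y * N y)"])
    show "AE y in lborel. E y * thin_transform P k y \<le> (D * ennreal (sqrt pi ^ (DIM('a) - 1) * sqrt pi)) * (E y * N y)" for k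
    proof (rule AE_mp[OF ae0], rule AE_I2, rule impI)
      fix y :: 'a assume "y \<noteq> 0"
      then have "E y * thin_transform P k y \<le> E y * (D * ennreal (sqrt pi ^ (DIM('a) - 1) * sqrt pi) * N y)"
        by (intro mult_left_mono P_le) auto
      then show "E y * thin_transform P k y \<le> (D * ennreal (sqrt pi ^ (DIM('a) - 1) * sqrt pi)) * (E y * N y)"
        by (simp add: mult_ac)
    qed
    show "(\<integral>\<^sup>+y. (D * ennreal (sqrt pi ^ (DIM('a) - 1) * sqrt pi)) * (E y * N y) \<partial>lborel) < \<infinity>"
      using P(2) EN by (subst nn_integral_cmult) (auto simp: ennreal_mult_less_top)
  qed measurable
  also have "\<dots> = (\<integral>\<^sup>+y. E y * Q y \<partial>lborel)"
  proof (rule nn_integral_lborel_cong_nonzero)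
    fix y :: 'a assume y: "y \<noteq> 0"
    have "(\<lambda>k. E y * thin_transform P k y) \<longlonglongrightarrow> E y * Q y"
      by (intro ennreal_tendsto_cmult Q[OF y]) (simp add: E_def)
    then show "limsup (\<lambda>k. E y * thin_transform P k y) = E y * Q y" by (rule lim_eqs(2))
  qed
  finally have right: "(\<integral>\<^sup>+\<xi>. P \<xi> * (ennreal (q * sqrt pi) * N \<xi>) \<partial>lborel) \<le> (\<integral>\<^sup>+y. E y * Q y \<partial>lborel)" .
  have "ennreal q * (\<integral>\<^sup>+y. g y * Q y \<partial>lborel) \<le> ennreal q * (\<integral>\<^sup>+\<xi>. P \<xi> * (ennreal (sqrt pi) * N \<xi> * M) \<partial>lborel)"
    by (intro mult_left_mono left) simp
  also have "\<dots> = (\<integral>\<^sup>+\<xi>. ennreal q * (P \<xi> * (ennreal (sqrt pi) * N \<xi> * M)) \<partial>lborel)"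
    by (rule nn_integral_cmult[symmetric]) measurable
  also have "\<dots> = (\<integral>\<^sup>+\<xi>. M * (P \<xi> * (ennreal (q * sqrt pi) * N \<xi>)) \<partial>lborel)"
    using q by (simp add: ennreal_mult mult_ac)
  also have "\<dots> = M * (\<integral>\<^sup>+\<xi>. P \<xi> * (ennreal (q * sqrt pi) * N \<xi>) \<partial>lborel)" by (rule nn_integral_cmult) measurable
  also have "\<dots> \<le> M * (\<integral>\<^sup>+y. E y * Q y \<partial>lborel)" by (intro mult_left_mono right) simp
  finally show ?thesis by (simp only: q_def E_def)
qed

section \<open>Weights with a prescribed transform\<close>

definition slab :: "'a::euclidean_space set \<Rightarrow> real \<Rightarrow> 'a \<Rightarrow> ennreal" where
  "slab K b \<xi> = (\<integral>\<^sup>+x. slab_gauss b \<xi> x * indicator K x \<partial>lborel)"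

lemma borel_measurable_slab:
  assumes [measurable]: "K \<in> sets borel"
  shows "slab K b \<in> borel_measurable borel"
  unfolding slab_def[abs_def] by measurable

lemma slab_le:
  assumes [measurable]: "K \<in> sets borel" and "b > 0"
  shows "slab K b \<xi> \<le> ennreal (sqrt b) * emeasure lborel K"
proof -
  have "slab K b \<xi> \<le> (\<integral>\<^sup>+x. ennreal (sqrt b) * indicator K x \<partial>lborel)"
    unfolding slab_def using \<open>b > 0\<close>
    by (intro nn_integral_mono mult_right_mono ennreal_leI) (auto simp: mult_le_cancel_left1)
  then show ?thesis by (simp add: nn_integral_cmult_indicator)
qed

text \<open>
  For a unit vector e, the distance from x to the line through 0 and e.
\<close>

definition axis_dist :: "'a::euclidean_space \<Rightarrow> 'a \<Rightarrow> real" where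
  "axis_dist e x = norm (x - (x \<bullet> e) *\<^sub>R e)"

definition gweight :: "'a::euclidean_space set \<Rightarrow> real \<Rightarrow> real \<Rightarrow> 'a \<Rightarrow> ennreal" where
  "gweight K c b \<xi> = gauss c \<xi> * slab K b \<xi>"

lemma borel_measurable_gweight:
  assumes "K \<in> sets borel"
  shows "gweight K c b \<in> borel_measurable borel"
  unfolding gweight_def[abs_def] using borel_measurable_slab[OF assms, measurable] by measurable

text \<open>
  By Fubini the transform is an integral over x in K of the Gaussian integral in two directions, x and
  e. The limit is dominated by the constant B on K.
\<close>

lemma gweight_transform:
  fixes K :: "'a::euclidean_space set"
  assumes [measurable]: "K \<in> sets borel" and fin: "emeasure lborel K < \<infinity>" and dim: "2 \<le> DIM('a)"
    and c: "c > 0" and b: "b > 0" and e: "norm e = 1" and r: "r > 0"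
  defines "T \<equiv> \<lambda>k. thin_transform (gweight K c b) k (r *\<^sub>R e)"
    and "L \<equiv> (\<integral>\<^sup>+x. ennreal (pi * sqrt (pi / c) ^ (DIM('a) - 2) / (r * sqrt (c / b + (axis_dist e x)\<^sup>2))) * indicator K x \<partial>lborel)"
  shows "T k < \<infinity>" "T \<longlonglongrightarrow> L" "L < \<infinity>"
proof -
  define A where "A = pi * sqrt (pi / c) ^ (DIM('a) - 2)"
  have A: "A > 0" using c by (simp add: A_def)
  have ad [measurable]: "axis_dist e \<in> borel_measurable borel" unfolding axis_dist_def[abs_def] by measurable
  define J where "J k x = A / sqrt ((c\<^sup>2 / b + c * (norm x)\<^sup>2) * (1 / real (Suc k)) + (c / b + (axis_dist e x)\<^sup>2) * r\<^sup>2)" for k x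
  have [measurable]: "J k \<in> borel_measurable borel" for k unfolding J_def[abs_def] by measurable
  have T: "T k = (\<integral>\<^sup>+x. ennreal (J k x) * indicator K x \<partial>lborel)" for k
  proof -
    define a where "a = real (Suc k)"
    have a: "a > 0" by (simp add: a_def)
    have "T k = (\<integral>\<^sup>+\<xi>. \<integral>\<^sup>+x. (gauss c \<xi> * thin k (\<xi> \<bullet> (r *\<^sub>R e))) *
        (slab_gauss b \<xi> x * indicator K x) \<partial>lborel \<partial>lborel)"
      unfolding T_def thin_transform_def gweight_def slab_def
      by (intro nn_integral_cong, subst nn_integral_cmult) (auto simp: mult_ac)
    also have "\<dots> = (\<integral>\<^sup>+x. \<integral>\<^sup>+\<xi>. (gauss c \<xi> * thin k (\<xi> \<bullet> (r *\<^sub>R e))) *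
        (slab_gauss b \<xi> x * indicator K x) \<partial>lborel \<partial>lborel)"
      by (rule lborel_pair.Fubini') measurable
    also have "\<dots> = (\<integral>\<^sup>+x. ennreal (J k x) * indicator K x \<partial>lborel)"
    proof (rule nn_integral_cong)
      fix x :: 'a
      define G where "G \<xi> = ennreal (exp (- (c * (norm \<xi>)\<^sup>2 + a * (\<xi> \<bullet> (r *\<^sub>R e))\<^sup>2 + b * (\<xi> \<bullet> x)\<^sup>2)))" for \<xi> :: 'a
      have [measurable]: "G \<in> borel_measurable borel" unfolding G_def[abs_def] by measurable
      have "(\<integral>\<^sup>+\<xi>. (gauss c \<xi> * thin k (\<xi> \<bullet> (r *\<^sub>R e))) *
          (slab_gauss b \<xi> x * indicator K x) \<partial>lborel) =
        (\<integral>\<^sup>+\<xi>. (ennreal (sqrt a * sqrt b) * indicator K x) * G \<xi> \<partial>lborel)"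
      proof (rule nn_integral_cong)
        fix \<xi>
        have "gauss c \<xi> * thin k (\<xi> \<bullet> (r *\<^sub>R e)) * slab_gauss b \<xi> x =
          ennreal (exp (- (c * (norm \<xi>)\<^sup>2)) * (sqrt a * exp (- (a * (\<xi> \<bullet> (r *\<^sub>R e))\<^sup>2))) * (sqrt b * exp (- b * (x \<bullet> \<xi>)\<^sup>2)))"
          using a b by (simp only: thin_def a_def[symmetric] ennreal_mult[symmetric] exp_ge_zero mult_nonneg_nonneg real_sqrt_ge_zero less_imp_le)
        also have "exp (- (c * (norm \<xi>)\<^sup>2)) * (sqrt a * exp (- (a * (\<xi> \<bullet> (r *\<^sub>R e))\<^sup>2))) * (sqrt b * exp (- b * (x \<bullet> \<xi>)\<^sup>2)) =
          (sqrt a * sqrt b) * exp (- (c * (norm \<xi>)\<^sup>2 + a * (\<xi> \<bullet> (r *\<^sub>R e))\<^sup>2 + b * (\<xi> \<bullet> x)\<^sup>2))"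
          by (simp only: minus_add_distrib exp_add inner_commute[of x] mult_ac minus_mult_left)
        also have "ennreal \<dots> = ennreal (sqrt a * sqrt b) * G \<xi>"
          unfolding G_def using a b by (intro ennreal_mult) auto
        finally show "(gauss c \<xi> * thin k (\<xi> \<bullet> (r *\<^sub>R e))) *
            (slab_gauss b \<xi> x * indicator K x) =
          (ennreal (sqrt a * sqrt b) * indicator K x) * G \<xi>"
          by (simp add: indicator_def)
      qed
      also have "\<dots> = (ennreal (sqrt a * sqrt b) * indicator K x) * (\<integral>\<^sup>+\<xi>. G \<xi> \<partial>lborel)"
        by (rule nn_integral_cmult) measurable
      also have "(\<integral>\<^sup>+\<xi>. G \<xi> \<partial>lborel) = ennreal (A / sqrt (c\<^sup>2 + c * (a * r\<^sup>2 + b * (norm x)\<^sup>2) + a * b * r\<^sup>2 * (axis_dist e x)\<^sup>2))"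
        unfolding G_def axis_dist_def A_def using a b c
        by (subst nn_integral_gauss_two_dirs[OF c _ _ e dim]) (auto simp: mult_ac)
      also have "(ennreal (sqrt a * sqrt b) * indicator K x) * \<dots> = ennreal (J k x) * indicator K x"
      proof -
        have "c\<^sup>2 + c * (a * r\<^sup>2 + b * (norm x)\<^sup>2) + a * b * r\<^sup>2 * (axis_dist e x)\<^sup>2 =
          (a * b) * ((c\<^sup>2 / b + c * (norm x)\<^sup>2) * (1 / a) + (c / b + (axis_dist e x)\<^sup>2) * r\<^sup>2)"
          using a b by (simp add: field_simps)
        then have "(sqrt a * sqrt b) * (A / sqrt (c\<^sup>2 + c * (a * r\<^sup>2 + b * (norm x)\<^sup>2) + a * b * r\<^sup>2 * (axis_dist e x)\<^sup>2)) = J k x"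
          unfolding J_def a_def[symmetric] using a b by (simp add: real_sqrt_mult)
        then have "ennreal (sqrt a * sqrt b) * ennreal (A / sqrt (c\<^sup>2 + c * (a * r\<^sup>2 + b * (norm x)\<^sup>2) + a * b * r\<^sup>2 * (axis_dist e x)\<^sup>2)) = ennreal (J k x)"
          using a b by (subst ennreal_mult'[symmetric]) auto
        then show ?thesis by (simp add: indicator_def)
      qed
      finally show "(\<integral>\<^sup>+\<xi>. (gauss c \<xi> * thin k (\<xi> \<bullet> (r *\<^sub>R e))) *
          (slab_gauss b \<xi> x * indicator K x) \<partial>lborel) = ennreal (J k x) * indicator K x" .
    qed
    finally show ?thesis .
  qed
  define B where "B = A / sqrt (c / b * r\<^sup>2)"
  have cb: "c / b * r\<^sup>2 > 0" using c b r by simp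
  have J_le: "J k x \<le> B" for k x
    unfolding J_def B_def
  proof (rule divide_left_mono)
    have "0 \<le> (c\<^sup>2 / b + c * (norm x)\<^sup>2) * (1 / real (Suc k))" "0 \<le> (axis_dist e x)\<^sup>2 * r\<^sup>2"
      using c b by simp_all
    moreover have "(c / b + (axis_dist e x)\<^sup>2) * r\<^sup>2 = c / b * r\<^sup>2 + (axis_dist e x)\<^sup>2 * r\<^sup>2"
      by (rule distrib_right)
    ultimately show "sqrt (c / b * r\<^sup>2) \<le> sqrt ((c\<^sup>2 / b + c * (norm x)\<^sup>2) * (1 / real (Suc k)) + (c / b + (axis_dist e x)\<^sup>2) * r\<^sup>2)"
      by (intro real_sqrt_le_mono) linarith
    then show "0 < sqrt ((c\<^sup>2 / b + c * (norm x)\<^sup>2) * (1 / real (Suc k)) + (c / b + (axis_dist e x)\<^sup>2) * r\<^sup>2) * sqrt (c / b * r\<^sup>2)"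
      using cb by (intro mult_pos_pos) (auto intro: less_le_trans[of 0 "sqrt (c / b * r\<^sup>2)"])
  qed (use A in simp)
  have fB: "(\<integral>\<^sup>+x. ennreal B * indicator K x \<partial>lborel) < \<infinity>"
    using fin by (simp add: nn_integral_cmult_indicator ennreal_mult_less_top)
  show "T k < \<infinity>" for k
    unfolding T by (rule le_less_trans[OF nn_integral_mono fB]) (auto intro!: mult_right_mono ennreal_leI J_le)
  have Lim: "(\<lambda>k. J k x) \<longlonglongrightarrow> A / (r * sqrt (c / b + (axis_dist e x)\<^sup>2))" for x
  proof -
    have pos: "c / b + (axis_dist e x)\<^sup>2 > 0" using c b by (simp add: add_pos_nonneg)
    have "(\<lambda>k. 1 / real (Suc k)) \<longlonglongrightarrow> 0"
      by (intro real_tendsto_divide_at_top[OF tendsto_const] filterlim_compose[OF filterlim_real_sequentially filterlim_Suc])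
    then have "(\<lambda>k. J k x) \<longlonglongrightarrow> A / sqrt ((c\<^sup>2 / b + c * (norm x)\<^sup>2) * 0 + (c / b + (axis_dist e x)\<^sup>2) * r\<^sup>2)"
      unfolding J_def using pos r by (intro tendsto_intros) auto
    also have "sqrt ((c\<^sup>2 / b + c * (norm x)\<^sup>2) * 0 + (c / b + (axis_dist e x)\<^sup>2) * r\<^sup>2) = r * sqrt (c / b + (axis_dist e x)\<^sup>2)"
      using r by (simp add: real_sqrt_mult)
    finally show ?thesis .
  qed
  show "T \<longlonglongrightarrow> L"
    unfolding T[abs_def] L_def A_def[symmetric]
  proof (rule nn_integral_dominated_convergence[where w = "\<lambda>x. ennreal B * indicator K x"])
    show "AE x in lborel. ennreal (J k x) * indicator K x \<le> ennreal B * indicator K x" for k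
      by (intro AE_I2 mult_right_mono ennreal_leI J_le) simp
    show "AE x in lborel. (\<lambda>k. ennreal (J k x) * indicator K x) \<longlonglongrightarrow> ennreal (A / (r * sqrt (c / b + (axis_dist e x)\<^sup>2))) * indicator K x"
    proof (rule AE_I2)
      fix x
      show "(\<lambda>k. ennreal (J k x) * indicator K x) \<longlonglongrightarrow> ennreal (A / (r * sqrt (c / b + (axis_dist e x)\<^sup>2))) * indicator K x"
        using tendsto_ennrealI[OF Lim[of x]] by (cases "x \<in> K") auto
    qed
  qed (use fB in \<open>measurable\<close>)
  have "A / (r * sqrt (c / b + (axis_dist e x)\<^sup>2)) \<le> B" for x
    using Lim[of x] J_le by (intro LIMSEQ_le_const2) auto
  then show "L < \<infinity>" unfolding L_def A_def[symmetric]
    by (intro le_less_trans[OF nn_integral_mono fB] mult_right_mono ennreal_leI) auto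
qed

text \<open>
  The points x of K act on y through their distance from the line through y. As
  \<open>\<epsilon>\<close> tends to 0 this concentrates on the chord of K along that line.
\<close>

definition kern_potential :: "'a::euclidean_space set \<Rightarrow> real \<Rightarrow> 'a \<Rightarrow> ennreal" where
  "kern_potential K \<epsilon> y = (\<integral>\<^sup>+x. ennreal (pi * sqrt pi ^ (DIM('a) - 2) / (norm y * \<epsilon>) *
      kern DIM('a) (axis_dist (y /\<^sub>R norm y) x / \<epsilon>)) * indicator K x \<partial>lborel)"

lemma borel_measurable_kern_potential:
  assumes [measurable]: "K \<in> sets borel"
  shows "kern_potential K \<epsilon> \<in> borel_measurable borel"
  unfolding kern_potential_def[abs_def] axis_dist_def by measurable

lemma weight_from_difference:
  fixes K :: "'a::euclidean_space set" and S N :: "'a \<Rightarrow> ennreal"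
  assumes meas: "S \<in> borel_measurable borel" "N \<in> borel_measurable borel"
    and NS: "\<And>\<xi>. N \<xi> \<le> S \<xi>" and S: "\<And>\<xi>. S \<xi> \<le> D * gauss 1 \<xi>" "D < \<infinity>"
    and lim: "\<And>e r. norm e = 1 \<Longrightarrow> r > 0 \<Longrightarrow> (\<lambda>k. thin_transform S k (r *\<^sub>R e)) \<longlonglongrightarrow> LS e r"
      "\<And>e r. norm e = 1 \<Longrightarrow> r > 0 \<Longrightarrow> (\<lambda>k. thin_transform N k (r *\<^sub>R e)) \<longlonglongrightarrow> LN e r"
    and fin: "\<And>e r k. norm e = 1 \<Longrightarrow> r > 0 \<Longrightarrow> thin_transform N k (r *\<^sub>R e) < \<infinity>"
      "\<And>e r. norm e = 1 \<Longrightarrow> r > 0 \<Longrightarrow> LN e r < \<infinity>"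
    and eq: "\<And>e r. norm e = 1 \<Longrightarrow> r > 0 \<Longrightarrow> LS e r = kern_potential K \<epsilon> (r *\<^sub>R e) + LN e r"
  shows "\<exists>P D. P \<in> borel_measurable borel \<and> D < \<infinity> \<and> (\<forall>\<xi>. P \<xi> \<le> D * gauss 1 \<xi>) \<and>
    (\<forall>y. y \<noteq> 0 \<longrightarrow> (\<lambda>k. thin_transform P k y) \<longlonglongrightarrow> kern_potential K \<epsilon> y)"
proof (intro exI conjI allI impI)
  note [measurable] = meas
  show Pm: "(\<lambda>\<xi>. S \<xi> - N \<xi>) \<in> borel_measurable borel" by measurable
  show "S \<xi> - N \<xi> \<le> D * gauss 1 \<xi>" for \<xi>
    using S(1)[of \<xi>] by (meson diff_le_self_ennreal order_trans)
  fix y :: 'a assume "y \<noteq> 0"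
  define e where "e = y /\<^sub>R norm y"
  define r where "r = norm y"
  have e: "norm e = 1" "r > 0" "y = r *\<^sub>R e" using \<open>y \<noteq> 0\<close> by (auto simp: e_def r_def)
  have "thin_transform S k y = thin_transform (\<lambda>\<xi>. S \<xi> - N \<xi>) k y + thin_transform N k y" for k
    using NS thin_transform_add[OF Pm meas(2), of k y] by (simp add: diff_add_cancel_ennreal)
  then have "thin_transform (\<lambda>\<xi>. S \<xi> - N \<xi>) k y = thin_transform S k y - thin_transform N k y" for k
    using fin(1)[OF e(1,2), of k] by (simp add: e(3) ennreal_add_diff_cancel_right less_top)
  moreover have "(\<lambda>k. thin_transform S k y - thin_transform N k y) \<longlonglongrightarrow> LS e r - LN e r"
    unfolding e(3) using fin(2)[OF e(1,2)] by (intro tendsto_diff_ennreal_general lim e) auto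
  moreover have "LS e r - LN e r = kern_potential K \<epsilon> y"
    using fin(2)[OF e(1,2)] unfolding eq[OF e(1,2)] e(3)[symmetric] by (simp add: ennreal_add_diff_cancel_right less_top)
  ultimately show "(\<lambda>k. thin_transform (\<lambda>\<xi>. S \<xi> - N \<xi>) k y) \<longlonglongrightarrow> kern_potential K \<epsilon> y"
    by simp
qed (rule S(2))

lemma gweight_le:
  assumes "K \<in> sets borel" "b > 0" "c \<ge> 1"
  shows "gweight K c b \<xi> \<le> (ennreal (sqrt b) * emeasure lborel K) * gauss 1 \<xi>"
proof -
  have "exp (- (c * (norm \<xi>)\<^sup>2)) \<le> exp (- (1 * (norm \<xi>)\<^sup>2))"
    using assms(3) by (simp add: mult_right_mono[of 1 c "(norm \<xi>)\<^sup>2", simplified])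
  then have "gweight K c b \<xi> \<le> gauss 1 \<xi> * (ennreal (sqrt b) * emeasure lborel K)"
    unfolding gweight_def by (intro mult_mono ennreal_leI slab_le assms) auto
  then show ?thesis by (simp add: mult.commute)
qed

text \<open>
  The weights are combinations of terms W c \<open>\<beta>\<close>, each the product of the Gaussian
  with parameter c and the slab function with parameter \<open>\<beta> / \<epsilon>\<^sup>2\<close>.
  Up to a common factor, the limit of the transform of W c \<open>\<beta>\<close> has the profile
  \<open>c powr (- (n - 2) / 2) / sqrt (c / \<beta> + d\<^sup>2)\<close>, with d measured in units of
  \<open>\<epsilon>\<close>. The kernel is obtained from W 1 1 - W 2 1 for n = 2, from W 1 1 - W 1
  (1/2) for n = 3, and for n = 4 from the product of the two differences of factors, that is from W 1
  1 - W 2 1 - W 1 (1/2) + W 2 (1/2). The weight is nonnegative since the Gaussian decreases in c and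
  the slab function increases in \<open>\<beta>\<close>.
\<close>

lemma exists_kernel_weight:
  fixes K :: "'a::euclidean_space set"
  assumes K: "compact K" "convex K" "\<And>x. x \<in> K \<Longrightarrow> - x \<in> K" and dim: "2 \<le> DIM('a)" "DIM('a) \<le> 4"
    and \<epsilon>: "\<epsilon> > 0"
  shows "\<exists>P D. P \<in> borel_measurable borel \<and> D < \<infinity> \<and> (\<forall>\<xi>. P \<xi> \<le> D * gauss 1 \<xi>) \<and>
    (\<forall>y. y \<noteq> 0 \<longrightarrow> (\<lambda>k. thin_transform P k y) \<longlonglongrightarrow> kern_potential K \<epsilon> y)"
proof -
  have Kb[measurable]: "K \<in> sets borel" using K(1) by (rule borel_compact)
  have Kf: "emeasure lborel K < \<infinity>" using K(1) by (rule emeasure_compact_finite)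
  have ad [measurable]: "axis_dist e \<in> borel_measurable borel" for e :: 'a unfolding axis_dist_def[abs_def] by measurable
  define b where "b = 1 / \<epsilon>\<^sup>2"
  have b: "b > 0" using \<epsilon> by (simp add: b_def)
  define A where "A = pi * sqrt pi ^ (DIM('a) - 2)"
  have A: "A > 0" by (simp add: A_def)
  define W where "W c \<beta> = gweight K c (\<beta> * b)" for c \<beta>
  have Wm [measurable]: "W c \<beta> \<in> borel_measurable borel" for c \<beta>
    unfolding W_def by (rule borel_measurable_gweight[OF Kb])
  define j where "j c d e r x = A / (r * \<epsilon>) * (sqrt (1 / c) ^ (DIM('a) - 2) / sqrt (d + (axis_dist e x / \<epsilon>)\<^sup>2))" for c d r and e x :: 'a
  have j0: "j c d e r x \<ge> 0" if "c > 0" "d > 0" "r > 0" for c d r e x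
    using that \<epsilon> A by (simp add: j_def)
  have [measurable]: "j c d e r \<in> borel_measurable borel" for c d e r unfolding j_def[abs_def] by measurable
  define L where "L c d e r = (\<integral>\<^sup>+x. ennreal (j c d e r x) * indicator K x \<partial>lborel)" for c d e r
  have tr: "thin_transform (W c \<beta>) k (r *\<^sub>R e) < \<infinity>"
      "(\<lambda>k. thin_transform (W c \<beta>) k (r *\<^sub>R e)) \<longlonglongrightarrow> L c (c / \<beta>) e r"
      "L c (c / \<beta>) e r < \<infinity>" if "c > 0" "\<beta> > 0" "norm e = 1" "r > 0" for c \<beta> r e k
  proof -
    have "pi * sqrt (pi / c) ^ (DIM('a) - 2) / (r * sqrt (c / (\<beta> * b) + (axis_dist e x)\<^sup>2)) = j c (c / \<beta>) e r x" for x
    proof -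
      have "c / (\<beta> * b) + (axis_dist e x)\<^sup>2 = \<epsilon>\<^sup>2 * (c / \<beta> + (axis_dist e x / \<epsilon>)\<^sup>2)"
        using \<epsilon> that by (simp add: b_def power_divide field_simps)
      then have 1: "sqrt (c / (\<beta> * b) + (axis_dist e x)\<^sup>2) = \<epsilon> * sqrt (c / \<beta> + (axis_dist e x / \<epsilon>)\<^sup>2)"
        using \<epsilon> by (simp add: real_sqrt_mult)
      have 2: "sqrt (pi / c) = sqrt pi * sqrt (1 / c)" by (simp add: real_sqrt_divide)
      show ?thesis unfolding 1 2 j_def A_def power_mult_distrib by (simp add: mult_ac)
    qed
    then show "thin_transform (W c \<beta>) k (r *\<^sub>R e) < \<infinity>"
      "(\<lambda>k. thin_transform (W c \<beta>) k (r *\<^sub>R e)) \<longlonglongrightarrow> L c (c / \<beta>) e r"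
      "L c (c / \<beta>) e r < \<infinity>"
      using gweight_transform[OF Kb Kf dim(1) that(1) _ that(3,4), of "\<beta> * b"] that b
      unfolding L_def W_def by auto
  qed
  have mono_b: "slab K (1 / 2 * b) \<xi> \<le> slab K (1 * b) \<xi>" for \<xi>
    unfolding slab_def using b by (intro slab_gauss_mono K) auto
  have mono_e: "gauss 2 \<xi> \<le> gauss 1 \<xi>" for \<xi> :: 'a
    by (intro ennreal_leI) simp
  have pot: "kern_potential K \<epsilon> (r *\<^sub>R e) = (\<integral>\<^sup>+x. ennreal (A / (r * \<epsilon>) * kern DIM('a) (axis_dist e x / \<epsilon>)) * indicator K x \<partial>lborel)"
    if "norm e = 1" "r > 0" for e :: 'a and r
    using that by (simp add: kern_potential_def A_def)
  have kn: "A / (r * \<epsilon>) * kern n s \<ge> 0" if "r > 0" for r n s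
    using kern_pos[of n s] A \<epsilon> that by simp
  have W_le: "W c \<beta> \<xi> \<le> ennreal (sqrt (\<beta> * b)) * emeasure lborel K * gauss 1 \<xi>" if "c \<ge> 1" "\<beta> > 0" for c \<beta> \<xi>
    unfolding W_def using b that by (intro gweight_le Kb) auto
  have one: "(\<lambda>k. thin_transform (W 1 1) k (r *\<^sub>R e)) \<longlonglongrightarrow> L 1 1 e r" if "norm e = 1" "r > 0" for e r
    using tr(2)[of 1 1 e r] that by simp
  have two_terms: ?thesis if n: "DIM('a) \<noteq> 4" and c: "c > 0" "\<beta> > 0" "c / \<beta> = 2" and c1: "sqrt (1 / c) ^ (DIM('a) - 2) = 1"
    and le: "\<And>\<xi>. W c \<beta> \<xi> \<le> W 1 1 \<xi>" for c \<beta>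
  proof (rule weight_from_difference[OF Wm Wm le W_le])
    show "ennreal (sqrt (1 * b)) * emeasure lborel K < \<infinity>" using Kf by (simp add: ennreal_mult_less_top)
    fix e :: 'a and r :: real assume er: "norm e = 1" "r > 0"
    show "(\<lambda>k. thin_transform (W 1 1) k (r *\<^sub>R e)) \<longlonglongrightarrow> L 1 1 e r" by (rule one[OF er])
    show "(\<lambda>k. thin_transform (W c \<beta>) k (r *\<^sub>R e)) \<longlonglongrightarrow> L c (c / \<beta>) e r" "L c (c / \<beta>) e r < \<infinity>"
      "thin_transform (W c \<beta>) k (r *\<^sub>R e) < \<infinity>" for k
      by (rule tr[OF c(1,2) er])+
    have "ennreal (j 1 1 e r x) = ennreal (A / (r * \<epsilon>) * kern DIM('a) (axis_dist e x / \<epsilon>)) + ennreal (j c (c / \<beta>) e r x)" for x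
      using j0[of c "c / \<beta>" r e x] kn[OF er(2), of "DIM('a)" "axis_dist e x / \<epsilon>"] er c n
      by (subst ennreal_plus[symmetric]) (auto simp: j_def kern_def c1 algebra_simps)
    then show "L 1 1 e r = kern_potential K \<epsilon> (r *\<^sub>R e) + L c (c / \<beta>) e r"
      unfolding L_def pot[OF er] by (subst nn_integral_add[symmetric]) (auto simp: distrib_right)
  qed simp_all
  consider "DIM('a) = 2" | "DIM('a) = 3" | "DIM('a) = 4" using dim by linarith
  then show ?thesis
  proof cases
    case 1
    then show ?thesis
      by (intro two_terms[of 2 1]) (auto simp: W_def gweight_def intro!: mult_right_mono mono_e)
  next
    case 2
    then show ?thesis using mono_b
      by (intro two_terms[of 1 "1/2"]) (auto simp: W_def gweight_def intro!: mult_left_mono)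
  next
    case 3
    have add_m: "(\<lambda>\<xi>. W c d \<xi> + W c' d' \<xi>) \<in> borel_measurable borel" for c d c' d' by measurable
    show ?thesis
    proof (rule weight_from_difference[OF add_m add_m])
      show "W 2 1 \<xi> + W 1 (1/2) \<xi> \<le> W 1 1 \<xi> + W 2 (1/2) \<xi>" for \<xi>
      proof -
        obtain p where p: "gauss 1 \<xi> = gauss 2 \<xi> + p"
          using mono_e[of \<xi>] by (auto simp: le_iff_add)
        obtain q where q: "slab K (1 * b) \<xi> = slab K (1 / 2 * b) \<xi> + q"
          using mono_b[of \<xi>] by (auto simp: le_iff_add)
        have "u * (s + q) + (u + p) * s + p * q = (u + p) * (s + q) + u * s" for u s :: ennreal
          by (simp add: algebra_simps)
        then show ?thesis unfolding W_def gweight_def p q by (metis le_iff_add)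
      qed
      show "W 1 1 \<xi> + W 2 (1/2) \<xi> \<le> (ennreal (sqrt (1 * b)) * emeasure lborel K + ennreal (sqrt (1/2 * b)) * emeasure lborel K) * gauss 1 \<xi>" for \<xi>
        unfolding distrib_right by (intro add_mono W_le) auto
      show "ennreal (sqrt (1 * b)) * emeasure lborel K + ennreal (sqrt (1/2 * b)) * emeasure lborel K < \<infinity>"
        using Kf by (simp add: ennreal_mult_less_top)
      fix e :: 'a and r :: real assume er: "norm e = 1" "r > 0"
      have t21: "(\<lambda>k. thin_transform (W 2 1) k (r *\<^sub>R e)) \<longlonglongrightarrow> L 2 2 e r" "L 2 2 e r < \<infinity>"
        "thin_transform (W 2 1) k (r *\<^sub>R e) < \<infinity>" for k using tr[of 2 1 e r] er by auto
      have t12: "(\<lambda>k. thin_transform (W 1 (1/2)) k (r *\<^sub>R e)) \<longlonglongrightarrow> L 1 2 e r" "L 1 2 e r < \<infinity>"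
        "thin_transform (W 1 (1/2)) k (r *\<^sub>R e) < \<infinity>" for k using tr[of 1 "1/2" e r] er by auto
      have t22: "(\<lambda>k. thin_transform (W 2 (1/2)) k (r *\<^sub>R e)) \<longlonglongrightarrow> L 2 4 e r" using tr(2)[of 2 "1/2" e r] er by simp
      show "(\<lambda>k. thin_transform (\<lambda>\<xi>. W 1 1 \<xi> + W 2 (1/2) \<xi>) k (r *\<^sub>R e)) \<longlonglongrightarrow> L 1 1 e r + L 2 4 e r"
        unfolding thin_transform_add[OF Wm Wm] by (intro tendsto_add one er t22)
      show "(\<lambda>k. thin_transform (\<lambda>\<xi>. W 2 1 \<xi> + W 1 (1/2) \<xi>) k (r *\<^sub>R e)) \<longlonglongrightarrow> L 2 2 e r + L 1 2 e r"
        unfolding thin_transform_add[OF Wm Wm] by (intro tendsto_add t21 t12)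
      show "L 2 2 e r + L 1 2 e r < \<infinity>" using t21(2) t12(2) by simp
      show "thin_transform (\<lambda>\<xi>. W 2 1 \<xi> + W 1 (1/2) \<xi>) k (r *\<^sub>R e) < \<infinity>" for k
        unfolding thin_transform_add[OF Wm Wm] using t21(3) t12(3) by simp
      have pw: "ennreal (j 1 1 e r x) + ennreal (j 2 4 e r x) =
        ennreal (A / (r * \<epsilon>) * kern DIM('a) (axis_dist e x / \<epsilon>)) + (ennreal (j 2 2 e r x) + ennreal (j 1 2 e r x))" for x
      proof -
        have "(sqrt (1/2))\<^sup>2 = (1/2 :: real)" by simp
        then have "B * (sqrt (1 / 1) ^ (4 - 2) / sqrt (1 + s\<^sup>2)) + B * (sqrt (1/2) ^ (4 - 2) / sqrt (4 + s\<^sup>2)) =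
          B * kern 4 s + (B * (sqrt (1/2) ^ (4 - 2) / sqrt (2 + s\<^sup>2)) + B * (sqrt (1 / 1) ^ (4 - 2) / sqrt (2 + s\<^sup>2)))" for B s
          by (simp add: kern_def distrib_left right_diff_distrib)
        then have "j 1 1 e r x + j 2 4 e r x =
          A / (r * \<epsilon>) * kern DIM('a) (axis_dist e x / \<epsilon>) + (j 2 2 e r x + j 1 2 e r x)"
          unfolding j_def 3 .
        moreover have "0 \<le> j 1 1 e r x" "0 \<le> j 2 4 e r x" "0 \<le> j 2 2 e r x" "0 \<le> j 1 2 e r x"
          using er by (intro j0; simp)+
        ultimately show ?thesis
          using kn[OF er(2), of "DIM('a)" "axis_dist e x / \<epsilon>"] by (metis add_nonneg_nonneg ennreal_plus)
      qed
      have "L 1 1 e r + L 2 4 e r = (\<integral>\<^sup>+x. (ennreal (j 1 1 e r x) + ennreal (j 2 4 e r x)) * indicator K x \<partial>lborel)"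
        unfolding L_def distrib_right by (rule nn_integral_add[symmetric]) measurable
      also have "\<dots> = (\<integral>\<^sup>+x. ennreal (A / (r * \<epsilon>) * kern DIM('a) (axis_dist e x / \<epsilon>)) * indicator K x +
          (ennreal (j 2 2 e r x) * indicator K x + ennreal (j 1 2 e r x) * indicator K x) \<partial>lborel)"
        unfolding pw distrib_right ..
      also have "\<dots> = kern_potential K \<epsilon> (r *\<^sub>R e) + (L 2 2 e r + L 1 2 e r)"
      proof -
        have "(\<integral>\<^sup>+x. ennreal (j 2 2 e r x) * indicator K x + ennreal (j 1 2 e r x) * indicator K x \<partial>lborel) = L 2 2 e r + L 1 2 e r"
          unfolding L_def by (rule nn_integral_add) measurable
        then show ?thesis unfolding pot[OF er] by (subst nn_integral_add) auto
      qed
      finally show "L 1 1 e r + L 2 4 e r = kern_potential K \<epsilon> (r *\<^sub>R e) + (L 2 2 e r + L 1 2 e r)" .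
    qed
  qed
qed

section \<open>The limit of a concentrated kernel\<close>

definition chord :: "'a::euclidean_space set \<Rightarrow> 'a \<Rightarrow> 'a \<Rightarrow> ennreal" where
  "chord K e z = (\<integral>\<^sup>+s. indicator K (z + s *\<^sub>R e) \<partial>lborel)"

text \<open>
  For a convex body with the origin in its interior, the reciprocal of its gauge.
\<close>

definition radial :: "'a::euclidean_space set \<Rightarrow> 'a \<Rightarrow> ennreal" where
  "radial K y = (\<integral>\<^sup>+s. indicator {0<..} s * indicator K (s *\<^sub>R y) \<partial>lborel)"

definition kern_mass :: "'a::euclidean_space \<Rightarrow> real \<Rightarrow> ennreal" where
  "kern_mass e R = (\<integral>\<^sup>+z. ennreal (kern DIM('a) (norm z)) * indicator (cball 0 R) z \<partial>perp_lborel e)"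

text \<open>
  The half difference of the end points of a chord lies in K by symmetry, so the chord in the same
  direction through the centre is at least as long.
\<close>

lemma chord_le_central:
  fixes K :: "'a::euclidean_space set"
  assumes K: "compact K" "convex K" "\<And>x. x \<in> K \<Longrightarrow> - x \<in> K" and e: "norm e = 1"
  shows "chord K e z \<le> chord K e 0"
proof (rule chord_interval[OF K(1,2) e, of z])
  assume "{s. z + s *\<^sub>R e \<in> K} = {}"
  then have "indicator K (z + s *\<^sub>R e) = (0 :: ennreal)" for s by (auto simp: indicator_def)
  then show ?thesis by (simp add: chord_def)
next
  fix l u :: real assume lu: "l \<le> u" "{s. z + s *\<^sub>R e \<in> K} = {l..u}"
  have ind: "indicator K (z + s *\<^sub>R e) = (indicator {l..u} s :: ennreal)" for s
    unfolding lu(2)[symmetric] by (simp add: indicator_def)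
  have "l \<in> {s. z + s *\<^sub>R e \<in> K}" "u \<in> {s. z + s *\<^sub>R e \<in> K}" unfolding lu(2) using lu(1) by simp_all
  then have zl: "z + l *\<^sub>R e \<in> K" and zu: "z + u *\<^sub>R e \<in> K" by simp_all
  have mid: "(1 / 2) *\<^sub>R (p - q) \<in> K" if "p \<in> K" "q \<in> K" for p q
    using convexD[OF K(2) that(1) K(3)[OF that(2)], of "1/2" "1/2"] by (simp add: algebra_simps)
  have a: "((u - l) / 2) *\<^sub>R e \<in> K" using mid[OF zu zl] by (simp add: scaleR_diff_left[symmetric])
  have b: "(- ((u - l) / 2)) *\<^sub>R e \<in> K" using K(3)[OF a] by simp
  have "0 + s *\<^sub>R e \<in> K" if s: "s \<in> {- ((u - l) / 2)..(u - l) / 2}" for s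
  proof -
    have "s *\<^sub>R e \<in> closed_segment ((- ((u - l) / 2)) *\<^sub>R e) (((u - l) / 2) *\<^sub>R e)"
    proof (cases "u = l")
      case True then show ?thesis using s by simp
    next
      case False
      then show ?thesis unfolding in_segment using s lu(1)
        by (intro exI[of _ "s / (u - l) + 1 / 2"]) (auto simp: field_simps scaleR_add_left[symmetric])
    qed
    then show ?thesis using closed_segment_subset[OF b a K(2)] by auto
  qed
  then have "chord K e 0 \<ge> (\<integral>\<^sup>+s. indicator {- ((u - l) / 2)..(u - l) / 2} s \<partial>lborel)"
    unfolding chord_def by (intro nn_integral_mono) (auto simp: indicator_def)
  moreover have "(\<integral>\<^sup>+s. indicator {- ((u - l) / 2)..(u - l) / 2} s \<partial>lborel) = ennreal (u - l)"
    using lu(1) by (simp add: field_simps)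
  ultimately show ?thesis using lu(1) by (simp add: chord_def ind)
qed

lemma chord_central:
  fixes K :: "'a::euclidean_space set"
  assumes [measurable]: "K \<in> sets borel" and K: "\<And>x. x \<in> K \<Longrightarrow> - x \<in> K" and r: "r > 0"
  shows "chord K e 0 = ennreal (2 * r) * radial K (r *\<^sub>R e)"
proof -
  have sym: "indicator K (- x) = (indicator K x :: ennreal)" for x
    using K[of x] K[of "- x"] by (auto simp: indicator_def)
  have "chord K e 0 = ennreal \<bar>r\<bar> * (\<integral>\<^sup>+s. indicator K (0 + (0 + r * s) *\<^sub>R e) \<partial>lborel)"
    unfolding chord_def using r by (intro nn_integral_real_affine) auto
  also have "(\<integral>\<^sup>+s. indicator K (0 + (0 + r * s) *\<^sub>R e) \<partial>lborel) =
    (\<integral>\<^sup>+s. indicator {0<..} s * indicator K (s *\<^sub>R (r *\<^sub>R e)) + indicator {0<..} (- s) * indicator K ((- s) *\<^sub>R (r *\<^sub>R e)) \<partial>lborel)"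
  proof (rule nn_integral_lborel_cong_nonzero)
    fix s :: real assume "s \<noteq> 0"
    then show "indicator K (0 + (0 + r * s) *\<^sub>R e) =
      (indicator {0<..} s * indicator K (s *\<^sub>R (r *\<^sub>R e)) + indicator {0<..} (- s) * indicator K ((- s) *\<^sub>R (r *\<^sub>R e)) :: ennreal)"
      using sym[of "s *\<^sub>R (r *\<^sub>R e)"] by (cases "s > 0") (simp_all add: mult.commute)
  qed
  also have "\<dots> = radial K (r *\<^sub>R e) + (\<integral>\<^sup>+s. indicator {0<..} (- s) * indicator K ((- s) *\<^sub>R (r *\<^sub>R e)) \<partial>lborel)"
    unfolding radial_def by (rule nn_integral_add) measurable
  also have "(\<integral>\<^sup>+s. indicator {0<..} (- s) * indicator K ((- s) *\<^sub>R (r *\<^sub>R e)) \<partial>lborel) = radial K (r *\<^sub>R e)"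
    unfolding radial_def by (rule nn_integral_lborel_uminus) measurable
  also have "ennreal \<bar>r\<bar> * (radial K (r *\<^sub>R e) + radial K (r *\<^sub>R e)) = ennreal (2 * r) * radial K (r *\<^sub>R e)"
    using r by (simp add: ennreal_mult mult_2[symmetric] mult_ac)
  finally show ?thesis .
qed

text \<open>
  The convex hull of the segment from - r e to r e and a ball contains, for t < 1, a cylinder around t
  times the segment.
\<close>

lemma chord_ge:
  fixes K :: "'a::euclidean_space set"
  assumes K: "convex K" "\<And>x. x \<in> K \<Longrightarrow> - x \<in> K" and \<rho>: "cball 0 \<rho> \<subseteq> K" and t: "0 < t" "t < 1"
    and y: "r *\<^sub>R e \<in> K" "r > 0" and z: "norm z \<le> (1 - t) * \<rho>"
  shows "ennreal (2 * t * r) \<le> chord K e z"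
proof -
  have "z + s *\<^sub>R e \<in> K" if s: "s \<in> {- (t * r)..t * r}" for s
  proof -
    define c where "c = s / (t * r)"
    have c: "- 1 \<le> c" "c \<le> 1" "s = t * (c * r)" using s t y(2) by (auto simp: c_def field_simps)
    have "(1 / 2 * (1 + c)) *\<^sub>R (r *\<^sub>R e) + (1 / 2 * (1 - c)) *\<^sub>R (- (r *\<^sub>R e)) \<in> K"
      using c by (intro convexD[OF K(1) y(1) K(2)[OF y(1)]]) (auto simp: field_simps)
    also have "(1 / 2 * (1 + c)) *\<^sub>R (r *\<^sub>R e) + (1 / 2 * (1 - c)) *\<^sub>R (- (r *\<^sub>R e)) = (c * r) *\<^sub>R e"
      by (simp add: scaleR_diff_left[symmetric] field_simps)
    finally have 1: "(c * r) *\<^sub>R e \<in> K" .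
    have "norm ((1 / (1 - t)) *\<^sub>R z) \<le> \<rho>" using z t by (simp add: field_simps)
    then have 2: "(1 / (1 - t)) *\<^sub>R z \<in> K" using \<rho> by auto
    have "t *\<^sub>R ((c * r) *\<^sub>R e) + (1 - t) *\<^sub>R ((1 / (1 - t)) *\<^sub>R z) \<in> K"
      using t by (intro convexD[OF K(1) 1 2]) auto
    then show ?thesis using t c(3) by (simp add: add.commute)
  qed
  then have "(\<integral>\<^sup>+s. indicator {- (t * r)..t * r} s \<partial>lborel) \<le> chord K e z"
    unfolding chord_def by (intro nn_integral_mono) (auto simp: indicator_def)
  moreover have "(\<integral>\<^sup>+s. indicator {- (t * r)..t * r} s \<partial>lborel) = ennreal (2 * t * r)"
    using t y(2) by simp
  ultimately show ?thesis by simp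
qed

lemma kern_mass_indep:
  fixes e e' :: "'a::euclidean_space"
  assumes "norm e = 1" "norm e' = 1"
  shows "kern_mass e' R = kern_mass e R"
proof -
  have [measurable]: "cball (0::'a) R \<in> sets borel" by (auto intro: borel_closed)
  have "kern_mass e' R = (\<integral>\<^sup>+z. ennreal (kern DIM('a) (norm (turn e e' z))) * indicator (cball 0 R) (turn e e' z) \<partial>perp_lborel e)"
    unfolding kern_mass_def using assms by (intro nn_integral_perp_lborel_turn) auto
  then show ?thesis by (simp add: kern_mass_def indicator_def)
qed

text \<open>
  In the coordinates x = z + s e the kernel depends on z only.
\<close>

lemma kern_potential_slices:
  fixes K :: "'a::euclidean_space set"
  assumes [measurable]: "K \<in> sets borel" and e: "norm e = 1" and r: "r > 0" and \<epsilon>: "\<epsilon> > 0"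
  shows "kern_potential K \<epsilon> (r *\<^sub>R e) = ennreal (pi * sqrt pi ^ (DIM('a) - 2) / (r * \<epsilon>)) *
    (\<integral>\<^sup>+z. ennreal (kern DIM('a) (norm z / \<epsilon>)) * chord K e z \<partial>perp_lborel e)"
proof -
  define A where "A = pi * sqrt pi ^ (DIM('a) - 2) / (r * \<epsilon>)"
  have A: "A > 0" using r \<epsilon> by (simp add: A_def)
  have [measurable]: "axis_dist e \<in> borel_measurable borel" unfolding axis_dist_def[abs_def] by measurable
  have [measurable]: "chord K e \<in> borel_measurable borel" unfolding chord_def[abs_def] by measurable
  have "kern_potential K \<epsilon> (r *\<^sub>R e) = (\<integral>\<^sup>+x. ennreal A * (ennreal (kern DIM('a) (axis_dist e x / \<epsilon>)) * indicator K x) \<partial>lborel)"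
    using e r A by (simp add: kern_potential_def A_def[symmetric] ennreal_mult' mult.assoc)
  also have "\<dots> = ennreal A * (\<integral>\<^sup>+x. ennreal (kern DIM('a) (axis_dist e x / \<epsilon>)) * indicator K x \<partial>lborel)"
    by (rule nn_integral_cmult) measurable
  also have "(\<integral>\<^sup>+x. ennreal (kern DIM('a) (axis_dist e x / \<epsilon>)) * indicator K x \<partial>lborel) =
    (\<integral>\<^sup>+z. ennreal (kern DIM('a) (norm z / \<epsilon>)) * chord K e z \<partial>perp_lborel e)"
  proof (rule nn_integral_lborel_perp_eq[OF e])
    fix z assume z: "z \<bullet> e = 0"
    have "axis_dist e (z + s *\<^sub>R e) = norm z" for s
      using z e by (simp add: axis_dist_def inner_add_left dot_square_norm)
    then show "(\<integral>\<^sup>+s. ennreal (kern DIM('a) (axis_dist e (z + s *\<^sub>R e) / \<epsilon>)) * indicator K (z + s *\<^sub>R e) \<partial>lborel) =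
      ennreal (kern DIM('a) (norm z / \<epsilon>)) * chord K e z"
      unfolding chord_def by (simp add: nn_integral_cmult)
  qed measurable
  finally show ?thesis by (simp add: A_def)
qed

lemma kern_scaled_mass:
  fixes e :: "'a::euclidean_space"
  assumes e: "norm e = 1" and \<epsilon>: "\<epsilon> > 0"
  shows "(\<integral>\<^sup>+z. ennreal (kern DIM('a) (norm z / \<epsilon>)) * indicator (cball 0 R) z \<partial>perp_lborel e) =
      ennreal (\<epsilon> ^ (DIM('a) - 1)) * kern_mass e (R / \<epsilon>)"
    and "(\<integral>\<^sup>+z. ennreal (kern DIM('a) (norm z / \<epsilon>)) \<partial>perp_lborel e) =
      ennreal (\<epsilon> ^ (DIM('a) - 1)) * kern_total e"
proof -
  have [measurable]: "cball (0::'a) R \<in> sets borel" for R by (auto intro: borel_closed)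
  have "(\<integral>\<^sup>+z. ennreal (kern DIM('a) (norm z / \<epsilon>)) * indicator (cball 0 R) z \<partial>perp_lborel e) =
    ennreal (\<epsilon> ^ (DIM('a) - 1)) * (\<integral>\<^sup>+z. ennreal (kern DIM('a) (norm (\<epsilon> *\<^sub>R z) / \<epsilon>)) * indicator (cball 0 R) (\<epsilon> *\<^sub>R z) \<partial>perp_lborel e)"
    by (rule nn_integral_perp_lborel_scale[OF e \<epsilon>]) measurable
  also have "(\<integral>\<^sup>+z. ennreal (kern DIM('a) (norm (\<epsilon> *\<^sub>R z) / \<epsilon>)) * indicator (cball 0 R) (\<epsilon> *\<^sub>R z) \<partial>perp_lborel e) = kern_mass e (R / \<epsilon>)"
    unfolding kern_mass_def using \<epsilon> by (intro nn_integral_cong) (auto simp: indicator_def field_simps)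
  finally show "(\<integral>\<^sup>+z. ennreal (kern DIM('a) (norm z / \<epsilon>)) * indicator (cball 0 R) z \<partial>perp_lborel e) =
      ennreal (\<epsilon> ^ (DIM('a) - 1)) * kern_mass e (R / \<epsilon>)" .
  show "(\<integral>\<^sup>+z. ennreal (kern DIM('a) (norm z / \<epsilon>)) \<partial>perp_lborel e) =
      ennreal (\<epsilon> ^ (DIM('a) - 1)) * kern_total e"
    using nn_integral_perp_lborel_scale[OF e \<epsilon>, of "\<lambda>z. ennreal (kern DIM('a) (norm z / \<epsilon>))"] \<epsilon> by simp
qed

text \<open>
  Replacing the chords by the central one gives the upper bound; keeping only those at a distance of
  at most \<open>(1 - t) \<rho>\<close> gives the lower one, where y in K makes the central chord at
  least 2 norm y long. The constant is the same in both bounds.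
\<close>

lemma kern_potential_bounds:
  fixes K :: "'a::euclidean_space set" and e y :: 'a
  assumes K: "compact K" "convex K" "\<And>x. x \<in> K \<Longrightarrow> - x \<in> K" and e: "norm e = 1" and \<epsilon>: "\<epsilon> > 0" and y: "y \<noteq> 0"
    and dim: "2 \<le> DIM('a)"
  defines "\<kappa> \<equiv> 2 * pi * sqrt pi ^ (DIM('a) - 2) * \<epsilon> ^ (DIM('a) - 2)"
  shows "kern_potential K \<epsilon> y \<le> ennreal \<kappa> * kern_total e * radial K y"
    and "y \<in> K \<Longrightarrow> cball 0 \<rho> \<subseteq> K \<Longrightarrow> 0 < t \<Longrightarrow> t < 1 \<Longrightarrow>
      ennreal \<kappa> * (ennreal t * kern_mass e ((1 - t) * \<rho> / \<epsilon>)) \<le> kern_potential K \<epsilon> y"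
proof -
  have [measurable]: "K \<in> sets borel" using K(1) by (rule borel_compact)
  have [measurable]: "cball (0::'a) R \<in> sets borel" for R by (auto intro: borel_closed)
  define r where "r = norm y"
  define u where "u = y /\<^sub>R r"
  have u: "norm u = 1" "r > 0" "y = r *\<^sub>R u" using y by (auto simp: u_def r_def)
  have [measurable]: "chord K u \<in> borel_measurable borel" unfolding chord_def[abs_def] by measurable
  define A where "A = pi * sqrt pi ^ (DIM('a) - 2)"
  have A: "A > 0" by (simp add: A_def)
  obtain m where m: "DIM('a) = Suc (Suc m)" using dim by (metis Suc_le_D numeral_2_eq_2 Suc_le_mono)
  have fac: "A / (r * \<epsilon>) * \<epsilon> ^ (DIM('a) - 1) * (2 * r) = \<kappa>"
    using u(2) \<epsilon> by (simp add: \<kappa>_def A_def m)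
  have mass: "kern_total u = kern_total e"
    using nn_integral_perp_lborel_turn[OF e u(1), of "\<lambda>z. ennreal (kern DIM('a) (norm z))"] by simp
  have pot: "kern_potential K \<epsilon> y = ennreal (A / (r * \<epsilon>)) *
    (\<integral>\<^sup>+z. ennreal (kern DIM('a) (norm z / \<epsilon>)) * chord K u z \<partial>perp_lborel u)"
    unfolding u(3) A_def by (rule kern_potential_slices) (use u \<epsilon> in auto)
  have "(\<integral>\<^sup>+z. ennreal (kern DIM('a) (norm z / \<epsilon>)) * chord K u z \<partial>perp_lborel u) \<le>
    (\<integral>\<^sup>+z. ennreal (kern DIM('a) (norm z / \<epsilon>)) * chord K u 0 \<partial>perp_lborel u)"
    by (intro nn_integral_mono mult_left_mono chord_le_central K u) simp_all
  also have "\<dots> = ennreal (\<epsilon> ^ (DIM('a) - 1)) * kern_total e * chord K u 0"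
    unfolding mass[symmetric] kern_scaled_mass(2)[OF u(1) \<epsilon>, symmetric] by (rule nn_integral_multc) measurable
  also have "chord K u 0 = ennreal (2 * r) * radial K y"
    unfolding u(3) by (rule chord_central) (use K u in auto)
  finally have "kern_potential K \<epsilon> y \<le> ennreal (A / (r * \<epsilon>)) * (ennreal (\<epsilon> ^ (DIM('a) - 1)) *
    kern_total e * (ennreal (2 * r) * radial K y))"
    unfolding pot by (rule mult_left_mono) simp
  also have "\<dots> = (ennreal (A / (r * \<epsilon>)) * ennreal (\<epsilon> ^ (DIM('a) - 1)) * ennreal (2 * r)) *
    kern_total e * radial K y" by (simp only: mult_ac)
  also have "ennreal (A / (r * \<epsilon>)) * ennreal (\<epsilon> ^ (DIM('a) - 1)) * ennreal (2 * r) = ennreal \<kappa>"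
    unfolding fac[symmetric] using A u(2) \<epsilon> by (simp only: ennreal_mult divide_nonneg_nonneg mult_nonneg_nonneg less_imp_le zero_le_power zero_le_numeral)
  finally show "kern_potential K \<epsilon> y \<le> ennreal \<kappa> * kern_total e * radial K y" .
  assume yK: "y \<in> K" and \<rho>: "cball 0 \<rho> \<subseteq> K" and t: "0 < t" "t < 1"
  have "ennreal (\<epsilon> ^ (DIM('a) - 1)) * kern_mass e ((1 - t) * \<rho> / \<epsilon>) * ennreal (2 * t * r) =
    (\<integral>\<^sup>+z. ennreal (kern DIM('a) (norm z / \<epsilon>)) * indicator (cball 0 ((1 - t) * \<rho>)) z * ennreal (2 * t * r) \<partial>perp_lborel u)"
    unfolding kern_mass_indep[OF u(1) e] kern_scaled_mass(1)[OF u(1) \<epsilon>, symmetric] by (rule nn_integral_multc[symmetric]) measurable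
  also have "\<dots> \<le> (\<integral>\<^sup>+z. ennreal (kern DIM('a) (norm z / \<epsilon>)) * chord K u z \<partial>perp_lborel u)"
  proof (rule nn_integral_mono)
    fix z
    show "ennreal (kern DIM('a) (norm z / \<epsilon>)) * indicator (cball 0 ((1 - t) * \<rho>)) z * ennreal (2 * t * r) \<le>
      ennreal (kern DIM('a) (norm z / \<epsilon>)) * chord K u z"
    proof (cases "norm z \<le> (1 - t) * \<rho>")
      case True
      then have "ennreal (2 * t * r) \<le> chord K u z"
        using yK u by (intro chord_ge[OF K(2,3) \<rho> t]) auto
      then show ?thesis using True by (simp add: mult_left_mono)
    qed simp
  qed
  finally have "ennreal (A / (r * \<epsilon>)) * (ennreal (\<epsilon> ^ (DIM('a) - 1)) * kern_mass e ((1 - t) * \<rho> / \<epsilon>) * ennreal (2 * t * r)) \<le> kern_potential K \<epsilon> y"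
    unfolding pot by (rule mult_left_mono) simp
  moreover have "ennreal (A / (r * \<epsilon>)) * (ennreal (\<epsilon> ^ (DIM('a) - 1)) * kern_mass e ((1 - t) * \<rho> / \<epsilon>) * ennreal (2 * t * r)) =
    ennreal \<kappa> * (ennreal t * kern_mass e ((1 - t) * \<rho> / \<epsilon>))"
  proof -
    have "ennreal (2 * t * r) = ennreal t * ennreal (2 * r)"
      using t u(2) by (simp add: ennreal_mult'[symmetric] mult_ac)
    moreover have "ennreal \<kappa> = ennreal (A / (r * \<epsilon>)) * ennreal (\<epsilon> ^ (DIM('a) - 1)) * ennreal (2 * r)"
      unfolding fac[symmetric] using A u(2) \<epsilon> by (simp only: ennreal_mult divide_nonneg_nonneg mult_nonneg_nonneg less_imp_le zero_le_power zero_le_numeral)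
    ultimately show ?thesis by (simp only: mult_ac)
  qed
  ultimately show "ennreal \<kappa> * (ennreal t * kern_mass e ((1 - t) * \<rho> / \<epsilon>)) \<le> kern_potential K \<epsilon> y" by simp
qed

lemma kern_mass_tendsto:
  fixes e :: "'a::euclidean_space"
  assumes e: "norm e = 1" and dim: "2 \<le> DIM('a)" "DIM('a) \<le> 4"
  shows "(\<lambda>k. kern_mass e (real k)) \<longlonglongrightarrow> kern_total e"
  unfolding kern_mass_def
proof (rule nn_integral_dominated_convergence[where w = "\<lambda>z. ennreal (kern DIM('a) (norm z))"])
  have [measurable]: "cball (0::'a) R \<in> sets borel" for R by (auto intro: borel_closed)
  show "(\<lambda>z. ennreal (kern DIM('a) (norm z)) * indicator (cball 0 (real k)) z) \<in> borel_measurable (perp_lborel e)" for k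
    by measurable
  show "AE z in perp_lborel e. ennreal (kern DIM('a) (norm z)) * indicator (cball 0 (real k)) z \<le> ennreal (kern DIM('a) (norm z))" for k
    by (rule AE_I2) (simp add: indicator_def)
  show "AE z in perp_lborel e. (\<lambda>k. ennreal (kern DIM('a) (norm z)) * indicator (cball 0 (real k)) z) \<longlonglongrightarrow> ennreal (kern DIM('a) (norm z))"
  proof (rule AE_I2)
    fix z :: 'a
    obtain N where "norm z \<le> real N" using real_arch_simple by blast
    then have "eventually (\<lambda>k. ennreal (kern DIM('a) (norm z)) * indicator (cball 0 (real k)) z = ennreal (kern DIM('a) (norm z))) sequentially"
      by (intro eventually_sequentiallyI[of N]) (auto simp: indicator_def)
    then show "(\<lambda>k. ennreal (kern DIM('a) (norm z)) * indicator (cball 0 (real k)) z) \<longlonglongrightarrow> ennreal (kern DIM('a) (norm z))"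
      by (rule tendsto_eventually)
  qed
qed (use kern_mass_finite[OF e dim] in auto)

text \<open>
  The comparison of sections is applied to Q = the kernel potential. On the left it is at least
  \<open>\<kappa>\<close> times almost the total mass m of the kernel, for y in K; on the right it is
  at most \<open>\<kappa>\<close> m times the radial function. Then \<open>\<kappa>\<close> cancels,
  and t and the truncation R' tend to 1 and infinity.
\<close>

lemma measure_le_gauss_radial:
  fixes K :: "'a::euclidean_space set" and g :: "'a \<Rightarrow> ennreal"
  assumes K: "compact K" "convex K" "\<And>x. x \<in> K \<Longrightarrow> - x \<in> K" "0 \<in> interior K" and dim: "2 \<le> DIM('a)" "DIM('a) \<le> 4"
    and [measurable]: "g \<in> borel_measurable borel"
    and bound: "\<And>x. g x \<le> C * indicator K x" "C < \<infinity>"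
    and usc: "\<And>X x. X \<longlonglongrightarrow> x \<Longrightarrow> limsup (\<lambda>k. g (X k)) \<le> g x"
    and sec: "\<And>e. norm e = 1 \<Longrightarrow> (\<integral>\<^sup>+z. g z \<partial>perp_lborel e) \<le> M"
  shows "ennreal (sqrt (2 * pi) ^ (DIM('a) - 1)) * (\<integral>\<^sup>+y. g y \<partial>lborel) \<le>
    M * (\<integral>\<^sup>+y. gauss (1/2) y * radial K y \<partial>lborel)"
proof -
  have Kb [measurable]: "K \<in> sets borel" using K(1) by (rule borel_compact)
  have [measurable]: "radial K \<in> borel_measurable borel" unfolding radial_def[abs_def] by measurable
  obtain R where R: "\<And>x. x \<in> K \<Longrightarrow> norm x \<le> R" using K(1) by (meson bounded_iff compact_imp_bounded)
  have bound': "g x \<le> C * indicator (cball 0 R) x" for x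
  proof -
    have "C * indicator K x \<le> C * indicator (cball 0 R) x"
      using R by (intro mult_left_mono) (auto simp: indicator_def)
    then show ?thesis using bound(1)[of x] by (rule order_trans[rotated])
  qed
  obtain \<rho> where \<rho>: "\<rho> > 0" "cball 0 \<rho> \<subseteq> K" using K(4) by (auto simp: mem_interior_cball)
  obtain e :: 'a where "e \<in> Basis" using nonempty_Basis by blast
  then have e: "norm e = 1" by simp
  define q where "q = ennreal (sqrt (2 * pi) ^ (DIM('a) - 1))"
  define Y where "Y = (\<integral>\<^sup>+y. gauss (1/2) y * radial K y \<partial>lborel)"
  define I where "I = (\<integral>\<^sup>+y. g y \<partial>lborel)"
  define m where "m = kern_total e"
  have m: "0 < m" "m < \<infinity>" using kern_mass_pos[OF e] kern_mass_finite[OF e dim] by (auto simp: m_def)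
  have I_fin: "I < \<infinity>"
  proof -
    have "I \<le> (\<integral>\<^sup>+y. C * indicator K y \<partial>lborel)" unfolding I_def by (intro nn_integral_mono bound)
    also have "\<dots> < \<infinity>" using bound(2) emeasure_compact_finite[OF K(1)]
      by (simp add: nn_integral_cmult_indicator ennreal_mult_less_top)
    finally show ?thesis .
  qed
  have key: "q * I * (ennreal t * kern_mass e R') \<le> M * Y * m" if t: "0 < t" "t < 1" and R': "R' > 0" for t R'
  proof -
\<comment> \<open>At this scale the distance (1 - t) \<open>\<rho>\<close> in the lower bound corresponds to the radius R' of the unscaled kernel.\<close>
    define \<epsilon> where "\<epsilon> = (1 - t) * \<rho> / R'"
    have \<epsilon>: "\<epsilon> > 0" "(1 - t) * \<rho> / \<epsilon> = R'" using t R' \<rho>(1) by (auto simp: \<epsilon>_def)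
    define \<kappa> where "\<kappa> = 2 * pi * sqrt pi ^ (DIM('a) - 2) * \<epsilon> ^ (DIM('a) - 2)"
    have \<kappa>: "\<kappa> > 0" using \<epsilon> by (simp add: \<kappa>_def)
    have pot_le: "kern_potential K \<epsilon> y \<le> ennreal \<kappa> * m * radial K y" if "y \<noteq> 0" for y
      unfolding \<kappa>_def m_def by (rule kern_potential_bounds(1)[OF K(1,2) _ e \<epsilon>(1) that dim(1)]) (rule K(3))
    have pot_ge: "ennreal \<kappa> * (ennreal t * kern_mass e R') \<le> kern_potential K \<epsilon> y" if "y \<noteq> 0" "y \<in> K" for y
      unfolding \<kappa>_def \<epsilon>(2)[symmetric]
      by (rule kern_potential_bounds(2)[OF K(1,2) _ e \<epsilon>(1) that(1) dim(1) that(2) \<rho>(2) t]) (rule K(3))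
    obtain P D where P: "P \<in> borel_measurable borel" "D < \<infinity>" "\<And>\<xi>. P \<xi> \<le> D * gauss 1 \<xi>"
      "\<And>y. y \<noteq> 0 \<Longrightarrow> (\<lambda>k. thin_transform P k y) \<longlonglongrightarrow> kern_potential K \<epsilon> y"
      using exists_kernel_weight[OF K(1,2) _ dim \<epsilon>(1)] K(3) by blast
    have [measurable]: "kern_potential K \<epsilon> \<in> borel_measurable borel" by (rule borel_measurable_kern_potential[OF Kb])
    have "q * (\<integral>\<^sup>+y. g y * kern_potential K \<epsilon> y \<partial>lborel) \<le> M * (\<integral>\<^sup>+y. gauss (1/2) y * kern_potential K \<epsilon> y \<partial>lborel)"
      unfolding q_def 
    proof (rule section_comparison[OF dim(1) _ P(1) _ bound' bound(2) _ _ P(3,2)])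
      show "limsup (\<lambda>k. g (X k)) \<le> g x" if "X \<longlonglongrightarrow> x" for X x by (rule usc[OF that])
      show "(\<integral>\<^sup>+z. g z \<partial>perp_lborel e) \<le> M" if "norm e = 1" for e by (rule sec[OF that])
      show "(\<lambda>k. thin_transform P k y) \<longlonglongrightarrow> kern_potential K \<epsilon> y" if "y \<noteq> 0" for y
        by (rule P(4)[OF that])
    qed measurable
    also have "\<dots> \<le> M * (ennreal \<kappa> * m * Y)"
    proof (rule mult_left_mono)
      have "(\<integral>\<^sup>+y. gauss (1/2) y * kern_potential K \<epsilon> y \<partial>lborel) \<le>
        (\<integral>\<^sup>+y. (ennreal \<kappa> * m) * (gauss (1/2) y * radial K y) \<partial>lborel)"
      proof (rule nn_integral_lborel_mono_nonzero)
        fix y :: 'a assume "y \<noteq> 0"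
        then have "gauss (1/2) y * kern_potential K \<epsilon> y \<le> gauss (1/2) y * (ennreal \<kappa> * m * radial K y)"
          by (intro mult_left_mono pot_le) auto
        then show "gauss (1/2) y * kern_potential K \<epsilon> y \<le> (ennreal \<kappa> * m) * (gauss (1/2) y * radial K y)"
          by (simp only: mult_ac)
      qed
      also have "\<dots> = ennreal \<kappa> * m * Y" unfolding Y_def by (rule nn_integral_cmult) measurable
      finally show "(\<integral>\<^sup>+y. gauss (1/2) y * kern_potential K \<epsilon> y \<partial>lborel) \<le> ennreal \<kappa> * m * Y" .
    qed simp
    finally have up: "q * (\<integral>\<^sup>+y. g y * kern_potential K \<epsilon> y \<partial>lborel) \<le> M * (ennreal \<kappa> * m * Y)" .
    have "I * (ennreal \<kappa> * (ennreal t * kern_mass e R')) = (\<integral>\<^sup>+y. g y * (ennreal \<kappa> * (ennreal t * kern_mass e R')) \<partial>lborel)"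
      unfolding I_def by (rule nn_integral_multc[symmetric]) measurable
    also have "\<dots> \<le> (\<integral>\<^sup>+y. g y * kern_potential K \<epsilon> y \<partial>lborel)"
    proof (rule nn_integral_lborel_mono_nonzero)
      fix y :: 'a assume y: "y \<noteq> 0"
      show "g y * (ennreal \<kappa> * (ennreal t * kern_mass e R')) \<le> g y * kern_potential K \<epsilon> y"
      proof (cases "y \<in> K")
        case True
        then show ?thesis using pot_ge[OF y True] by (intro mult_left_mono) auto
      next
        case False
        then show ?thesis using bound(1)[of y] by simp
      qed
    qed
    finally have "q * (I * (ennreal \<kappa> * (ennreal t * kern_mass e R'))) \<le> M * (ennreal \<kappa> * m * Y)"
      using up by (meson mult_left_mono order_trans zero_le)
    then have "ennreal \<kappa> * (q * I * (ennreal t * kern_mass e R')) \<le> ennreal \<kappa> * (M * Y * m)"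
      by (simp only: mult_ac)
    then show ?thesis using \<kappa> by (subst (asm) ennreal_mult_le_mult_iff) auto
  qed
  have "(\<lambda>k. ennreal (1 - 1 / real (Suc (Suc k))) * kern_mass e (real (Suc k))) \<longlonglongrightarrow> ennreal (1 - 0) * m"
  proof (intro tendsto_mult_ennreal tendsto_ennrealI tendsto_diff tendsto_const)
    show "(\<lambda>k. 1 / real (Suc (Suc k))) \<longlonglongrightarrow> 0"
      by (intro real_tendsto_divide_at_top[OF tendsto_const] filterlim_compose[OF filterlim_real_sequentially]
          filterlim_compose[OF filterlim_Suc filterlim_Suc])
    show "(\<lambda>k. kern_mass e (real (Suc k))) \<longlonglongrightarrow> m"
      unfolding m_def by (rule LIMSEQ_Suc[OF kern_mass_tendsto[OF e dim]])
  qed (use m in auto)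
  then have "(\<lambda>k. (q * I) * (ennreal (1 - 1 / real (Suc (Suc k))) * kern_mass e (real (Suc k)))) \<longlonglongrightarrow> (q * I) * (ennreal (1 - 0) * m)"
    using I_fin by (intro ennreal_tendsto_cmult) (auto simp: q_def ennreal_mult_less_top)
  then have "(q * I) * (ennreal (1 - 0) * m) \<le> M * Y * m"
    by (rule LIMSEQ_le_const2) (use key in auto)
  then have "m * (q * I) \<le> m * (M * Y)" by (simp add: mult_ac)
  then have "q * I \<le> M * Y" using m by (subst (asm) ennreal_mult_le_mult_iff) auto
  then show ?thesis by (simp add: q_def I_def Y_def)
qed

section \<open>The hyperplane inequality\<close>

lemma section_measure_eq_enn2real:
  fixes f :: "'a::euclidean_space \<Rightarrow> real"
  assumes "continuous_on UNIV f" "\<And>x. f x > 0" and [measurable]: "K \<in> sets borel" and \<xi>: "norm \<xi> = 1"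
  shows "section_measure f K \<xi> = enn2real (\<integral>\<^sup>+z. ennreal (f z) * indicator K z \<partial>perp_lborel \<xi>)"
proof -
  have [measurable]: "f \<in> borel_measurable borel" using assms(1) by (rule borel_measurable_continuous_onI)
  have [measurable]: "perp_hyperplane \<xi> \<in> sets borel"
    by (rule borel_closed) (simp add: closed_subspace subspace_perp_hyperplane)
  have "section_measure f K \<xi> = enn2real (\<integral>\<^sup>+z. ennreal (indicator (K \<inter> perp_hyperplane \<xi>) z *\<^sub>R f z) \<partial>perp_lborel \<xi>)"
    unfolding section_measure_def set_lebesgue_integral_def
    using assms(2) by (intro integral_eq_nn_integral) (auto simp: less_imp_le)
  also have "(\<integral>\<^sup>+z. ennreal (indicator (K \<inter> perp_hyperplane \<xi>) z *\<^sub>R f z) \<partial>perp_lborel \<xi>) =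
    (\<integral>\<^sup>+z. ennreal (f z) * indicator K z \<partial>perp_lborel \<xi>)"
  proof (rule nn_integral_perp_cong[OF \<xi>])
    fix z assume "z \<bullet> \<xi> = 0"
    then show "ennreal (indicator (K \<inter> perp_hyperplane \<xi>) z *\<^sub>R f z) = ennreal (f z) * indicator K z"
      by (simp add: perp_hyperplane_def indicator_def)
  qed
  finally show ?thesis .
qed

lemma body_measure_eq_enn2real:
  fixes f :: "'a::euclidean_space \<Rightarrow> real"
  assumes "continuous_on UNIV f" "\<And>x. f x > 0" and [measurable]: "K \<in> sets borel"
  shows "body_measure f K = enn2real (\<integral>\<^sup>+z. ennreal (f z) * indicator K z \<partial>lborel)"
proof -
  have [measurable]: "f \<in> borel_measurable borel" using assms(1) by (rule borel_measurable_continuous_onI)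
  have "body_measure f K = enn2real (\<integral>\<^sup>+z. ennreal (indicator K z *\<^sub>R f z) \<partial>lborel)"
    unfolding body_measure_def set_lebesgue_integral_def
    using assms(2) by (intro integral_eq_nn_integral) (auto simp: less_imp_le)
  also have "(\<integral>\<^sup>+z. ennreal (indicator K z *\<^sub>R f z) \<partial>lborel) = (\<integral>\<^sup>+z. ennreal (f z) * indicator K z \<partial>lborel)"
    by (intro nn_integral_cong) (simp add: indicator_def)
  finally show ?thesis .
qed

lemma limsup_indicator_times_continuous:
  fixes f :: "'a::euclidean_space \<Rightarrow> real"
  assumes "continuous_on UNIV f" "closed K" and X: "X \<longlonglongrightarrow> x"
  shows "limsup (\<lambda>k. ennreal (f (X k)) * indicator K (X k)) \<le> ennreal (f x) * indicator K x"
proof (cases "x \<in> K")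
  case True
  have "isCont f x" using assms(1) by (simp add: continuous_on_eq_continuous_at)
  then have "(\<lambda>k. f (X k)) \<longlonglongrightarrow> f x" using X by (rule isCont_tendsto_compose)
  then have "(\<lambda>k. ennreal (f (X k))) \<longlonglongrightarrow> ennreal (f x)" by (rule tendsto_ennrealI)
  then have lim: "limsup (\<lambda>k. ennreal (f (X k))) = ennreal (f x)"
    by (metis lim_imp_Limsup trivial_limit_sequentially)
  have "limsup (\<lambda>k. ennreal (f (X k)) * indicator K (X k)) \<le> limsup (\<lambda>k. ennreal (f (X k)))"
    by (intro Limsup_mono always_eventually) (simp add: indicator_def)
  then show ?thesis using True lim by simp
next
  case False
  then have "eventually (\<lambda>k. X k \<in> - K) sequentially"
    using X assms(2) by (intro topological_tendstoD) auto
  then have "eventually (\<lambda>k. ennreal (f (X k)) * indicator K (X k) = 0) sequentially"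
    by eventually_elim simp
  then have "(\<lambda>k. ennreal (f (X k)) * indicator K (X k)) \<longlonglongrightarrow> 0" by (rule tendsto_eventually)
  then have "limsup (\<lambda>k. ennreal (f (X k)) * indicator K (X k)) = 0"
    by (metis lim_imp_Limsup trivial_limit_sequentially)
  then show ?thesis by simp
qed

theorem theorem1:
  fixes f :: "real ^ 'n \<Rightarrow> real" and K :: "(real ^ 'n) set" and n :: nat
  assumes "CARD('n) = n" and "2 \<le> n" and "n \<le> 4"
    and "continuous_on UNIV f" and "\<And>x. f x > 0" and "\<And>x. f (- x) = f x"
    and "convex_body K" and "origin_symmetric K"
  shows "\<exists>\<xi>\<in>sphere 0 1.
           (\<forall>\<eta>\<in>sphere 0 1. section_measure f K \<eta> \<le> section_measure f K \<xi>) \<and>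
           body_measure f K \<le>
             real n / (real n - 1) * section_measure f K \<xi> * measure lborel K powr (1 / real n)"
proof -
  have n: "DIM(real ^ 'n) = n" using assms(1) by simp
  have K: "compact K" "convex K" "0 \<in> interior K" using assms(7) by (auto simp: convex_body_def)
  have sym: "- x \<in> K" if "x \<in> K" for x using assms(8) that by (auto simp: origin_symmetric_def)
  have Kb [measurable]: "K \<in> sets borel" using K(1) by (rule borel_compact)
  have f [measurable]: "f \<in> borel_measurable borel" using assms(4) by (rule borel_measurable_continuous_onI)
  define g where "g x = ennreal (f x) * indicator K x" for x
  have gm [measurable]: "g \<in> borel_measurable borel" unfolding g_def[abs_def] by measurable
  have usc: "limsup (\<lambda>k. g (X k)) \<le> g x" if "X \<longlonglongrightarrow> x" for X x
    unfolding g_def by (rule limsup_indicator_times_continuous[OF assms(4) compact_imp_closed[OF K(1)] that])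
  have "compact (f ` K)" by (rule compact_continuous_image[OF continuous_on_subset[OF assms(4) subset_UNIV] K(1)])
  then have "bounded (f ` K)" by (rule compact_imp_bounded)
  then obtain C where C_norm: "\<forall>y\<in>f ` K. norm y \<le> C" unfolding bounded_iff by meson
  have C: "f x \<le> C" if "x \<in> K" for x
  proof -
    have "norm (f x) \<le> C" using C_norm imageI[OF that, of f] by (rule bspec)
    then show ?thesis by simp
  qed
  have gC: "g x \<le> ennreal C * indicator K x" for x
    using C[of x] by (cases "x \<in> K") (auto simp: g_def intro!: ennreal_leI)
  obtain R where R: "\<And>x. x \<in> K \<Longrightarrow> norm x \<le> R" using K(1) by (meson bounded_iff compact_imp_bounded)
  have gR: "g x \<le> ennreal C * indicator (cball 0 R) x" for x
  proof -
    have "ennreal C * indicator K x \<le> ennreal C * indicator (cball 0 R) x"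
      using R by (intro mult_left_mono) (auto simp: indicator_def)
    then show ?thesis using gC[of x] by (rule order_trans[rotated])
  qed
  define J where "J \<xi> = (\<integral>\<^sup>+z. g z \<partial>perp_lborel \<xi>)" for \<xi>
  have "\<exists>\<xi>\<in>sphere 0 1. \<forall>\<eta>\<in>sphere 0 1. J \<eta> \<le> J \<xi>"
    unfolding J_def
  proof (rule sections_attain_max[OF gm gR])
    show "limsup (\<lambda>k. g (X k)) \<le> g x" if "X \<longlonglongrightarrow> x" for X x by (rule usc[OF that])
  qed simp
  then obtain \<xi> where \<xi>: "\<xi> \<in> sphere 0 1" "\<And>\<eta>. \<eta> \<in> sphere 0 1 \<Longrightarrow> J \<eta> \<le> J \<xi>" by blast
  have J_fin: "J \<xi> < \<infinity>"
  proof -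
    have "J \<xi> \<le> (\<integral>\<^sup>+z. ennreal C * indicator (cball 0 R) z \<partial>perp_lborel \<xi>)"
      unfolding J_def by (intro nn_integral_mono gR)
    also have "\<dots> < \<infinity>"
      using emeasure_perp_cball_finite[of \<xi> R] \<xi>(1)
      by (subst nn_integral_cmult_indicator) (auto simp: ennreal_mult_less_top)
    finally show ?thesis .
  qed
  have sec: "section_measure f K \<eta> = enn2real (J \<eta>)" if "\<eta> \<in> sphere 0 1" for \<eta>
    using section_measure_eq_enn2real[OF assms(4,5) Kb, of \<eta>] that by (simp add: J_def g_def)
  define V where "V = measure lborel K"
  have V: "V > 0"
  proof -
    obtain \<rho> where \<rho>: "\<rho> > 0" "cball 0 \<rho> \<subseteq> K" using K(3) by (auto simp: mem_interior_cball)
    have "0 < measure lborel (cball (0 :: real ^ 'n) \<rho>)" using \<rho>(1) by (rule content_cball_pos)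
    also have "\<dots> \<le> V" unfolding V_def using \<rho>(2) emeasure_compact_finite[OF K(1)]
      by (intro measure_mono_fmeasurable fmeasurableI) auto
    finally show ?thesis .
  qed
  define q where "q = sqrt (2 * pi) ^ (n - 1)"
  have q: "q > 0" by (simp add: q_def)
  define c where "c = real n / (real n - 1) * V powr (1 / real n)"
  have c: "c \<ge> 0" using assms(2) V by (simp add: c_def)
  have "ennreal q * (\<integral>\<^sup>+y. g y \<partial>lborel) \<le> J \<xi> * (\<integral>\<^sup>+y. gauss (1/2) y * radial K y \<partial>lborel)"
    unfolding q_def n[symmetric]
  proof (rule measure_le_gauss_radial[OF K(1,2) _ K(3) _ _ gm gC])
    show "limsup (\<lambda>k. g (X k)) \<le> g x" if "X \<longlonglongrightarrow> x" for X x by (rule usc[OF that])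
    show "(\<integral>\<^sup>+z. g z \<partial>perp_lborel e) \<le> J \<xi>" if "norm e = 1" for e
      using \<xi>(2)[of e] that by (simp add: J_def)
  qed (use assms(2,3) n J_fin sym in auto)
  also have "\<dots> \<le> J \<xi> * ennreal (q * c)"
    unfolding radial_def q_def c_def V_def n[symmetric]
    using V assms(2) emeasure_compact_finite[OF K(1)] n
    by (intro mult_left_mono nn_integral_gauss_radial_le) (auto simp: V_def)
  also have "\<dots> = ennreal q * (J \<xi> * ennreal c)" using q c by (simp add: ennreal_mult mult_ac)
  finally have "(\<integral>\<^sup>+y. g y \<partial>lborel) \<le> J \<xi> * ennreal c"
    using q by (subst (asm) ennreal_mult_le_mult_iff) auto
  then have "body_measure f K \<le> enn2real (J \<xi> * ennreal c)"
    unfolding body_measure_eq_enn2real[OF assms(4,5) Kb] g_def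
    using J_fin by (intro enn2real_mono) (auto simp: ennreal_mult_less_top)
  also have "\<dots> = real n / (real n - 1) * section_measure f K \<xi> * V powr (1 / real n)"
    using c by (simp add: enn2real_mult sec[OF \<xi>(1)] c_def mult_ac)
  finally have "body_measure f K \<le> real n / (real n - 1) * section_measure f K \<xi> * measure lborel K powr (1 / real n)"
    by (simp add: V_def)
  moreover have "section_measure f K \<eta> \<le> section_measure f K \<xi>" if "\<eta> \<in> sphere 0 1" for \<eta>
    unfolding sec[OF that] sec[OF \<xi>(1)] using J_fin by (intro enn2real_mono \<xi>(2) that) auto
  ultimately show ?thesis using \<xi>(1) by blast
qed

end
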